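(* Let $\alpha>0$, let $T$ be a separable metric space with Borel $\sigma$-algebra $\mathcal T$ and a $\sigma$-finite Borel measure $\lambda$, and let $\mathcal P_1,\dots,\mathcal P_n$ be disjoint positive cones in $L^0_+(T,\mathcal T,\lambda)$. Let $X=\{X_t\}_{t\in T}$ be an $\alpha$-Fréchet process with a jointly measurable spectral representation $\{f_t\}_{t\in T}\subset L_+^\alpha(S,\mu)$ of full support, where $(S,\mu)$ is a standard Lebesgue space, and suppose that $\{f_t\}$ has a co-spectral decomposition $S^{(1)},\dots,S^{(n)}$ w.r.t. $\{\mathcal P_j\}_{1\le j\le n}$. Consider the induced decomposition $$\{X_t\}_{t\in T}\stackrel d=\{X_t^{(1)}\vee\cdots\vee X_t^{(n)}\}_{t\in T},\qquad X_t^{(j)}=\int^e_{S^{(j)}}f_t(s)\,M_\alpha(ds),\quad t\in T,\ 1\le j\le n,$$ where $M_\alpha$ is an $\alpha$-Fréchet random sup-measure with control measure $\mu$. Then: (i) this decomposition is unique in distribution; that is, for each $j$ the law of $\{X_t^{(j)}\}_{t\in T}$ is invariant with respect to the choice of the co-spectral decomposition w.r.t. $\{\mathcal P_j\}_{1\le j\le n}$ and of the measurable spectral representation of $X$; (ii) the components $\{X_t^{(j)}\}_{t\in T}$, $1\le j\le n$, are independent $\alpha$-Fréchet processes.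
   Context: A standard Lebesgue space is a standard Borel space with a $\sigma$-finite measure. A random variable is $\alpha$-Fréchet with scale $\sigma>0$ if its distribution function is $\exp(-\sigma^\alpha x^{-\alpha})$, $x>0$; a process is $\alpha$-Fréchet if all $\max_{1\le j\le n}a_jX_{t_j}$, $a_j>0$, are $\alpha$-Fréchet. $L_+^\alpha(S,\mu)$ is the set of measurable $f:S\to[0,\infty)$ with $\int_Sf^\alpha d\mu<\infty$, with metric $\rho_{\mu,\alpha}(f,g)=\int_S|f^\alpha-g^\alpha|d\mu$. An $\alpha$-Fréchet random sup-measure $M_\alpha$ with control measure $\mu$ is a process indexed by measurable sets, independent over disjoint sets, with $M_\alpha(\bigcup_iA_i)=\bigvee_iM_\alpha(A_i)$ a.s. for disjoint $A_i$, $i\in\mathbb N$, and with $M_\alpha(A)$ $\alpha$-Fréchet of scale $\mu(A)^{1/\alpha}$. The extremal integral $\int^e_Sf\,dM_\alpha$ equals $\bigvee_ia_iM_\alpha(A_i)$ for non-negative simple $f=\sum_ia_i\mathbf 1_{A_i}$ with disjoint $A_i$, and is extended to $L_+^\alpha(S,\mu)$ by continuity in probability. $\{f_t\}\subset L_+^\alpha(S,\mu)$ is a spectral representation of $X$ if $\{X_t\}\stackrel d=\{\int^e_Sf_t\,dM_\alpha\}$, equivalently $P(X_{t_i}\le x_i,\,1\le i\le m)=\exp\{-\int_S(\bigvee_ix_i^{-1}f_{t_i})^\alpha d\mu\}$ for all $m$, $t_i\in T$, $x_i>0$. It is jointly measurable if $(t,s)\mapsto f_t(s)$ is measurable for the product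 $\sigma$-algebra on $T\times S$. It has full support if $\mathrm{supp}\{f_t:t\in T\}=S$ modulo $\mu$, where $\mathrm{supp}\{f_t:t\in T\}$ is $\{f_0\neq0\}$ (mod $\mu$) for any $f_0$ in the $\rho_{\mu,\alpha}$-closure $\mathcal F$ of the set of all $\bigvee_{1\le i\le m}a_if_{t_i}$ ($a_i>0$, $t_i\in T$) such that $\mu(\{g\ne0\}\setminus\{f_0\neq0\})=0$ for all $g\in\mathcal F$. $L^0_+(T,\mathcal T,\lambda)$ is the set of non-negative $\mathcal T$-measurable functions modulo $\lambda$-a.e. equality. A positive cone is a subset $\mathcal P$ with $c\mathcal P\subset\mathcal P$ for all $c\ge0$; cones $\mathcal P_1,\mathcal P_2$ are disjoint if $\mathcal P_1\cap\mathcal P_2=\{0\}$. Functions $t\mapsto f_t(s)$, $s$ fixed, are denoted $f_\cdot(s)$ and viewed as elements of $L_+^0(T,\mathcal T,\lambda)$. A jointly measurable representation $\{f_t\}$ of full support has a co-spectral decomposition w.r.t. $\{\mathcal P_j\}_{1\le j\le n}$ if there exist measurable sets $S^{(1)},\dots,S^{(n)}\subset S$ such that $S^{(j)}\subset\{s\in S:f_\cdot(s)\in\mathcal P_j\}$ for $1\le j\le n$ and $\mu(S\setminus\bigcup_{j=1}^nS^{(j)})=0$.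
   Formalization: Added assumption: for μ-almost every s, f_·(s) is not zero λ-a.e.; otherwise such points may be put in any S^(j), and (i), (ii) can fail. Also, α-Fréchet admits scale 0 (a variable that is 0 a.s.), since a component may vanish. *)

theory Defs
  imports "HOL-Probability.Probability"
begin

text \<open>Measure spaces\<close>

definition standard_borel :: "'a measure \<Rightarrow> bool" where
  "standard_borel M \<longleftrightarrow>
     (\<exists>X. completely_metrizable_space X \<and> separable_space X \<and> topspace X = space M \<and>
          sets M = sigma_sets (space M) {U. openin X U})"

definition standard_lebesgue :: "'a measure \<Rightarrow> bool" where
  "standard_lebesgue M \<longleftrightarrow> standard_borel M \<and> sigma_finite_measure M"


text \<open>Frechet variables and processes\<close>

text \<open>The degenerate scale \<open>\<sigma> = 0\<close> (a variable that vanishes almost surely) is admitted.  It occurs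
  for \<open>M\<^sub>\<alpha>(A)\<close> with \<open>\<mu>(A) = 0\<close>, and for extremal integrals of functions that vanish \<open>\<mu>\<close>-almost
  everywhere; a component of a decomposition may be of this kind.  For \<open>\<sigma> > 0\<close> the condition
  \<open>Y \<ge> 0\<close> a.s. follows from the one on the distribution function.\<close>

definition frechet_rv :: "'w measure \<Rightarrow> real \<Rightarrow> real \<Rightarrow> ('w \<Rightarrow> real) \<Rightarrow> bool" where
  "frechet_rv Pr \<alpha> \<sigma> Y \<longleftrightarrow>
     Y \<in> borel_measurable Pr \<and> 0 \<le> \<sigma> \<and> (AE \<omega> in Pr. 0 \<le> Y \<omega>) \<and>
     (\<forall>x>0. cdf (distr Pr borel Y) x = exp (- (\<sigma> powr \<alpha> * x powr (- \<alpha>))))"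

definition frechet_process :: "'w measure \<Rightarrow> real \<Rightarrow> ('t \<Rightarrow> 'w \<Rightarrow> real) \<Rightarrow> bool" where
  "frechet_process Pr \<alpha> X \<longleftrightarrow>
     (\<forall>m\<ge>1. \<forall>(t :: nat \<Rightarrow> 't) (a :: nat \<Rightarrow> real). (\<forall>j\<in>{1..m}. 0 < a j) \<longrightarrow>
        (\<exists>\<sigma>. frechet_rv Pr \<alpha> \<sigma> (\<lambda>\<omega>. MAX j\<in>{1..m}. a j * X (t j) \<omega>)))"

text \<open>The law on the product \<open>\<sigma>\<close>-algebra, which is determined by the finite-dimensional
  distributions.\<close>

definition process_law :: "'w measure \<Rightarrow> ('t \<Rightarrow> 'w \<Rightarrow> real) \<Rightarrow> ('t \<Rightarrow> real) measure" where
  "process_law Pr X = distr Pr (\<Pi>\<^sub>M t\<in>UNIV. borel) (\<lambda>\<omega> t. X t \<omega>)"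

definition indep_processes ::
    "'w measure \<Rightarrow> nat set \<Rightarrow> (nat \<Rightarrow> 't \<Rightarrow> 'w \<Rightarrow> real) \<Rightarrow> bool" where
  "indep_processes Pr I X \<longleftrightarrow>
     prob_space.indep_vars Pr (\<lambda>_. \<Pi>\<^sub>M t\<in>UNIV. borel) (\<lambda>j \<omega> t. X j t \<omega>) I"


text \<open>The space of \<open>\<alpha>\<close>-integrable non-negative functions\<close>

definition L_plus :: "real \<Rightarrow> 's measure \<Rightarrow> ('s \<Rightarrow> real) set" where
  "L_plus \<alpha> \<mu> = {f \<in> borel_measurable \<mu>. (\<forall>s\<in>space \<mu>. 0 \<le> f s) \<and> integrable \<mu> (\<lambda>s. f s powr \<alpha>)}"

definition rho :: "'s measure \<Rightarrow> real \<Rightarrow> ('s \<Rightarrow> real) \<Rightarrow> ('s \<Rightarrow> real) \<Rightarrow> real" where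
  "rho \<mu> \<alpha> f g = (\<integral>s. \<bar>f s powr \<alpha> - g s powr \<alpha>\<bar> \<partial>\<mu>)"


text \<open>Random sup-measures and extremal integrals\<close>

text \<open>Random sup-measures take values in \<open>[0,\<infinity>]\<close>, with \<open>M\<^sub>\<alpha>(A) = \<infinity>\<close> almost surely (infinite scale)
  when \<open>\<mu>(A) = \<infinity>\<close>.  Since \<open>A\<close> may be empty from some index on, independence of disjoint sequences
  includes that of finite disjoint families.\<close>

definition frechet_sup_measure ::
    "'w measure \<Rightarrow> real \<Rightarrow> 's measure \<Rightarrow> ('s set \<Rightarrow> 'w \<Rightarrow> ennreal) \<Rightarrow> bool" where
  "frechet_sup_measure Pr \<alpha> \<mu> M \<longleftrightarrow>
     (\<forall>A\<in>sets \<mu>. M A \<in> borel_measurable Pr \<and>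
        (if emeasure \<mu> A < \<infinity>
         then (AE \<omega> in Pr. M A \<omega> < \<infinity>) \<and>
              frechet_rv Pr \<alpha> (measure \<mu> A powr (1 / \<alpha>)) (\<lambda>\<omega>. enn2real (M A \<omega>))
         else (AE \<omega> in Pr. M A \<omega> = \<infinity>))) \<and>
     (\<forall>A :: nat \<Rightarrow> 's set. range A \<subseteq> sets \<mu> \<and> disjoint_family A \<longrightarrow>
        prob_space.indep_vars Pr (\<lambda>_. borel) (\<lambda>i. M (A i)) UNIV \<and>
        (AE \<omega> in Pr. M (\<Union>i. A i) \<omega> = (SUP i. M (A i) \<omega>)))"

text \<open>As for the library's integral of simple functions, \<open>f\<close> is written as \<open>\<Sum>\<^sub>y y 1\<^bsub>{f = y}\<^esub>\<close>, where
  \<open>y\<close> ranges over the finitely many values of \<open>f\<close>.  Note \<open>0 * \<infinity> = 0\<close>.\<close>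

definition simple_extremal_integral ::
    "('s set \<Rightarrow> 'w \<Rightarrow> ennreal) \<Rightarrow> 's measure \<Rightarrow> ('s \<Rightarrow> real) \<Rightarrow> 'w \<Rightarrow> ennreal" where
  "simple_extremal_integral M \<mu> f \<omega> =
     (SUP y\<in>f ` space \<mu>. ennreal y * M (f -` {y} \<inter> space \<mu>) \<omega>)"

text \<open>Extremal integrals are only defined up to almost sure equality, hence a relation: \<open>Y\<close> is a
  version of the integral of \<open>f\<close>.\<close>

definition has_extremal_integral ::
    "'w measure \<Rightarrow> real \<Rightarrow> 's measure \<Rightarrow> ('s set \<Rightarrow> 'w \<Rightarrow> ennreal) \<Rightarrow>
     ('s \<Rightarrow> real) \<Rightarrow> ('w \<Rightarrow> real) \<Rightarrow> bool" where
  "has_extremal_integral Pr \<alpha> \<mu> M f Y \<longleftrightarrow>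
     f \<in> L_plus \<alpha> \<mu> \<and> Y \<in> borel_measurable Pr \<and>
     (\<exists>g :: nat \<Rightarrow> 's \<Rightarrow> real.
        (\<forall>k. simple_function \<mu> (g k) \<and> g k \<in> L_plus \<alpha> \<mu>) \<and>
        (\<lambda>k. rho \<mu> \<alpha> (g k) f) \<longlonglongrightarrow> 0 \<and>
        (\<forall>\<epsilon>>0. (\<lambda>k. measure Pr {\<omega> \<in> space Pr.
            \<epsilon> < \<bar>enn2real (simple_extremal_integral M \<mu> (g k) \<omega>) - Y \<omega>\<bar>}) \<longlonglongrightarrow> 0))"


text \<open>Spectral representations\<close>

definition spectral_representation ::
    "'w measure \<Rightarrow> real \<Rightarrow> ('t \<Rightarrow> 'w \<Rightarrow> real) \<Rightarrow> 's measure \<Rightarrow> ('t \<Rightarrow> 's \<Rightarrow> real) \<Rightarrow> bool" where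
  "spectral_representation Pr \<alpha> X \<mu> f \<longleftrightarrow>
     (\<forall>t. f t \<in> L_plus \<alpha> \<mu>) \<and>
     (\<forall>m\<ge>1. \<forall>(t :: nat \<Rightarrow> 't) (x :: nat \<Rightarrow> real). (\<forall>i\<in>{1..m}. 0 < x i) \<longrightarrow>
        measure Pr {\<omega> \<in> space Pr. \<forall>i\<in>{1..m}. X (t i) \<omega> \<le> x i} =
        exp (- (\<integral>s. (MAX i\<in>{1..m}. f (t i) s / x i) powr \<alpha> \<partial>\<mu>)))"

definition jointly_measurable :: "'s measure \<Rightarrow> ('t::topological_space \<Rightarrow> 's \<Rightarrow> real) \<Rightarrow> bool" where
  "jointly_measurable \<mu> f \<longleftrightarrow> (\<lambda>(t, s). f t s) \<in> borel_measurable (borel \<Otimes>\<^sub>M \<mu>)"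

definition max_linear_combinations :: "('t \<Rightarrow> 's \<Rightarrow> real) \<Rightarrow> ('s \<Rightarrow> real) set" where
  "max_linear_combinations f =
     {(\<lambda>s. MAX i\<in>{1..m}. a i * f (t i) s) | (m :: nat) (a :: nat \<Rightarrow> real) (t :: nat \<Rightarrow> 't).
        1 \<le> m \<and> (\<forall>i\<in>{1..m}. 0 < a i)}"

definition max_linear_space ::
    "real \<Rightarrow> 's measure \<Rightarrow> ('t \<Rightarrow> 's \<Rightarrow> real) \<Rightarrow> ('s \<Rightarrow> real) set" where
  "max_linear_space \<alpha> \<mu> f =
     {g \<in> L_plus \<alpha> \<mu>. \<forall>\<epsilon>>0. \<exists>h\<in>max_linear_combinations f. rho \<mu> \<alpha> g h < \<epsilon>}"

text \<open>The support is unique only modulo \<open>\<mu>\<close>, hence a relation.\<close>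

definition is_support :: "real \<Rightarrow> 's measure \<Rightarrow> ('t \<Rightarrow> 's \<Rightarrow> real) \<Rightarrow> 's set \<Rightarrow> bool" where
  "is_support \<alpha> \<mu> f A \<longleftrightarrow>
     (\<exists>f0\<in>max_linear_space \<alpha> \<mu> f. A = {s \<in> space \<mu>. f0 s \<noteq> 0} \<and>
        (\<forall>g\<in>max_linear_space \<alpha> \<mu> f. emeasure \<mu> ({s \<in> space \<mu>. g s \<noteq> 0} - A) = 0))"

definition full_support :: "real \<Rightarrow> 's measure \<Rightarrow> ('t \<Rightarrow> 's \<Rightarrow> real) \<Rightarrow> bool" where
  "full_support \<alpha> \<mu> f \<longleftrightarrow> (\<exists>A. is_support \<alpha> \<mu> f A \<and> emeasure \<mu> (space \<mu> - A) = 0)"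


text \<open>Positive cones of functions modulo almost everywhere equality\<close>

definition nonneg_measurable :: "'t measure \<Rightarrow> ('t \<Rightarrow> real) set" where
  "nonneg_measurable lam = {g \<in> borel_measurable lam. \<forall>t\<in>space lam. 0 \<le> g t}"

definition ae_class :: "'t measure \<Rightarrow> ('t \<Rightarrow> real) \<Rightarrow> ('t \<Rightarrow> real) set" where
  "ae_class lam g = {h \<in> nonneg_measurable lam. AE t in lam. g t = h t}"

definition L0_plus :: "'t measure \<Rightarrow> ('t \<Rightarrow> real) set set" where
  "L0_plus lam = ae_class lam ` nonneg_measurable lam"

definition positive_cone :: "'t measure \<Rightarrow> ('t \<Rightarrow> real) set set \<Rightarrow> bool" where
  "positive_cone lam P \<longleftrightarrow>
     P \<subseteq> L0_plus lam \<and>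
     (\<forall>c\<ge>0. \<forall>g\<in>nonneg_measurable lam.
        ae_class lam g \<in> P \<longrightarrow> ae_class lam (\<lambda>t. c * g t) \<in> P)"

definition disjoint_cones :: "'t measure \<Rightarrow> nat \<Rightarrow> (nat \<Rightarrow> ('t \<Rightarrow> real) set set) \<Rightarrow> bool" where
  "disjoint_cones lam n P \<longleftrightarrow>
     (\<forall>j\<in>{1..n}. positive_cone lam (P j)) \<and>
     (\<forall>i\<in>{1..n}. \<forall>j\<in>{1..n}. i \<noteq> j \<longrightarrow> P i \<inter> P j = {ae_class lam (\<lambda>_. 0)})"


text \<open>Co-spectral decompositions\<close>

text \<open>Neither full support nor the cones prevent a point \<open>s\<close> whose co-spectral function is zero
  \<open>lam\<close>-almost everywhere from lying in several \<open>S j\<close>: full support refers to all \<open>t\<close>, the cones only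
  to \<open>lam\<close>-almost all \<open>t\<close>, and the zero class lies in every cone of a disjoint family of two or more.
  Results on decompositions therefore need the separate hypothesis that \<open>\<mu>\<close>-almost all co-spectral
  functions are nonzero in \<open>L0_plus lam\<close>.\<close>

definition cospectral_decomposition ::
    "'t measure \<Rightarrow> nat \<Rightarrow> (nat \<Rightarrow> ('t \<Rightarrow> real) set set) \<Rightarrow>
     's measure \<Rightarrow> ('t \<Rightarrow> 's \<Rightarrow> real) \<Rightarrow> (nat \<Rightarrow> 's set) \<Rightarrow> bool" where
  "cospectral_decomposition lam n P \<mu> f S \<longleftrightarrow>
     (\<forall>j\<in>{1..n}. S j \<in> sets \<mu> \<and>
        S j \<subseteq> {s \<in> space \<mu>. ae_class lam (\<lambda>t. f t s) \<in> P j}) \<and>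
     emeasure \<mu> (space \<mu> - (\<Union>j\<in>{1..n}. S j)) = 0"

definition induced_components ::
    "'w measure \<Rightarrow> real \<Rightarrow> 's measure \<Rightarrow> ('s set \<Rightarrow> 'w \<Rightarrow> ennreal) \<Rightarrow> ('t \<Rightarrow> 's \<Rightarrow> real) \<Rightarrow>
     nat \<Rightarrow> (nat \<Rightarrow> 's set) \<Rightarrow> (nat \<Rightarrow> 't \<Rightarrow> 'w \<Rightarrow> real) \<Rightarrow> bool" where
  "induced_components Pr \<alpha> \<mu> M f n S Y \<longleftrightarrow>
     (\<forall>j\<in>{1..n}. \<forall>t. has_extremal_integral Pr \<alpha> \<mu> M (\<lambda>s. f t s * indicator (S j) s) (Y j t))"

end

theory Submission
  imports Defs
begin

text \<open>
  Both parts rest on one formula.  For finitely many pairs \<open>(t, a)\<close> with \<open>a > 0\<close>, collected in a set \<open>K\<close>,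
  let \<open>q\<^sub>K = max (a f\<^sub>t)\<^sup>\<alpha>\<close> be the envelope of the family over \<open>K\<close>.  A process \<open>Z\<close> has the spectral law of
  \<open>(f, \<mu>)\<close> if the box event \<open>{a Z\<^sub>t \<le> 1 for all (t, a) \<in> K}\<close> has probability \<open>exp (- \<integral> q\<^sub>K d\<mu>)\<close> for
  all \<open>K\<close>.  A spectral representation says this about \<open>X\<close>.  For a family of extremal integrals it is
  proved in \<open>extremal_integral_box\<close>: for simple integrands on a common partition it is the
  independence of \<open>M\<^sub>\<alpha>\<close> over disjoint sets, and it survives the limit in probability because the
  exponent is continuous in the metric \<open>rho\<close>.  Box events determine the law of a non-negative process
  (\<open>distr_eqI_box_events\<close>) and its independence of others (\<open>indep_processesI\<close>).

  The sets \<open>S j\<close> are disjoint modulo \<open>\<mu>\<close>: on an overlap the co-spectral function would lie in two of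
  the cones, hence vanish, which happens only on a null set.  So the exponent of all components
  together is the sum of the integrals of \<open>q\<^sub>K\<close> over the \<open>S j\<close>.  This gives the identity in law with
  \<open>X\<close> and the independence; the components are Frechet since \<open>q\<^sub>K\<close> is homogeneous in the weights.

  Uniqueness requires \<open>\<integral>\<^sub>S\<^sub>j q\<^sub>K d\<mu> = \<integral>\<^sub>S\<^sub>'\<^sub>j q'\<^sub>K d\<mu>'\<close> for two representations \<open>f\<close> and \<open>f'\<close> of \<open>X\<close>, although only
  the integrals over the whole spaces are known to agree.  Map \<open>s\<close> to the sequence
  \<open>R s = (f\<^sub>D\<^sub>i(s)\<^sup>\<alpha> / q\<^sub>K(s))\<^sub>i\<close> for a sequence \<open>D\<close> of points of \<open>T\<close>, and give the spectral space the
  finite measure \<open>q\<^sub>K \<mu>\<close>.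
   \<^item> The law of \<open>R\<close> is a function of the exponents of \<open>f\<close>, so it is the same for \<open>f'\<close>: the mass of
     \<open>{Q \<le> q\<^sub>K}\<close> is the right derivative at 1 of \<open>y \<mapsto> \<integral> max (y q\<^sub>K) Q d\<mu>\<close>, and for \<open>Q\<close> an envelope
     these integrals are exponents (\<open>distr_ratio_eq\<close>).
   \<^item> \<open>D\<close> can be chosen so that \<open>R s\<close> determines \<open>f\<^sub>\<sqdot>(s)\<close> up to a factor and \<open>lam\<close>-null sets, by the same
     recipe for both representations: L1 is separable, so each \<open>f\<^sub>t\<^sup>\<alpha>\<close> is a limit of functions
     \<open>f\<^sub>D\<^sub>i\<^sup>\<alpha>\<close> with indices \<open>i\<close> that depend measurably on \<open>t\<close>; and \<open>rho\<close> distances are functions of the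
     exponents, so these indices serve for \<open>f'\<close> as well (\<open>AE_recovered_from_selection\<close>).
   \<^item> As the cones are disjoint, the image of \<open>S i\<close> under \<open>R\<close> therefore does not meet that of \<open>S j\<close> or
     \<open>S' j\<close> for \<open>j \<noteq> i\<close>, up to null sets.  In a standard Borel space the image of a measurable set
     contains a Borel set that carries all of its mass
     (\<open>standard_borel_image_contains_full_borel_set\<close>).  So there are disjoint Borel sets \<open>C j\<close> of
     sequences whose preimages are \<open>S j\<close> and \<open>S' j\<close> up to null sets, and both have the mass that the
     common law of \<open>R\<close> gives to \<open>C j\<close> (\<open>measure_eq_of_separated_images\<close>).
\<close>

section \<open>Weights, envelopes and spectral laws\<close>

text \<open>A set of pairs, and not a function of the index, lets one index carry several weights; unions of
  weight sets then always correspond to maxima of envelopes.\<close>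

definition positive_weights :: "('i \<times> real) set \<Rightarrow> bool" where
  "positive_weights K \<longleftrightarrow> finite K \<and> (\<forall>(i, a)\<in>K. 0 < a)"

definition box_event :: "'w measure \<Rightarrow> ('i \<Rightarrow> 'w \<Rightarrow> real) \<Rightarrow> ('i \<times> real) set \<Rightarrow> 'w set" where
  "box_event Pr Z K = {\<omega> \<in> space Pr. \<forall>(i, a)\<in>K. a * Z i \<omega> \<le> 1}"

text \<open>The inserted \<open>0\<close> makes the envelope over no weights zero, in accordance with the box event, which is
  then the whole space.\<close>

definition envelope :: "real \<Rightarrow> ('i \<Rightarrow> 's \<Rightarrow> real) \<Rightarrow> ('i \<times> real) set \<Rightarrow> 's \<Rightarrow> real" where
  "envelope \<alpha> g K s = Max (insert 0 ((\<lambda>(i, a). (a * g i s) powr \<alpha>) ` K))"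

abbreviation exponent :: "real \<Rightarrow> 's measure \<Rightarrow> ('i \<Rightarrow> 's \<Rightarrow> real) \<Rightarrow> ('i \<times> real) set \<Rightarrow> real" where
  "exponent \<alpha> \<mu> g K \<equiv> \<integral>s. envelope \<alpha> g K s \<partial>\<mu>"

text \<open>The weight \<open>a\<close> is the reciprocal of the threshold in the joint distribution function.\<close>

definition spectral_law ::
    "'w measure \<Rightarrow> real \<Rightarrow> ('i \<Rightarrow> 'w \<Rightarrow> real) \<Rightarrow> 's measure \<Rightarrow> ('i \<Rightarrow> 's \<Rightarrow> real) \<Rightarrow> bool" where
  "spectral_law Pr \<alpha> Z \<mu> g \<longleftrightarrow>
     (\<forall>K. positive_weights K \<longrightarrow> measure Pr (box_event Pr Z K) = exp (- exponent \<alpha> \<mu> g K))"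

lemma positive_weights_Un: "positive_weights K \<Longrightarrow> positive_weights L \<Longrightarrow> positive_weights (K \<union> L)"
  by (auto simp: positive_weights_def)

lemma positive_weights_finite: "positive_weights K \<Longrightarrow> finite K"
  by (simp add: positive_weights_def)

lemma positive_weightsD: "positive_weights K \<Longrightarrow> (i, a) \<in> K \<Longrightarrow> 0 < a"
  by (auto simp: positive_weights_def)

lemma positive_weights_image:
  "positive_weights K \<Longrightarrow> (\<And>i a. (i, a) \<in> K \<Longrightarrow> 0 < h i a) \<Longrightarrow> positive_weights ((\<lambda>(i, a). (\<phi> i a, h i a)) ` K)"
  by (auto simp: positive_weights_def)

lemma sets_box_event:
  assumes "finite K" "\<And>i a. (i, a) \<in> K \<Longrightarrow> Z i \<in> borel_measurable Pr"
  shows "box_event Pr Z K \<in> sets Pr"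
proof -
  have "box_event Pr Z K = {\<omega> \<in> space Pr. \<forall>p\<in>K. snd p * Z (fst p) \<omega> \<le> 1}"
    by (auto simp: box_event_def)
  moreover have [measurable]: "p \<in> K \<Longrightarrow> Z (fst p) \<in> borel_measurable Pr" for p
    using assms(2)[of "fst p" "snd p"] by simp
  have "{\<omega> \<in> space Pr. \<forall>p\<in>K. snd p * Z (fst p) \<omega> \<le> 1} \<in> sets Pr"
    using assms(1) by measurable
  ultimately show ?thesis by simp
qed

lemma envelope_empty [simp]: "envelope \<alpha> g {} s = 0"
  by (simp add: envelope_def)

lemma envelope_nonneg: "finite K \<Longrightarrow> 0 \<le> envelope \<alpha> g K s"
  by (simp add: envelope_def)

lemma envelope_le_iff:
  "finite K \<Longrightarrow> envelope \<alpha> g K s \<le> c \<longleftrightarrow> 0 \<le> c \<and> (\<forall>(i, a)\<in>K. (a * g i s) powr \<alpha> \<le> c)"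
  by (auto simp: envelope_def)

lemma envelope_ge: "finite K \<Longrightarrow> (i, a) \<in> K \<Longrightarrow> (a * g i s) powr \<alpha> \<le> envelope \<alpha> g K s"
  using envelope_le_iff[of K \<alpha> g s "envelope \<alpha> g K s"] by auto

lemma envelope_eqI:
  assumes "\<And>c. 0 \<le> c \<Longrightarrow> (x::real) \<le> c \<longleftrightarrow> (\<forall>(i, a)\<in>K. (a * g i s) powr \<alpha> \<le> c)" "0 \<le> x" "finite K"
  shows "envelope \<alpha> g K s = x"
proof (rule antisym)
  show "envelope \<alpha> g K s \<le> x" using assms by (subst envelope_le_iff) auto
  show "x \<le> envelope \<alpha> g K s"
    using assms(1)[of "envelope \<alpha> g K s"] envelope_ge[OF assms(3)] envelope_nonneg[OF assms(3)] by fastforce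
qed

lemma envelope_Un:
  "finite K \<Longrightarrow> finite L \<Longrightarrow> envelope \<alpha> g (K \<union> L) s = max (envelope \<alpha> g K s) (envelope \<alpha> g L s)"
  by (rule envelope_eqI) (auto simp: envelope_le_iff envelope_nonneg le_max_iff_disj)

lemma envelope_eq_Max:
  assumes "finite K" "K \<noteq> {}"
  shows "envelope \<alpha> g K s = (MAX p\<in>K. (snd p * g (fst p) s) powr \<alpha>)"
  using assms by (intro envelope_eqI) (auto simp: Max_ge_iff)

lemma Max_powr:
  assumes "finite I" "I \<noteq> {}" "\<And>i. i \<in> I \<Longrightarrow> 0 \<le> h i" "0 < \<alpha>"
  shows "(MAX i\<in>I. h i) powr \<alpha> = (MAX i\<in>I. h i powr \<alpha> :: real)"
proof (rule Max_eqI[symmetric])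
  show "finite ((\<lambda>i. h i powr \<alpha>) ` I)" using assms by simp
  have "(MAX i\<in>I. h i) \<in> h ` I" using assms by (intro Max_in) auto
  then show "(MAX i\<in>I. h i) powr \<alpha> \<in> (\<lambda>i. h i powr \<alpha>) ` I" by auto
  fix y assume "y \<in> (\<lambda>i. h i powr \<alpha>) ` I"
  then show "y \<le> (MAX i\<in>I. h i) powr \<alpha>"
    using assms by (auto intro!: powr_mono2 Max_ge)
qed

text \<open>Homogeneity of the exponent, the source of its Frechet form in the threshold.\<close>

lemma envelope_scale:
  assumes "positive_weights K" "\<And>i a. (i, a) \<in> K \<Longrightarrow> 0 \<le> g i s" "0 < c"
  shows "envelope \<alpha> g ((\<lambda>(i, a). (i, c * a)) ` K) s = c powr \<alpha> * envelope \<alpha> g K s"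
proof (rule envelope_eqI)
  have fin: "finite K" using assms by (simp add: positive_weights_finite)
  show "finite ((\<lambda>(i, a). (i, c * a)) ` K)" using fin by simp
  show "0 \<le> c powr \<alpha> * envelope \<alpha> g K s" using fin by (simp add: envelope_nonneg)
  fix d :: real assume d: "0 \<le> d"
  have "c powr \<alpha> * envelope \<alpha> g K s \<le> d \<longleftrightarrow> envelope \<alpha> g K s \<le> d / c powr \<alpha>"
    using assms by (simp add: field_simps)
  also have "\<dots> \<longleftrightarrow> (\<forall>(i, a)\<in>K. (a * g i s) powr \<alpha> \<le> d / c powr \<alpha>)"
    using d by (subst envelope_le_iff[OF fin]) auto
  also have "\<dots> \<longleftrightarrow> (\<forall>(i, a)\<in>K. (c * a * g i s) powr \<alpha> \<le> d)"
  proof (intro ball_cong refl, clarsimp)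
    fix i a assume "(i, a) \<in> K"
    then have "0 \<le> a * g i s"
      using assms(2) positive_weightsD[OF assms(1)] by (intro mult_nonneg_nonneg) (auto simp: less_imp_le)
    then have "(c * a * g i s) powr \<alpha> = c powr \<alpha> * (a * g i s) powr \<alpha>"
      using assms(3) by (simp add: powr_mult mult.assoc)
    then show "((a * g i s) powr \<alpha> \<le> d / c powr \<alpha>) = ((c * a * g i s) powr \<alpha> \<le> d)"
      using assms(3) by (simp add: field_simps)
  qed
  finally show "(c powr \<alpha> * envelope \<alpha> g K s \<le> d) =
    (\<forall>(i, a)\<in>(\<lambda>(i, a). (i, c * a)) ` K. (a * g i s) powr \<alpha> \<le> d)"
    by auto
qed

lemma L_plusD:
  assumes "g \<in> L_plus \<alpha> \<mu>"
  shows "g \<in> borel_measurable \<mu>" "s \<in> space \<mu> \<Longrightarrow> 0 \<le> g s" "integrable \<mu> (\<lambda>s. g s powr \<alpha>)"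
  using assms by (auto simp: L_plus_def)

lemma envelope_le_sum:
  assumes "positive_weights K"
  shows "envelope \<alpha> g K s \<le> (\<Sum>p\<in>K. (snd p * g (fst p) s) powr \<alpha>)"
proof (subst envelope_le_iff)
  show "finite K" using assms by (rule positive_weights_finite)
  then show "0 \<le> (\<Sum>p\<in>K. (snd p * g (fst p) s) powr \<alpha>) \<and>
    (\<forall>(i, a)\<in>K. (a * g i s) powr \<alpha> \<le> (\<Sum>p\<in>K. (snd p * g (fst p) s) powr \<alpha>))"
    by (auto intro!: sum_nonneg member_le_sum[where f = "\<lambda>p. (snd p * g (fst p) s) powr \<alpha>" and i = "(_, _)", simplified])
qed

lemma measurable_envelope:
  assumes "finite K" "\<And>i a. (i, a) \<in> K \<Longrightarrow> g i \<in> borel_measurable \<mu>"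
  shows "envelope \<alpha> g K \<in> borel_measurable \<mu>"
proof (cases "K = {}")
  case False
  have [measurable]: "p \<in> K \<Longrightarrow> g (fst p) \<in> borel_measurable \<mu>" for p
    using assms(2)[of "fst p" "snd p"] by simp
  have "(\<lambda>s. MAX p\<in>K. (snd p * g (fst p) s) powr \<alpha>) \<in> borel_measurable \<mu>"
    using assms(1) by (intro borel_measurable_Max) measurable
  then show ?thesis by (simp add: envelope_eq_Max[OF assms(1) False, abs_def] cong: measurable_cong)
qed (simp add: envelope_def[abs_def])

lemma integrable_weighted:
  assumes "g \<in> L_plus \<alpha> \<mu>" "0 < a"
  shows "integrable \<mu> (\<lambda>s. (a * g s) powr \<alpha>)"
proof -
  have "integrable \<mu> (\<lambda>s. a powr \<alpha> * g s powr \<alpha>)" using L_plusD[OF assms(1)] by simp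
  then show ?thesis
    by (rule Bochner_Integration.integrable_cong[THEN iffD1, rotated 2])
       (use assms L_plusD(2)[OF assms(1)] in \<open>auto simp: powr_mult\<close>)
qed

lemma integrable_envelope:
  assumes "positive_weights K" "\<And>i a. (i, a) \<in> K \<Longrightarrow> g i \<in> L_plus \<alpha> \<mu>"
  shows "integrable \<mu> (envelope \<alpha> g K)"
proof (rule Bochner_Integration.integrable_bound)
  show "integrable \<mu> (\<lambda>s. \<Sum>p\<in>K. (snd p * g (fst p) s) powr \<alpha>)"
  proof (rule Bochner_Integration.integrable_sum, rule integrable_weighted)
    fix p assume "p \<in> K"
    then show "g (fst p) \<in> L_plus \<alpha> \<mu>" "0 < snd p"
      using assms(2)[of "fst p" "snd p"] positive_weightsD[OF assms(1), of "fst p" "snd p"] by auto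
  qed
  show "envelope \<alpha> g K \<in> borel_measurable \<mu>"
    using assms by (intro measurable_envelope L_plusD(1)) (auto simp: positive_weights_finite)
  show "AE s in \<mu>. norm (envelope \<alpha> g K s) \<le> norm (\<Sum>p\<in>K. (snd p * g (fst p) s) powr \<alpha>)"
    using envelope_le_sum[OF assms(1), of \<alpha> g]
    by (simp add: sum_nonneg abs_of_nonneg[OF envelope_nonneg[OF positive_weights_finite[OF assms(1)]]])
qed

text \<open>The finite set of weights is enumerated, with thresholds \<open>x = 1 / a\<close>.\<close>

lemma spectral_representation_imp_law:
  fixes X :: "'t \<Rightarrow> 'w \<Rightarrow> real"
  assumes "spectral_representation Pr \<alpha> X \<mu> f" "0 < \<alpha>" "prob_space Pr"
  shows "spectral_law Pr \<alpha> X \<mu> f"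
  unfolding spectral_law_def
proof (intro allI impI)
  fix K :: "('t \<times> real) set" assume K: "positive_weights K"
  interpret prob_space Pr by fact
  show "prob (box_event Pr X K) = exp (- exponent \<alpha> \<mu> f K)"
  proof (cases "K = {}")
    case True
    then show ?thesis by (simp add: box_event_def prob_space)
  next
    case False
    have fin: "finite K" using K by (rule positive_weights_finite)
    then obtain e where e: "bij_betw e {1..card K} K"
      using ex_bij_betw_nat_finite_1 by blast
    define t where "t i = fst (e i)" for i
    define x where "x i = 1 / snd (e i)" for i
    have im: "e ` {1..card K} = K" using e by (simp add: bij_betw_def)
    have pos: "0 < x i" if "i \<in> {1..card K}" for i
    proof -
      have "(fst (e i), snd (e i)) \<in> K" using im that by auto
      then show ?thesis using positive_weightsD[OF K, of "fst (e i)" "snd (e i)"] by (simp add: x_def)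
    qed
    have card: "1 \<le> card K" using fin False by (simp add: Suc_le_eq card_gt_0_iff)
    have "measure Pr {\<omega> \<in> space Pr. \<forall>i\<in>{1..card K}. X (t i) \<omega> \<le> x i} =
        exp (- (\<integral>s. (MAX i\<in>{1..card K}. f (t i) s / x i) powr \<alpha> \<partial>\<mu>))"
      using assms(1) card pos unfolding spectral_representation_def by blast
    also have "{\<omega> \<in> space Pr. \<forall>i\<in>{1..card K}. X (t i) \<omega> \<le> x i} = box_event Pr X K"
    proof -
      have "(X (t i) \<omega> \<le> x i) \<longleftrightarrow> snd (e i) * X (fst (e i)) \<omega> \<le> 1" if "i \<in> {1..card K}" for i \<omega>
        using pos[OF that] by (auto simp: t_def x_def field_simps)
      moreover have "box_event Pr X K = {\<omega> \<in> space Pr. \<forall>i\<in>{1..card K}. snd (e i) * X (fst (e i)) \<omega> \<le> 1}"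
        unfolding box_event_def by (subst im[symmetric]) (auto simp: split_beta)
      ultimately show ?thesis by auto
    qed
    also have "(\<integral>s. (MAX i\<in>{1..card K}. f (t i) s / x i) powr \<alpha> \<partial>\<mu>) = exponent \<alpha> \<mu> f K"
    proof (intro Bochner_Integration.integral_cong refl)
      fix s assume s: "s \<in> space \<mu>"
      have f: "0 \<le> f u s" for u
        using assms(1) s by (auto simp: spectral_representation_def L_plus_def)
      have "(MAX i\<in>{1..card K}. f (t i) s / x i) powr \<alpha> = (MAX i\<in>{1..card K}. (f (t i) s / x i) powr \<alpha>)"
        using card pos f assms(2) by (intro Max_powr) (auto simp: less_imp_le)
      also have "\<dots> = (MAX i\<in>{1..card K}. (snd (e i) * f (fst (e i)) s) powr \<alpha>)"
        by (simp add: t_def x_def mult.commute)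
      also have "\<dots> = (MAX p\<in>K. (snd p * f (fst p) s) powr \<alpha>)"
        by (subst im[symmetric]) (simp add: image_image)
      finally show "(MAX i\<in>{1..card K}. f (t i) s / x i) powr \<alpha> = envelope \<alpha> f K s"
        unfolding envelope_eq_Max[OF fin False] .
    qed
    finally show ?thesis .
  qed
qed

section \<open>Laws and independence from box events\<close>

definition orthants :: "('i \<Rightarrow> real) set set" where
  "orthants = {{w. \<forall>i\<in>F. w i \<le> c i} | F c. finite F}"

lemma Int_stable_orthants: "Int_stable orthants"
proof (rule Int_stableI)
  fix a b :: "('i \<Rightarrow> real) set" assume "a \<in> orthants" "b \<in> orthants"
  then obtain F c G d where *: "a = {w. \<forall>i\<in>F. w i \<le> c i}" "finite F"
    "b = {w. \<forall>i\<in>G. w i \<le> d i}" "finite G"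
    by (auto simp: orthants_def)
  define m where "m i = (if i \<in> F \<and> i \<in> G then min (c i) (d i) else if i \<in> F then c i else d i)" for i
  have "a \<inter> b = {w. \<forall>i\<in>F \<union> G. w i \<le> m i}"
    using * by (auto simp: m_def)
  then show "a \<inter> b \<in> orthants"
    using * unfolding orthants_def by blast
qed

text \<open>The coordinate functions are measurable for the \<open>\<sigma>\<close>-algebra generated by the orthants, since their
  half-lines are orthants over one coordinate.\<close>

lemma sets_PiM_eq_sigma_orthants:
  "sets (\<Pi>\<^sub>M i\<in>(UNIV :: 'i set). (borel :: real measure)) = sigma_sets UNIV orthants"
proof
  let ?N = "sigma UNIV orthants :: ('i \<Rightarrow> real) measure"
  have N: "space ?N = UNIV" "sets ?N = sigma_sets UNIV orthants"
    by (auto simp: space_measure_of_conv)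
  have "(\<lambda>w i. w i) \<in> measurable ?N (\<Pi>\<^sub>M i\<in>UNIV. borel)"
  proof (rule measurable_PiM_single')
    fix i :: 'i
    show "(\<lambda>w. w i) \<in> borel_measurable ?N"
      unfolding borel_measurable_iff_le N
    proof (intro allI sigma_sets.Basic)
      fix a show "{w \<in> UNIV. w i \<le> a} \<in> orthants"
        unfolding orthants_def by (intro CollectI exI[of _ "{i}"] exI[of _ "\<lambda>_. a"]) auto
    qed
  qed (auto simp: PiE_def)
  from measurable_sets[OF this]
  show "sets (\<Pi>\<^sub>M i\<in>(UNIV :: 'i set). (borel :: real measure)) \<subseteq> sigma_sets UNIV orthants"
    unfolding N by (auto simp: space_measure_of_conv)
  have "orthants \<subseteq> sets (\<Pi>\<^sub>M i\<in>(UNIV :: 'i set). (borel :: real measure))"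
  proof
    fix A :: "('i \<Rightarrow> real) set" assume "A \<in> orthants"
    then obtain F c where A: "A = {w. \<forall>i\<in>F. w i \<le> c i}" "finite F" by (auto simp: orthants_def)
    have "{w \<in> space (\<Pi>\<^sub>M i\<in>UNIV. borel). \<forall>i\<in>F. w i \<le> c i} \<in> sets (\<Pi>\<^sub>M i\<in>(UNIV :: 'i set). (borel :: real measure))"
      using A(2) by measurable
    then show "A \<in> sets (\<Pi>\<^sub>M i\<in>(UNIV :: 'i set). (borel :: real measure))"
      by (simp add: A space_PiM PiE_def)
  qed
  from sets.sigma_sets_subset[OF this]
  show "sigma_sets UNIV orthants \<subseteq> sets (\<Pi>\<^sub>M i\<in>(UNIV :: 'i set). (borel :: real measure))"
    by (simp add: space_PiM PiE_def)
qed

text \<open>Box events have positive thresholds only; non-negative ones are reached from above.\<close>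

lemma tendsto_measure_orthant:
  assumes "finite_measure M" "finite F" "\<And>i. i \<in> F \<Longrightarrow> Z i \<in> borel_measurable M" "\<And>i. i \<in> F \<Longrightarrow> 0 \<le> c i"
  shows "(\<lambda>k. measure M (box_event M Z ((\<lambda>i. (i, 1 / (c i + 1 / Suc k))) ` F)))
    \<longlonglongrightarrow> measure M {\<omega> \<in> space M. \<forall>i\<in>F. Z i \<omega> \<le> c i}"
proof -
  interpret finite_measure M by fact
  let ?B = "\<lambda>k. {\<omega> \<in> space M. \<forall>i\<in>F. Z i \<omega> \<le> c i + 1 / Suc k}"
  have pos: "0 < c i + 1 / Suc k" if "i \<in> F" for i k
    using assms(4)[OF that] by (simp add: add_nonneg_pos)
  have B: "box_event M Z ((\<lambda>i. (i, 1 / (c i + 1 / Suc k))) ` F) = ?B k" for k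
  proof -
    have "(1 / (c i + 1 / Suc k) * Z i \<omega> \<le> 1) \<longleftrightarrow> Z i \<omega> \<le> c i + 1 / Suc k" if "i \<in> F" for i \<omega>
      using pos[OF that, of k] by (simp add: divide_le_eq)
    then show ?thesis by (auto simp: box_event_def)
  qed
  note [measurable] = assms(3)
  have "?B k \<in> sets M" for k using assms(2) by measurable
  then have "range ?B \<subseteq> sets M" by blast
  moreover have "decseq ?B"
  proof (intro decseq_SucI Collect_mono impI conjI, clarify, clarsimp)
    fix k \<omega> i assume "\<forall>i\<in>F. Z i \<omega> \<le> c i + 1 / (2 + real k)" "i \<in> F"
    then have "Z i \<omega> \<le> c i + 1 / (2 + real k)" by blast
    also have "\<dots> \<le> c i + 1 / (1 + real k)" by (simp add: frac_le)
    finally show "Z i \<omega> \<le> c i + 1 / (1 + real k)" .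
  qed
  ultimately have "(\<lambda>k. measure M (?B k)) \<longlonglongrightarrow> measure M (\<Inter>k. ?B k)"
    by (rule finite_Lim_measure_decseq)
  moreover have "(\<Inter>k. ?B k) = {\<omega> \<in> space M. \<forall>i\<in>F. Z i \<omega> \<le> c i}"
  proof -
    have "Z i \<omega> \<le> c i" if "\<And>k. Z i \<omega> \<le> c i + 1 / Suc k" for i \<omega>
    proof (rule LIMSEQ_le_const)
      show "(\<lambda>k. c i + 1 / Suc k) \<longlonglongrightarrow> c i"
        using tendsto_add[OF tendsto_const LIMSEQ_inverse_real_of_nat, of "c i"] by (simp add: inverse_eq_divide)
    qed (use that in auto)
    moreover have "Z i \<omega> \<le> c i + 1 / Suc k" if "Z i \<omega> \<le> c i" for i k \<omega>
      using that by (rule order_trans) simp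
    ultimately show ?thesis by fastforce
  qed
  ultimately show ?thesis unfolding B by simp
qed

lemma measure_orthant_negative:
  assumes "AE \<omega> in M. 0 \<le> Z i \<omega>" "i \<in> F" "c i < (0::real)"
  shows "measure M {\<omega> \<in> space M. \<forall>i\<in>F. Z i \<omega> \<le> c i} = 0"
proof -
  have "AE \<omega> in M. \<not> (\<omega> \<in> space M \<and> (\<forall>i\<in>F. Z i \<omega> \<le> c i))"
    using assms(1) by eventually_elim (use assms(2,3) in force)
  then have "AE \<omega> in M. \<omega> \<in> {\<omega> \<in> space M. \<forall>i\<in>F. Z i \<omega> \<le> c i} \<longleftrightarrow> \<omega> \<in> {}"
    by simp
  from measure_eq_AE[OF this] show ?thesis
    by (cases "{\<omega> \<in> space M. \<forall>i\<in>F. Z i \<omega> \<le> c i} \<in> sets M") (simp_all add: measure_notin_sets)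
qed

text \<open>Orthants form a generator that is stable under intersection.  An orthant with a negative bound is
  null for a non-negative process, and any other one is a limit of box events.\<close>

lemma distr_eqI_box_events:
  fixes Z :: "'i \<Rightarrow> 'a \<Rightarrow> real" and Z' :: "'i \<Rightarrow> 'b \<Rightarrow> real"
  assumes fin: "finite_measure M" "finite_measure M'"
    and meas: "\<And>i. Z i \<in> borel_measurable M" "\<And>i. Z' i \<in> borel_measurable M'"
    and nonneg: "\<And>i. AE \<omega> in M. 0 \<le> Z i \<omega>" "\<And>i. AE \<omega> in M'. 0 \<le> Z' i \<omega>"
    and eq: "\<And>K. positive_weights K \<Longrightarrow> measure M (box_event M Z K) = measure M' (box_event M' Z' K)"
  shows "distr M (\<Pi>\<^sub>M i\<in>UNIV. borel) (\<lambda>\<omega> i. Z i \<omega>) = distr M' (\<Pi>\<^sub>M i\<in>UNIV. borel) (\<lambda>\<omega> i. Z' i \<omega>)"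
    (is "?D = ?D'")
proof (rule measure_eqI_generator_eq)
  interpret M: finite_measure M by fact
  interpret M': finite_measure M' by fact
  have m: "(\<lambda>\<omega> i. Z i \<omega>) \<in> measurable M (\<Pi>\<^sub>M i\<in>UNIV. borel)"
    by (rule measurable_PiM_single') (auto intro: meas)
  have m': "(\<lambda>\<omega> i. Z' i \<omega>) \<in> measurable M' (\<Pi>\<^sub>M i\<in>UNIV. borel)"
    by (rule measurable_PiM_single') (auto intro: meas)
  show "Int_stable (orthants :: ('i \<Rightarrow> real) set set)" by (rule Int_stable_orthants)
  show "(orthants :: ('i \<Rightarrow> real) set set) \<subseteq> Pow UNIV" by simp
  show "sets ?D = sigma_sets UNIV orthants" "sets ?D' = sigma_sets UNIV orthants"
    by (simp_all add: sets_PiM_eq_sigma_orthants)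
  show "range (\<lambda>_::nat. UNIV) \<subseteq> (orthants :: ('i \<Rightarrow> real) set set)"
    unfolding orthants_def by (auto intro!: exI[of _ "{}"])
  show "(\<Union>_::nat. UNIV) = (UNIV :: ('i \<Rightarrow> real) set)" by simp
  show "emeasure ?D UNIV \<noteq> \<infinity>"
  proof -
    interpret D: finite_measure ?D by (rule M.finite_measure_distr[OF m])
    show ?thesis by simp
  qed
  fix A :: "('i \<Rightarrow> real) set" assume A: "A \<in> orthants"
  then obtain F c where F: "A = {w. \<forall>i\<in>F. w i \<le> c i}" "finite F"
    by (auto simp: orthants_def)
  have A': "A \<in> sets (\<Pi>\<^sub>M i\<in>UNIV. borel)"
    using A by (auto simp: sets_PiM_eq_sigma_orthants)
  have "measure M {\<omega> \<in> space M. \<forall>i\<in>F. Z i \<omega> \<le> c i} = measure M' {\<omega> \<in> space M'. \<forall>i\<in>F. Z' i \<omega> \<le> c i}"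
  proof (cases "\<exists>i\<in>F. c i < 0")
    case True
    then show ?thesis using nonneg by (auto simp: measure_orthant_negative)
  next
    case False
    have "positive_weights ((\<lambda>i. (i, 1 / (c i + 1 / Suc k))) ` F)" for k
      using False F(2) by (auto simp: positive_weights_def not_less add_nonneg_pos)
    note same = eq[OF this]
    have "(\<lambda>k. measure M (box_event M Z ((\<lambda>i. (i, 1 / (c i + 1 / Suc k))) ` F)))
      \<longlonglongrightarrow> measure M {\<omega> \<in> space M. \<forall>i\<in>F. Z i \<omega> \<le> c i}"
      using False F(2) fin meas by (intro tendsto_measure_orthant) (auto simp: not_less)
    moreover have "(\<lambda>k. measure M (box_event M Z ((\<lambda>i. (i, 1 / (c i + 1 / Suc k))) ` F)))
      \<longlonglongrightarrow> measure M' {\<omega> \<in> space M'. \<forall>i\<in>F. Z' i \<omega> \<le> c i}"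
      unfolding same using False F(2) fin meas by (intro tendsto_measure_orthant) (auto simp: not_less)
    ultimately show ?thesis by (rule LIMSEQ_unique)
  qed
  moreover have "(\<lambda>\<omega> i. Z i \<omega>) -` A \<inter> space M = {\<omega> \<in> space M. \<forall>i\<in>F. Z i \<omega> \<le> c i}"
    "(\<lambda>\<omega> i. Z' i \<omega>) -` A \<inter> space M' = {\<omega> \<in> space M'. \<forall>i\<in>F. Z' i \<omega> \<le> c i}"
    by (auto simp: F)
  ultimately show "emeasure ?D A = emeasure ?D' A"
    using m m' A' by (simp add: emeasure_distr M.emeasure_eq_measure M'.emeasure_eq_measure)
qed

text \<open>The same approximation of orthants by box events, now for the product formula: the families for
  different \<open>j\<close> are treated as a single process indexed by pairs \<open>(j, t)\<close>.\<close>

lemma indep_processesI: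
  fixes Y :: "nat \<Rightarrow> 't \<Rightarrow> 'w \<Rightarrow> real"
  assumes "prob_space Pr"
    and meas: "\<And>j t. j \<in> I \<Longrightarrow> Y j t \<in> borel_measurable Pr"
    and nonneg: "\<And>j t. j \<in> I \<Longrightarrow> AE \<omega> in Pr. 0 \<le> Y j t \<omega>"
    and product: "\<And>J K. J \<subseteq> I \<Longrightarrow> finite J \<Longrightarrow> J \<noteq> {} \<Longrightarrow> (\<And>j. j \<in> J \<Longrightarrow> positive_weights (K j)) \<Longrightarrow>
      measure Pr (\<Inter>j\<in>J. box_event Pr (Y j) (K j)) = (\<Prod>j\<in>J. measure Pr (box_event Pr (Y j) (K j)))"
  shows "indep_processes Pr I Y"
proof -
  interpret prob_space Pr by fact
  define G where "G j = {(\<lambda>\<omega> t. Y j t \<omega>) -` A \<inter> space Pr | A. A \<in> orthants}" for j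
  have m: "(\<lambda>\<omega> t. Y j t \<omega>) \<in> measurable Pr (\<Pi>\<^sub>M t\<in>UNIV. borel)" if "j \<in> I" for j
    by (rule measurable_PiM_single') (auto intro: meas that)
  have G: "A \<in> G j \<longleftrightarrow> (\<exists>F c. finite F \<and> A = {\<omega> \<in> space Pr. \<forall>t\<in>F. Y j t \<omega> \<le> c t})" for A j
  proof
    assume "A \<in> G j"
    then obtain F c where "finite F" "A = (\<lambda>\<omega> t. Y j t \<omega>) -` {w. \<forall>i\<in>F. w i \<le> c i} \<inter> space Pr"
      by (auto simp: G_def orthants_def)
    then show "\<exists>F c. finite F \<and> A = {\<omega> \<in> space Pr. \<forall>t\<in>F. Y j t \<omega> \<le> c t}"
      by (intro exI[of _ F] exI[of _ c]) auto
  next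
    assume "\<exists>F c. finite F \<and> A = {\<omega> \<in> space Pr. \<forall>t\<in>F. Y j t \<omega> \<le> c t}"
    then obtain F c where F: "finite F" "A = {\<omega> \<in> space Pr. \<forall>t\<in>F. Y j t \<omega> \<le> c t}" by auto
    have "{w. \<forall>i\<in>F. w i \<le> c i} \<in> orthants" using F by (auto simp: orthants_def)
    moreover have "A = (\<lambda>\<omega> t. Y j t \<omega>) -` {w. \<forall>i\<in>F. w i \<le> c i} \<inter> space Pr"
      using F(2) by auto
    ultimately show "A \<in> G j" unfolding G_def by (intro CollectI exI conjI)
  qed
  have events: "A \<in> events" if j: "j \<in> I" and A: "A \<in> G j" for A j
  proof -
    obtain B where "B \<in> orthants" "A = (\<lambda>\<omega> t. Y j t \<omega>) -` B \<inter> space Pr"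
      using A by (auto simp: G_def)
    then show ?thesis
      using measurable_sets[OF m[OF j], of B] by (simp add: sets_PiM_eq_sigma_orthants sigma_sets.Basic)
  qed
  have "indep_sets G I"
    unfolding indep_sets_def
  proof (intro conjI ballI allI impI)
    fix j assume "j \<in> I"
    then show "G j \<subseteq> events" using events by blast
  next
    fix J A assume J: "J \<subseteq> I" "J \<noteq> {}" "finite J" and A: "A \<in> Pi J G"
    then have "\<forall>j\<in>J. \<exists>F c. finite F \<and> A j = {\<omega> \<in> space Pr. \<forall>t\<in>F. Y j t \<omega> \<le> c t}"
      by (auto simp: Pi_iff G)
    from bchoice[OF this] obtain F where
      "\<forall>j\<in>J. \<exists>c. finite (F j) \<and> A j = {\<omega> \<in> space Pr. \<forall>t\<in>F j. Y j t \<omega> \<le> c t}" by blast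
    from bchoice[OF this] obtain c where
      "\<forall>j\<in>J. finite (F j) \<and> A j = {\<omega> \<in> space Pr. \<forall>t\<in>F j. Y j t \<omega> \<le> c j t}" by blast
    then have F: "\<And>j. j \<in> J \<Longrightarrow> finite (F j)"
      "\<And>j. j \<in> J \<Longrightarrow> A j = {\<omega> \<in> space Pr. \<forall>t\<in>F j. Y j t \<omega> \<le> c j t}"
      by blast+
    show "prob (\<Inter>j\<in>J. A j) = (\<Prod>j\<in>J. prob (A j))"
    proof (cases "\<exists>j\<in>J. \<exists>t\<in>F j. c j t < 0")
      case True
      then obtain j t where jt: "j \<in> J" "t \<in> F j" "c j t < 0" by auto
      have "j \<in> I" using jt J by auto
      have "prob (A j) = 0"
        unfolding F(2)[OF jt(1)]
        by (rule measure_orthant_negative[where Z = "Y j" and i = t]) (use nonneg[OF \<open>j \<in> I\<close>] jt in auto)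
      moreover have "prob (\<Inter>j\<in>J. A j) \<le> prob (A j)"
      proof (rule finite_measure_mono)
        have "A j \<in> G j" using A jt by auto
        with \<open>j \<in> J\<close> J(1) show "A j \<in> events" by (intro events) auto
      qed (use jt in auto)
      ultimately have "prob (\<Inter>j\<in>J. A j) = 0" by (simp add: measure_le_0_iff)
      moreover have "(\<Prod>j\<in>J. prob (A j)) = 0"
        using \<open>prob (A j) = 0\<close> jt J by (auto intro!: prod_zero)
      ultimately show ?thesis by simp
    next
      case False
      define K where "K k j = (\<lambda>t. (t, 1 / (c j t + 1 / Suc k))) ` F j" for k :: nat and j
      have pos: "positive_weights (K k j)" if "j \<in> J" for k j
        using False F(1) that by (auto simp: K_def positive_weights_def not_less add_nonneg_pos)
      have "(\<lambda>k. prob (box_event Pr (Y j) (K k j))) \<longlonglongrightarrow> prob (A j)" if "j \<in> J" for j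
        unfolding K_def F(2)[OF that] using False that J F meas
        by (intro tendsto_measure_orthant) (auto simp: finite_measure_axioms not_less)
      then have lim: "(\<lambda>k. \<Prod>j\<in>J. prob (box_event Pr (Y j) (K k j))) \<longlonglongrightarrow> (\<Prod>j\<in>J. prob (A j))"
        by (intro tendsto_prod)
      let ?Z = "\<lambda>(j, t). Y j t" and ?c = "\<lambda>(j, t). c j t"
      have "(\<lambda>k. prob (box_event Pr ?Z ((\<lambda>p. (p, 1 / (?c p + 1 / Suc k))) ` Sigma J F)))
          \<longlonglongrightarrow> prob {\<omega> \<in> space Pr. \<forall>p\<in>Sigma J F. ?Z p \<omega> \<le> ?c p}"
        using False J F meas
        by (intro tendsto_measure_orthant) (auto simp: finite_measure_axioms not_less)
      moreover have "box_event Pr ?Z ((\<lambda>p. (p, 1 / (?c p + 1 / Suc k))) ` Sigma J F)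
          = (\<Inter>j\<in>J. box_event Pr (Y j) (K k j))" for k
        using J by (auto simp: box_event_def K_def)
      moreover have "{\<omega> \<in> space Pr. \<forall>p\<in>Sigma J F. ?Z p \<omega> \<le> ?c p} = (\<Inter>j\<in>J. A j)"
        using J F(2) by auto
      ultimately have "(\<lambda>k. prob (\<Inter>j\<in>J. box_event Pr (Y j) (K k j))) \<longlonglongrightarrow> prob (\<Inter>j\<in>J. A j)"
        by simp
      moreover have "prob (\<Inter>j\<in>J. box_event Pr (Y j) (K k j)) = (\<Prod>j\<in>J. prob (box_event Pr (Y j) (K k j)))" for k
        using J pos by (intro product) auto
      ultimately show ?thesis using LIMSEQ_unique[OF _ lim] by simp
    qed
  qed
  moreover have "Int_stable (G j)" for j
  proof (rule Int_stableI)
    fix a b assume "a \<in> G j" "b \<in> G j"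
    then obtain A B where "a = (\<lambda>\<omega> t. Y j t \<omega>) -` A \<inter> space Pr" "b = (\<lambda>\<omega> t. Y j t \<omega>) -` B \<inter> space Pr"
      "A \<in> orthants" "B \<in> orthants" by (auto simp: G_def)
    moreover from this have "A \<inter> B \<in> orthants"
      using Int_stable_orthants[THEN Int_stableD] by blast
    ultimately show "a \<inter> b \<in> G j"
      unfolding G_def by (intro CollectI exI[of _ "A \<inter> B"]) auto
  qed
  ultimately have "indep_sets (\<lambda>j. sigma_sets (space Pr) (G j)) I"
    by (intro indep_sets_sigma)
  moreover have "sigma_sets (space Pr) (G j)
      = {(\<lambda>\<omega> t. Y j t \<omega>) -` A \<inter> space Pr | A. A \<in> sets (\<Pi>\<^sub>M t\<in>UNIV. borel)}" for j
    unfolding G_def sets_PiM_eq_sigma_orthants by (rule sigma_sets_vimage_commute[symmetric]) simp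
  ultimately show ?thesis
    unfolding indep_processes_def indep_vars_def2 using m by simp
qed

lemma spectral_law_process_law_eq:
  fixes Z :: "'i \<Rightarrow> 'a \<Rightarrow> real" and Z' :: "'i \<Rightarrow> 'b \<Rightarrow> real"
  assumes "prob_space Pr" "prob_space Pr'"
    and "\<And>i. Z i \<in> borel_measurable Pr" "\<And>i. Z' i \<in> borel_measurable Pr'"
    and "\<And>i. AE \<omega> in Pr. 0 \<le> Z i \<omega>" "\<And>i. AE \<omega> in Pr'. 0 \<le> Z' i \<omega>"
    and "spectral_law Pr \<alpha> Z \<mu> g" "spectral_law Pr' \<alpha> Z' \<mu>' g'"
    and "\<And>K. positive_weights K \<Longrightarrow> exponent \<alpha> \<mu> g K = exponent \<alpha> \<mu>' g' K"
  shows "process_law Pr Z = process_law Pr' Z'"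
  unfolding process_law_def
proof (rule distr_eqI_box_events)
  show "finite_measure Pr" "finite_measure Pr'"
    using assms(1,2) by (auto intro: prob_space.finite_measure)
  fix K :: "('i \<times> real) set" assume "positive_weights K"
  then show "measure Pr (box_event Pr Z K) = measure Pr' (box_event Pr' Z' K)"
    using assms(7-9) by (simp add: spectral_law_def)
qed (fact assms)+

lemma frechet_process_nonneg:
  assumes "frechet_process Pr \<alpha> X"
  shows "X t \<in> borel_measurable Pr" "AE \<omega> in Pr. 0 \<le> X t \<omega>"
proof -
  have "\<exists>\<sigma>. frechet_rv Pr \<alpha> \<sigma> (\<lambda>\<omega>. MAX j\<in>{1..1::nat}. 1 * X t \<omega>)"
    using assms[unfolded frechet_process_def, rule_format, of 1 "\<lambda>_. 1" "\<lambda>_. t"] by simp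
  then show "X t \<in> borel_measurable Pr" "AE \<omega> in Pr. 0 \<le> X t \<omega>"
    by (auto simp: frechet_rv_def)
qed

text \<open>The maximum is at most \<open>x\<close> exactly on the box event with weights \<open>a\<^sub>j / x\<close>, whose exponent is
  \<open>x\<^sup>-\<^sup>\<alpha>\<close> times that for the weights \<open>a\<^sub>j\<close>.\<close>

lemma spectral_law_frechet_process:
  fixes Z :: "'i \<Rightarrow> 'w \<Rightarrow> real"
  assumes "0 < \<alpha>" "prob_space Pr" and meas: "\<And>i. Z i \<in> borel_measurable Pr"
    and nonneg: "\<And>i. AE \<omega> in Pr. 0 \<le> Z i \<omega>"
    and law: "spectral_law Pr \<alpha> Z \<mu> g" and g: "\<And>i. g i \<in> L_plus \<alpha> \<mu>"
  shows "frechet_process Pr \<alpha> Z"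
  unfolding frechet_process_def
proof (intro allI impI)
  interpret prob_space Pr by fact
  fix m :: nat and t :: "nat \<Rightarrow> 'i" and a :: "nat \<Rightarrow> real"
  assume m: "1 \<le> m" and a: "\<forall>j\<in>{1..m}. 0 < a j"
  let ?Y = "\<lambda>\<omega>. MAX j\<in>{1..m}. a j * Z (t j) \<omega>"
  define K where "K = (\<lambda>j. (t j, a j)) ` {1..m}"
  have K: "positive_weights K" using a by (auto simp: K_def positive_weights_def)
  define E where "E = exponent \<alpha> \<mu> g K"
  have E: "0 \<le> E" unfolding E_def
    by (intro Bochner_Integration.integral_nonneg envelope_nonneg) (rule positive_weights_finite[OF K])
  have Y: "?Y \<in> borel_measurable Pr" using meas by (intro borel_measurable_Max) auto
  have "AE \<omega> in Pr. 0 \<le> ?Y \<omega>"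
    using nonneg[of "t 1"]
  proof eventually_elim
    case (elim \<omega>)
    have "0 \<le> a 1 * Z (t 1) \<omega>" using elim a m by (auto intro!: mult_nonneg_nonneg simp: less_imp_le)
    also have "\<dots> \<le> ?Y \<omega>" using m by (intro Max_ge) auto
    finally show ?case .
  qed
  moreover have "cdf (distr Pr borel ?Y) x = exp (- ((E powr (1 / \<alpha>)) powr \<alpha> * x powr (- \<alpha>)))" if x: "0 < x" for x
  proof -
    let ?Kx = "(\<lambda>(i, b). (i, 1 / x * b)) ` K"
    have Kx: "positive_weights ?Kx"
      using x positive_weightsD[OF K] by (intro positive_weights_image[OF K]) auto
    have "cdf (distr Pr borel ?Y) x = prob (?Y -` {..x} \<inter> space Pr)"
      using Y by (simp add: cdf_def measure_distr)
    also have "?Y -` {..x} \<inter> space Pr = box_event Pr Z ?Kx"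
    proof -
      have "?Y \<omega> \<le> x \<longleftrightarrow> (\<forall>j\<in>{1..m}. a j * Z (t j) \<omega> \<le> x)" for \<omega>
        using m by (subst Max_le_iff) auto
      then show ?thesis using x by (auto simp: box_event_def K_def divide_le_eq)
    qed
    also have "prob \<dots> = exp (- exponent \<alpha> \<mu> g ?Kx)"
      using law Kx by (simp add: spectral_law_def)
    also have "exponent \<alpha> \<mu> g ?Kx = (\<integral>s. (1 / x) powr \<alpha> * envelope \<alpha> g K s \<partial>\<mu>)"
      using K x L_plusD(2)[OF g] by (intro Bochner_Integration.integral_cong refl envelope_scale) auto
    also have "\<dots> = (1 / x) powr \<alpha> * E" by (simp add: E_def)
    also have "(1 / x) powr \<alpha> = x powr (- \<alpha>)" using x by (simp add: powr_minus_divide powr_divide)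
    also have "x powr (- \<alpha>) * E = (E powr (1 / \<alpha>)) powr \<alpha> * x powr (- \<alpha>)"
      using E assms(1) by (simp add: powr_powr)
    finally show ?thesis .
  qed
  ultimately show "\<exists>\<sigma>. frechet_rv Pr \<alpha> \<sigma> ?Y"
    using Y unfolding frechet_rv_def by (intro exI[of _ "E powr (1 / \<alpha>)"]) simp
qed

section \<open>Extremal integrals of simple functions\<close>

lemma sup_measure_measurable:
  assumes "frechet_sup_measure Pr \<alpha> \<mu> M" "A \<in> sets \<mu>"
  shows "M A \<in> borel_measurable Pr"
  using assms by (simp add: frechet_sup_measure_def)

lemma sup_measure_finite:
  assumes "frechet_sup_measure Pr \<alpha> \<mu> M" "A \<in> sets \<mu>" "emeasure \<mu> A < \<infinity>"
  shows "AE \<omega> in Pr. M A \<omega> < \<infinity>"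
    "frechet_rv Pr \<alpha> (measure \<mu> A powr (1 / \<alpha>)) (\<lambda>\<omega>. enn2real (M A \<omega>))"
  using assms unfolding frechet_sup_measure_def by (auto split: if_splits)

lemma sup_measure_cdf:
  assumes "prob_space Pr" "frechet_sup_measure Pr \<alpha> \<mu> M" "0 < \<alpha>"
    and A: "A \<in> sets \<mu>" "emeasure \<mu> A < \<infinity>" and x: "0 < x"
  shows "measure Pr {\<omega> \<in> space Pr. M A \<omega> \<le> ennreal x} = exp (- (measure \<mu> A * x powr (- \<alpha>)))"
proof -
  interpret prob_space Pr by fact
  note [measurable] = sup_measure_measurable[OF assms(2) A(1)]
  have fin: "AE \<omega> in Pr. M A \<omega> < \<infinity>"
    and fr: "frechet_rv Pr \<alpha> (measure \<mu> A powr (1 / \<alpha>)) (\<lambda>\<omega>. enn2real (M A \<omega>))"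
    using sup_measure_finite[OF assms(2) A] by auto
  have "prob {\<omega> \<in> space Pr. M A \<omega> \<le> ennreal x} = prob {\<omega> \<in> space Pr. enn2real (M A \<omega>) \<le> x}"
  proof (rule finite_measure_eq_AE)
    show "AE \<omega> in Pr. (\<omega> \<in> {\<omega> \<in> space Pr. M A \<omega> \<le> ennreal x}) = (\<omega> \<in> {\<omega> \<in> space Pr. enn2real (M A \<omega>) \<le> x})"
      using fin
    proof eventually_elim
      case (elim \<omega>)
      then obtain r where "M A \<omega> = ennreal r" "0 \<le> r" by (cases "M A \<omega>") auto
      then show ?case using x by simp
    qed
  qed measurable
  also have "\<dots> = cdf (distr Pr borel (\<lambda>\<omega>. enn2real (M A \<omega>))) x"
    by (simp add: cdf_def measure_distr vimage_def Int_def conj_commute)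
  also have "\<dots> = exp (- ((measure \<mu> A powr (1 / \<alpha>)) powr \<alpha> * x powr (- \<alpha>)))"
    using fr x by (simp add: frechet_rv_def)
  also have "(measure \<mu> A powr (1 / \<alpha>)) powr \<alpha> = measure \<mu> A"
    using assms(3) by (simp add: powr_powr)
  finally show ?thesis .
qed

lemma sup_measure_empty:
  assumes "prob_space Pr" "frechet_sup_measure Pr \<alpha> \<mu> M" "0 < \<alpha>"
  shows "AE \<omega> in Pr. M {} \<omega> = 0"
proof -
  interpret prob_space Pr by fact
  note [measurable] = sup_measure_measurable[OF assms(2) sets.empty_sets]
  have "AE \<omega> in Pr. M {} \<omega> \<le> ennreal (1 / Suc k)" for k
  proof -
    have "prob {\<omega> \<in> space Pr. M {} \<omega> \<le> ennreal (1 / Suc k)} = 1"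
      using sup_measure_cdf[OF assms sets.empty_sets, of "1 / Suc k"] by simp
    from AE_prob_1[OF this] show ?thesis by simp
  qed
  then have "AE \<omega> in Pr. \<forall>k. M {} \<omega> \<le> ennreal (1 / Suc k)" by (simp add: AE_all_countable)
  then show ?thesis
  proof eventually_elim
    case (elim \<omega>)
    have "(\<lambda>k. ennreal (1 / Suc k)) \<longlonglongrightarrow> ennreal 0"
      using LIMSEQ_inverse_real_of_nat by (intro tendsto_ennrealI) (simp add: inverse_eq_divide)
    then have "M {} \<omega> \<le> ennreal 0"
      by (rule LIMSEQ_le_const) (use elim in blast)
    then show ?case by simp
  qed
qed

text \<open>The sup-measure axiom concerns infinite sequences.  Padding with the empty set, on which the measure
  vanishes almost surely, gives arbitrary subfamilies of a sequence.\<close>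

lemma sup_measure_Union:
  fixes Q :: "nat set"
  assumes "prob_space Pr" "frechet_sup_measure Pr \<alpha> \<mu> M" "0 < \<alpha>"
    and B: "disjoint_family B" "range B \<subseteq> sets \<mu>"
  shows "AE \<omega> in Pr. M (\<Union>k\<in>Q. B k) \<omega> = (SUP k\<in>Q. M (B k) \<omega>)"
proof -
  define A where "A k = (if k \<in> Q then B k else {})" for k :: nat
  have "disjoint_family A" "range A \<subseteq> sets \<mu>"
    using B by (auto simp: A_def disjoint_family_on_def)
  then have "AE \<omega> in Pr. M (\<Union>k. A k) \<omega> = (SUP k. M (A k) \<omega>)"
    using assms(2) by (simp add: frechet_sup_measure_def)
  moreover have "(\<Union>k. A k) = (\<Union>k\<in>Q. B k)" by (auto simp: A_def)
  ultimately have "AE \<omega> in Pr. M (\<Union>k\<in>Q. B k) \<omega> = (SUP k. M (A k) \<omega>)" by simp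
  then show ?thesis
    using sup_measure_empty[OF assms(1-3)]
  proof eventually_elim
    case (elim \<omega>)
    have "(SUP k. M (A k) \<omega>) = (SUP k\<in>Q. M (B k) \<omega>)"
    proof (rule antisym)
      show "(SUP k. M (A k) \<omega>) \<le> (SUP k\<in>Q. M (B k) \<omega>)"
        by (rule SUP_least) (auto simp: A_def elim(2) intro: SUP_upper)
      show "(SUP k\<in>Q. M (B k) \<omega>) \<le> (SUP k. M (A k) \<omega>)"
        by (rule SUP_least, rule SUP_upper2) (auto simp: A_def)
    qed
    with elim show ?case by simp
  qed
qed

text \<open>The cells are the level sets of the vector of all functions; \<open>s k\<close> represents cell \<open>k\<close>.\<close>

lemma common_partition:
  fixes g :: "'i \<Rightarrow> 's \<Rightarrow> real"
  assumes I: "finite I" and g: "\<And>i. i \<in> I \<Longrightarrow> simple_function \<mu> (g i)"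
  obtains N :: nat and B :: "nat \<Rightarrow> 's set" and s :: "nat \<Rightarrow> 's"
  where "disjoint_family B" "range B \<subseteq> sets \<mu>" "(\<Union>k<N. B k) = space \<mu>"
    "\<forall>k<N. s k \<in> B k" "\<forall>k<N. \<forall>x\<in>B k. \<forall>i\<in>I. g i x = g i (s k)"
proof -
  define V where "V x = (\<lambda>i\<in>I. g i x)" for x
  have "V ` space \<mu> \<subseteq> Pi\<^sub>E I (\<lambda>i. g i ` space \<mu>)" by (auto simp: V_def)
  moreover have "finite (Pi\<^sub>E I (\<lambda>i. g i ` space \<mu>))"
    using I g by (intro finite_PiE) (auto simp: simple_function_def)
  ultimately have fin: "finite (V ` space \<mu>)" by (rule finite_subset)
  obtain e where e: "bij_betw e {0..<card (V ` space \<mu>)} (V ` space \<mu>)"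
    using ex_bij_betw_nat_finite[OF fin] by blast
  define N where "N = card (V ` space \<mu>)"
  define B where "B k = (if k < N then {x \<in> space \<mu>. V x = e k} else {})" for k
  have "\<exists>s. k < N \<longrightarrow> s \<in> B k" for k
  proof -
    have "e k \<in> V ` space \<mu>" if "k < N" using e that by (auto simp: bij_betw_def N_def)
    then have "B k \<noteq> {}" if "k < N" using that by (force simp: B_def)
    then show ?thesis by blast
  qed
  then obtain s where s: "\<And>k. k < N \<Longrightarrow> s k \<in> B k" by metis
  have V: "V x = V y \<longleftrightarrow> (\<forall>i\<in>I. g i x = g i y)" for x y
    by (auto simp: V_def fun_eq_iff restrict_def)
  show thesis
  proof
    show "disjoint_family B"
      using e by (auto simp: disjoint_family_on_def B_def bij_betw_def N_def inj_on_def split: if_splits)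
    show "range B \<subseteq> sets \<mu>"
    proof clarify
      fix k
      have "B k = {x \<in> space \<mu>. \<forall>i\<in>I. g i x = g i (s k)}" if "k < N"
        using s[OF that] that by (auto simp: B_def V[symmetric])
      moreover have [measurable]: "i \<in> I \<Longrightarrow> g i \<in> borel_measurable \<mu>" for i
        using g by (rule borel_measurable_simple_function)
      have "{x \<in> space \<mu>. \<forall>i\<in>I. g i x = g i (s k)} \<in> sets \<mu>"
        using I by measurable
      ultimately show "B k \<in> sets \<mu>" by (cases "k < N") (auto simp: B_def)
    qed
    show "(\<Union>k<N. B k) = space \<mu>"
    proof
      show "(\<Union>k<N. B k) \<subseteq> space \<mu>" by (auto simp: B_def)
      show "space \<mu> \<subseteq> (\<Union>k<N. B k)"
      proof
        fix x assume x: "x \<in> space \<mu>"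
        then have "V x \<in> e ` {0..<N}" using e by (auto simp: bij_betw_def N_def)
        then show "x \<in> (\<Union>k<N. B k)" using x by (auto simp: B_def)
      qed
    qed
    show "\<forall>k<N. \<forall>x\<in>B k. \<forall>i\<in>I. g i x = g i (s k)"
    proof (intro allI impI ballI)
      fix k x i assume "k < N" "x \<in> B k" "i \<in> I"
      moreover from this s have "V x = V (s k)" by (auto simp: B_def split: if_splits)
      ultimately show "g i x = g i (s k)" using V by blast
    qed
  qed (use s in blast)
qed

lemma simple_extremal_integral_partition:
  fixes B :: "nat \<Rightarrow> 's set"
  assumes "prob_space Pr" "frechet_sup_measure Pr \<alpha> \<mu> M" "0 < \<alpha>"
    and g: "simple_function \<mu> g"
    and B: "disjoint_family B" "range B \<subseteq> sets \<mu>" "(\<Union>k<N. B k) = space \<mu>"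
    and s: "\<And>k. k < N \<Longrightarrow> s k \<in> B k" "\<And>k x. k < N \<Longrightarrow> x \<in> B k \<Longrightarrow> g x = g (s k)"
  shows "AE \<omega> in Pr. simple_extremal_integral M \<mu> g \<omega> = (SUP k\<in>{..<N}. ennreal (g (s k)) * M (B k) \<omega>)"
proof -
  define Q where "Q y = {k. k < N \<and> g (s k) = y}" for y
  have sp: "s k \<in> space \<mu>" if "k < N" for k using s(1)[OF that] B(3) that by blast
  have "g -` {y} \<inter> space \<mu> = (\<Union>k\<in>Q y. B k)" for y
  proof (intro set_eqI iffI)
    fix x assume x: "x \<in> g -` {y} \<inter> space \<mu>"
    then obtain k where "k < N" "x \<in> B k" using B(3) by auto
    with x s(2)[of k x] show "x \<in> (\<Union>k\<in>Q y. B k)" by (auto simp: Q_def)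
  next
    fix x assume "x \<in> (\<Union>k\<in>Q y. B k)"
    then obtain k where "k < N" "g (s k) = y" "x \<in> B k" by (auto simp: Q_def)
    with s(2)[of k x] B(3) show "x \<in> g -` {y} \<inter> space \<mu>" by auto
  qed
  moreover have "finite (g ` space \<mu>)" using g by (rule simple_functionD)
  ultimately have "AE \<omega> in Pr. \<forall>y\<in>g ` space \<mu>. M (g -` {y} \<inter> space \<mu>) \<omega> = (SUP k\<in>Q y. M (B k) \<omega>)"
    using sup_measure_Union[OF assms(1-3) B(1,2)] by (intro AE_finite_allI) auto
  then show ?thesis
  proof eventually_elim
    case (elim \<omega>)
    have "simple_extremal_integral M \<mu> g \<omega>
        = (SUP y\<in>g ` space \<mu>. SUP k\<in>Q y. ennreal y * M (B k) \<omega>)"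
      unfolding simple_extremal_integral_def
      by (intro SUP_cong refl) (simp add: elim SUP_mult_left_ennreal)
    also have "\<dots> = (SUP k\<in>{..<N}. ennreal (g (s k)) * M (B k) \<omega>)"
    proof (rule antisym)
      show "(SUP y\<in>g ` space \<mu>. SUP k\<in>Q y. ennreal y * M (B k) \<omega>) \<le> (SUP k\<in>{..<N}. ennreal (g (s k)) * M (B k) \<omega>)"
        by (intro SUP_least) (auto simp: Q_def intro: SUP_upper)
      show "(SUP k\<in>{..<N}. ennreal (g (s k)) * M (B k) \<omega>) \<le> (SUP y\<in>g ` space \<mu>. SUP k\<in>Q y. ennreal y * M (B k) \<omega>)"
      proof (rule SUP_least)
        fix k assume k: "k \<in> {..<N}"
        then have "ennreal (g (s k)) * M (B k) \<omega> \<le> (SUP l\<in>Q (g (s k)). ennreal (g (s k)) * M (B l) \<omega>)"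
          by (intro SUP_upper) (simp add: Q_def)
        also have "\<dots> \<le> (SUP y\<in>g ` space \<mu>. SUP k\<in>Q y. ennreal y * M (B k) \<omega>)"
          using sp k by (intro SUP_upper) auto
        finally show "ennreal (g (s k)) * M (B k) \<omega> \<le> (SUP y\<in>g ` space \<mu>. SUP k\<in>Q y. ennreal y * M (B k) \<omega>)" .
      qed
    qed
    finally show ?case .
  qed
qed

lemma simple_extremal_integral_measurable:
  assumes "frechet_sup_measure Pr \<alpha> \<mu> M" "simple_function \<mu> g"
  shows "simple_extremal_integral M \<mu> g \<in> borel_measurable Pr"
proof -
  have "M (g -` {y} \<inter> space \<mu>) \<in> borel_measurable Pr" for y
    using sup_measure_measurable[OF assms(1) simple_functionD(2)[OF assms(2), of "{y}"]] .
  then show ?thesis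
    unfolding simple_extremal_integral_def[abs_def]
    using simple_functionD(1)[OF assms(2)]
    by (intro borel_measurable_SUP borel_measurable_times_ennreal) (auto intro: countable_finite)
qed

text \<open>A cell on which an integrable function is bounded below by \<open>c > 0\<close> has finite measure.  For \<open>c = 0\<close> the
  cell may have infinite measure but contributes nothing; both cases occur for simple integrands.\<close>

lemma integrable_indicator_of_lower_bound:
  assumes "integrable \<mu> (h :: 's \<Rightarrow> real)" "B \<in> sets \<mu>" "0 \<le> c"
    "\<And>x. x \<in> B \<Longrightarrow> c \<le> h x" "\<And>x. x \<in> space \<mu> \<Longrightarrow> 0 \<le> h x"
  shows "integrable \<mu> (\<lambda>x. c * indicator B x)" "0 < c \<Longrightarrow> emeasure \<mu> B < \<infinity>"
proof -
  show int: "integrable \<mu> (\<lambda>x. c * indicator B x)"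
    by (rule Bochner_Integration.integrable_bound[OF assms(1)])
       (use assms in \<open>auto simp: indicator_def intro!: AE_I2\<close>)
  assume "0 < c"
  then have "integrable \<mu> (indicator B :: 's \<Rightarrow> real)" using int by simp
  then show "emeasure \<mu> B < \<infinity>"
    using assms(2) sets.sets_into_space[OF assms(2)] by (simp add: integrable_indicator_iff Int_absorb2)
qed

lemma simple_extremal_integral_finite:
  assumes "frechet_sup_measure Pr \<alpha> \<mu> M" "0 < \<alpha>"
    and g: "simple_function \<mu> g" "g \<in> L_plus \<alpha> \<mu>"
  shows "AE \<omega> in Pr. simple_extremal_integral M \<mu> g \<omega> < \<infinity>"
proof -
  have "AE \<omega> in Pr. ennreal y * M (g -` {y} \<inter> space \<mu>) \<omega> < \<infinity>" if y: "y \<in> g ` space \<mu>" for y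
  proof (cases "y = 0")
    case False
    then have "0 < y" using y L_plusD(2)[OF g(2)] by (force simp: less_le)
    then have "emeasure \<mu> (g -` {y} \<inter> space \<mu>) < \<infinity>"
      using simple_functionD(2)[OF g(1), of "{y}"]
      by (intro integrable_indicator_of_lower_bound(2)[OF L_plusD(3)[OF g(2)], of _ "y powr \<alpha>"]) auto
    from sup_measure_finite(1)[OF assms(1) simple_functionD(2)[OF g(1)] this]
    show ?thesis by eventually_elim (simp add: ennreal_mult_less_top)
  qed simp
  then have "AE \<omega> in Pr. \<forall>y\<in>g ` space \<mu>. ennreal y * M (g -` {y} \<inter> space \<mu>) \<omega> < \<infinity>"
    using simple_functionD(1)[OF g(1)] by (intro AE_finite_allI) auto
  then show ?thesis
  proof eventually_elim
    case (elim \<omega>)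
    show ?case
    proof (cases "space \<mu> = {}")
      case False
      then have "(SUP y\<in>g ` space \<mu>. ennreal y * M (g -` {y} \<inter> space \<mu>) \<omega>)
          \<in> (\<lambda>y. ennreal y * M (g -` {y} \<inter> space \<mu>) \<omega>) ` g ` space \<mu>"
        using simple_functionD(1)[OF g(1)] by (subst Max_Sup[symmetric]) (auto intro!: Max_in)
      then show ?thesis unfolding simple_extremal_integral_def using elim by auto
    qed (simp add: simple_extremal_integral_def bot_ennreal)
  qed
qed

text \<open>On a common partition \<open>B\<close> all the integrals are maxima of multiples of the independent variables
  \<open>M (B k)\<close>.  If \<open>c k\<close> is the value of the envelope on \<open>B k\<close>, the box event says that
  \<open>c\<^sub>k\<^sup>1\<^sup>/\<^sup>\<alpha> M(B\<^sub>k) \<le> 1\<close> for all \<open>k\<close>, and this has probability \<open>exp (- c\<^sub>k \<mu>(B\<^sub>k))\<close> for each \<open>k\<close>.\<close>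

lemma simple_extremal_integral_box:
  fixes g :: "'i \<Rightarrow> 's \<Rightarrow> real"
  assumes Pr: "prob_space Pr" "frechet_sup_measure Pr \<alpha> \<mu> M" "0 < \<alpha>"
    and K: "positive_weights K"
    and simple: "\<And>i a. (i, a) \<in> K \<Longrightarrow> simple_function \<mu> (g i)"
    and L: "\<And>i a. (i, a) \<in> K \<Longrightarrow> g i \<in> L_plus \<alpha> \<mu>"
  shows "measure Pr (box_event Pr (\<lambda>i \<omega>. enn2real (simple_extremal_integral M \<mu> (g i) \<omega>)) K)
    = exp (- exponent \<alpha> \<mu> g K)"
proof -
  interpret prob_space Pr by fact
  have fin: "finite K" using K by (rule positive_weights_finite)
  note pos = positive_weightsD[OF K]
  let ?S = "\<lambda>i. simple_extremal_integral M \<mu> (g i)"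
  have simple': "simple_function \<mu> (g i)" if "i \<in> fst ` K" for i using simple that by auto
  obtain N :: nat and B and s where B: "disjoint_family B" "range B \<subseteq> sets \<mu>" "(\<Union>k<N. B k) = space \<mu>"
    and s': "\<forall>k<N. s k \<in> B k" "\<forall>k<N. \<forall>x\<in>B k. \<forall>i\<in>fst ` K. g i x = g i (s k)"
    by (rule common_partition[of "fst ` K" \<mu> g, OF finite_imageI[OF fin] simple']) (assumption, rule that)
  have s: "s k \<in> B k" "x \<in> B k \<Longrightarrow> i \<in> fst ` K \<Longrightarrow> g i x = g i (s k)" if "k < N" for k x i
    using s' that by blast+
  have sp: "s k \<in> space \<mu>" if "k < N" for k using s(1)[OF that] B(3) that by blast
  define c where "c k = envelope \<alpha> g K (s k)" for k
  have c0: "0 \<le> c k" for k unfolding c_def using fin by (rule envelope_nonneg)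
  have cB: "envelope \<alpha> g K x = c k" if "k < N" "x \<in> B k" for x k
  proof -
    have "(\<lambda>(i, a). (a * g i x) powr \<alpha>) ` K = (\<lambda>(i, a). (a * g i (s k)) powr \<alpha>) ` K"
    proof (intro image_cong refl, clarify)
      fix i a assume "(i, a) \<in> K"
      then have "i \<in> fst ` K" by force
      then show "(a * g i x) powr \<alpha> = (a * g i (s k)) powr \<alpha>" using s(2)[OF that] by simp
    qed
    then show ?thesis by (simp add: envelope_def c_def)
  qed
  have env: "integrable \<mu> (envelope \<alpha> g K)" using K L by (rule integrable_envelope)
  have Bk: "integrable \<mu> (\<lambda>x. c k * indicator (B k) x)" "0 < c k \<Longrightarrow> emeasure \<mu> (B k) < \<infinity>" if k: "k < N" for k
  proof -
    have 1: "B k \<in> sets \<mu>" using B(2) by auto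
    have 2: "c k \<le> envelope \<alpha> g K x" if "x \<in> B k" for x using cB[OF k that] by simp
    show "integrable \<mu> (\<lambda>x. c k * indicator (B k) x)"
      by (rule integrable_indicator_of_lower_bound(1)[OF env 1 c0 2 envelope_nonneg[OF fin]])
    show "0 < c k \<Longrightarrow> emeasure \<mu> (B k) < \<infinity>"
      by (rule integrable_indicator_of_lower_bound(2)[OF env 1 c0 2 envelope_nonneg[OF fin]])
  qed
  have int: "(\<integral>x. envelope \<alpha> g K x \<partial>\<mu>) = (\<Sum>k<N. c k * measure \<mu> (B k))"
  proof -
    have "(\<integral>x. envelope \<alpha> g K x \<partial>\<mu>) = (\<integral>x. (\<Sum>k<N. c k * indicator (B k) x) \<partial>\<mu>)"
    proof (intro Bochner_Integration.integral_cong refl)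
      fix x assume "x \<in> space \<mu>"
      then obtain k where k: "k < N" "x \<in> B k" using B(3) by auto
      then have "indicator (B l) x = (if l = k then 1 else 0 :: real)" for l
        using B(1) by (auto simp: indicator_def disjoint_family_on_def)
      then have "(\<Sum>l<N. c l * indicator (B l) x) = c k"
        using k by (simp add: if_distrib[of "\<lambda>y. _ * y"] cong: if_cong)
      then show "envelope \<alpha> g K x = (\<Sum>k<N. c k * indicator (B k) x)" using cB[OF k] by simp
    qed
    also have "\<dots> = (\<Sum>k<N. c k * measure \<mu> (B k))"
      using Bk(1) B(2) sets.sets_into_space[of _ \<mu>]
      by (subst Bochner_Integration.integral_sum) (auto simp: Int_absorb2 range_subsetD)
    finally show ?thesis .
  qed
  have meas [measurable]: "M (B k) \<in> borel_measurable Pr" for k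
    using B(2) by (intro sup_measure_measurable[OF Pr(2)]) auto
  let ?A = "\<lambda>k. {m :: ennreal. ennreal (c k powr (1 / \<alpha>)) * m \<le> 1}"
  have A: "?A k \<in> sets borel" for k
  proof -
    have "{m \<in> space borel. ennreal (c k powr (1 / \<alpha>)) * m \<le> 1} \<in> sets borel" by measurable
    then show ?thesis by simp
  qed
  have pA: "prob (M (B k) -` ?A k \<inter> space Pr) = exp (- (c k * measure \<mu> (B k)))" if k: "k < N" for k
  proof (cases "c k = 0")
    case True
    then show ?thesis by (simp add: prob_space)
  next
    case False
    then have ck: "0 < c k" using c0[of k] by simp
    let ?r = "c k powr (1 / \<alpha>)"
    have r: "0 < ?r" using ck by simp
    have "ennreal ?r * m \<le> 1 \<longleftrightarrow> m \<le> ennreal (1 / ?r)" for m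
    proof (cases m)
      case (real x)
      then show ?thesis using r by (simp add: ennreal_mult[symmetric] field_simps flip: ennreal_1)
    next
      case top
      then show ?thesis using r by (simp add: ennreal_mult_top top_unique)
    qed
    then have "M (B k) -` ?A k \<inter> space Pr = {\<omega> \<in> space Pr. M (B k) \<omega> \<le> ennreal (1 / ?r)}" by auto
    then have "prob (M (B k) -` ?A k \<inter> space Pr) = exp (- (measure \<mu> (B k) * (1 / ?r) powr (- \<alpha>)))"
      using sup_measure_cdf[OF Pr _ Bk(2)[OF k ck], of "1 / ?r"] B(2) r by auto
    also have "(1 / ?r) powr (- \<alpha>) = c k"
      using ck Pr(3) by (simp add: powr_minus_divide powr_divide powr_powr)
    finally show ?thesis by (simp add: mult.commute)
  qed
  have indep: "indep_vars (\<lambda>_. borel) (\<lambda>k. M (B k)) UNIV"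
    using Pr(2) B(1,2) by (simp add: frechet_sup_measure_def)
  have prodform: "prob {\<omega> \<in> space Pr. \<forall>k<N. M (B k) \<omega> \<in> ?A k} = (\<Prod>k<N. exp (- (c k * measure \<mu> (B k))))"
  proof (cases "N = 0")
    case True
    then show ?thesis by (simp add: prob_space)
  next
    case False
    have "{\<omega> \<in> space Pr. \<forall>k<N. M (B k) \<omega> \<in> ?A k} = (\<Inter>k\<in>{..<N}. M (B k) -` ?A k \<inter> space Pr)"
      using False by auto
    also have "prob \<dots> = (\<Prod>k<N. prob (M (B k) -` ?A k \<inter> space Pr))"
      using False A by (intro indep_varsD[OF indep]) auto
    finally show ?thesis using pA by simp
  qed
  \<comment> \<open>The integrals are finite almost surely, so passing to real values does not alter the box event.\<close>
  have "AE \<omega> in Pr. \<forall>i\<in>fst ` K. ?S i \<omega> = (SUP k\<in>{..<N}. ennreal (g i (s k)) * M (B k) \<omega>)"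
  proof (rule AE_finite_allI)
    fix i assume i: "i \<in> fst ` K"
    then have "simple_function \<mu> (g i)" using simple by auto
    then show "AE \<omega> in Pr. ?S i \<omega> = (SUP k\<in>{..<N}. ennreal (g i (s k)) * M (B k) \<omega>)"
      by (rule simple_extremal_integral_partition[OF Pr _ B, where s = s and g = "g i"]) (erule s(1), rule s(2)[OF _ _ i])
  qed (use fin in simp)
  moreover have "AE \<omega> in Pr. \<forall>i\<in>fst ` K. ?S i \<omega> < \<infinity>"
  proof (rule AE_finite_allI)
    fix i assume "i \<in> fst ` K"
    then obtain a where ia: "(i, a) \<in> K" by auto
    show "AE \<omega> in Pr. ?S i \<omega> < \<infinity>"
      by (rule simple_extremal_integral_finite[OF Pr(2,3) simple[OF ia] L[OF ia]])
  qed (use fin in simp)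
  ultimately have "AE \<omega> in Pr. \<omega> \<in> box_event Pr (\<lambda>i \<omega>. enn2real (?S i \<omega>)) K \<longleftrightarrow>
      \<omega> \<in> {\<omega> \<in> space Pr. \<forall>k<N. M (B k) \<omega> \<in> ?A k}"
  proof eventually_elim
    case (elim \<omega>)
    have "a * enn2real (?S i \<omega>) \<le> 1 \<longleftrightarrow> (\<forall>k<N. ennreal (a * g i (s k)) * M (B k) \<omega> \<le> 1)"
      if ia: "(i, a) \<in> K" for i a
    proof -
      have i: "i \<in> fst ` K" using ia by force
      have a: "0 < a" using pos[OF ia] .
      have gpos: "0 \<le> g i (s k)" if "k < N" for k using L_plusD(2)[OF L[OF ia] sp[OF that]] .
      obtain r where r: "?S i \<omega> = ennreal r" "0 \<le> r" using elim(2) i by (cases "?S i \<omega>") auto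
      have "a * enn2real (?S i \<omega>) \<le> 1 \<longleftrightarrow> ennreal a * ?S i \<omega> \<le> 1"
        using r a by (simp add: ennreal_mult[symmetric] flip: ennreal_1)
      also have "ennreal a * ?S i \<omega> = (SUP k\<in>{..<N}. ennreal (a * g i (s k)) * M (B k) \<omega>)"
        unfolding bspec[OF elim(1) i] SUP_mult_left_ennreal
        using gpos a by (intro SUP_cong refl) (simp add: ennreal_mult mult.assoc)
      also have "\<dots> \<le> 1 \<longleftrightarrow> (\<forall>k<N. ennreal (a * g i (s k)) * M (B k) \<omega> \<le> 1)"
        by (auto simp: SUP_le_iff)
      finally show ?thesis .
    qed
    then have "\<omega> \<in> box_event Pr (\<lambda>i \<omega>. enn2real (?S i \<omega>)) K \<longleftrightarrow>
        \<omega> \<in> space Pr \<and> (\<forall>k<N. \<forall>(i, a)\<in>K. ennreal (a * g i (s k)) * M (B k) \<omega> \<le> 1)"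
      unfolding box_event_def by fastforce
    also have "\<dots> \<longleftrightarrow> \<omega> \<in> space Pr \<and> (\<forall>k<N. M (B k) \<omega> \<in> ?A k)"
    proof (intro conj_cong refl all_cong imp_cong)
      fix k assume k: "k < N"
      have root: "ennreal (a * g i (s k)) = ennreal (((a * g i (s k)) powr \<alpha>) powr (1 / \<alpha>))" if "(i, a) \<in> K" for i a
        using pos[OF that] L_plusD(2)[OF L[OF that] sp[OF k]] Pr(3) by (simp add: powr_powr)
      show "(\<forall>(i, a)\<in>K. ennreal (a * g i (s k)) * M (B k) \<omega> \<le> 1) \<longleftrightarrow> M (B k) \<omega> \<in> ?A k"
      proof
        assume "M (B k) \<omega> \<in> ?A k"
        then have 1: "ennreal (c k powr (1 / \<alpha>)) * M (B k) \<omega> \<le> 1" by simp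
        show "\<forall>(i, a)\<in>K. ennreal (a * g i (s k)) * M (B k) \<omega> \<le> 1"
        proof clarify
          fix i a assume ia: "(i, a) \<in> K"
          have "ennreal (a * g i (s k)) \<le> ennreal (c k powr (1 / \<alpha>))"
            unfolding root[OF ia] c_def
            using envelope_ge[OF fin ia, of g "s k" \<alpha>] Pr(3) by (intro ennreal_leI powr_mono2) auto
          from order_trans[OF mult_right_mono[OF this] 1]
          show "ennreal (a * g i (s k)) * M (B k) \<omega> \<le> 1" by simp
        qed
      next
        assume *: "\<forall>(i, a)\<in>K. ennreal (a * g i (s k)) * M (B k) \<omega> \<le> 1"
        have "c k \<in> insert 0 ((\<lambda>(i, a). (a * g i (s k)) powr \<alpha>) ` K)"
          unfolding c_def envelope_def using fin by (intro Max_in) auto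
        then show "M (B k) \<omega> \<in> ?A k"
        proof
          assume "c k \<in> (\<lambda>(i, a). (a * g i (s k)) powr \<alpha>) ` K"
          then obtain i a where "(i, a) \<in> K" "c k = (a * g i (s k)) powr \<alpha>" by auto
          then show ?thesis using * root by force
        qed simp
      qed
    qed
    finally show ?case by simp
  qed
  then have "prob (box_event Pr (\<lambda>i \<omega>. enn2real (?S i \<omega>)) K) = prob {\<omega> \<in> space Pr. \<forall>k<N. M (B k) \<omega> \<in> ?A k}"
  proof (rule finite_measure_eq_AE)
    show "box_event Pr (\<lambda>i \<omega>. enn2real (?S i \<omega>)) K \<in> events"
    proof (rule sets_box_event[OF fin])
      fix i a assume "(i, a) \<in> K"
      from simple_extremal_integral_measurable[OF Pr(2) simple[OF this]]
      show "(\<lambda>\<omega>. enn2real (?S i \<omega>)) \<in> borel_measurable Pr" by measurable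
    qed
    show "{\<omega> \<in> space Pr. \<forall>k<N. M (B k) \<omega> \<in> ?A k} \<in> events" by measurable
  qed
  also have "\<dots> = exp (- (\<integral>x. envelope \<alpha> g K x \<partial>\<mu>))"
    unfolding prodform int by (simp add: exp_sum sum_negf[symmetric])
  finally show ?thesis .
qed

section \<open>Extremal integrals of general integrands\<close>

text \<open>Raising each entry of a maximum by at most some amount raises the maximum by at most the sum of the
  amounts.  This makes the exponent continuous in \<open>rho\<close>.\<close>

lemma envelope_le_add:
  assumes K: "positive_weights K"
    and g: "\<And>i a. (i, a) \<in> K \<Longrightarrow> 0 \<le> g i s" "\<And>i a. (i, a) \<in> K \<Longrightarrow> 0 \<le> h i s"
  shows "envelope \<alpha> g K s
    \<le> envelope \<alpha> h K s + (\<Sum>p\<in>K. snd p powr \<alpha> * \<bar>g (fst p) s powr \<alpha> - h (fst p) s powr \<alpha>\<bar>)"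
    (is "_ \<le> _ + ?\<Sigma>")
proof (subst envelope_le_iff)
  have fin: "finite K" using K by (rule positive_weights_finite)
  then show "finite K" .
  have \<Sigma>: "0 \<le> ?\<Sigma>" by (intro sum_nonneg) simp
  show "0 \<le> envelope \<alpha> h K s + ?\<Sigma> \<and> (\<forall>(i, a)\<in>K. (a * g i s) powr \<alpha> \<le> envelope \<alpha> h K s + ?\<Sigma>)"
  proof (intro conjI ballI, goal_cases)
    case 1 then show ?case using \<Sigma> envelope_nonneg[OF fin, of \<alpha> h s] by simp
  next
    case (2 p)
    obtain i a where p: "p = (i, a)" by (cases p)
    with 2 have ia: "(i, a) \<in> K" by simp
    have a: "0 < a" using positive_weightsD[OF K ia] .
    have "(a * g i s) powr \<alpha> = (a * h i s) powr \<alpha> + a powr \<alpha> * (g i s powr \<alpha> - h i s powr \<alpha>)"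
      using a g(1)[OF ia] g(2)[OF ia] by (simp add: powr_mult algebra_simps)
    also have "a powr \<alpha> * (g i s powr \<alpha> - h i s powr \<alpha>) \<le> a powr \<alpha> * \<bar>g i s powr \<alpha> - h i s powr \<alpha>\<bar>"
      by (intro mult_left_mono) auto
    also have "\<dots> \<le> ?\<Sigma>"
      using member_le_sum[OF ia, where f = "\<lambda>p. snd p powr \<alpha> * \<bar>g (fst p) s powr \<alpha> - h (fst p) s powr \<alpha>\<bar>"] fin
      by simp
    finally show ?case using envelope_ge[OF fin ia, of h s \<alpha>] by (simp add: p)
  qed
qed

lemma envelope_diff_le:
  assumes K: "positive_weights K"
    and g: "\<And>i a. (i, a) \<in> K \<Longrightarrow> 0 \<le> g i s" "\<And>i a. (i, a) \<in> K \<Longrightarrow> 0 \<le> h i s"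
  shows "\<bar>envelope \<alpha> g K s - envelope \<alpha> h K s\<bar>
    \<le> (\<Sum>p\<in>K. snd p powr \<alpha> * \<bar>g (fst p) s powr \<alpha> - h (fst p) s powr \<alpha>\<bar>)"
proof -
  have "envelope \<alpha> g K s \<le> envelope \<alpha> h K s + (\<Sum>p\<in>K. snd p powr \<alpha> * \<bar>g (fst p) s powr \<alpha> - h (fst p) s powr \<alpha>\<bar>)"
    by (rule envelope_le_add[OF K]) (erule g(1), erule g(2))
  moreover have "envelope \<alpha> h K s \<le> envelope \<alpha> g K s + (\<Sum>p\<in>K. snd p powr \<alpha> * \<bar>h (fst p) s powr \<alpha> - g (fst p) s powr \<alpha>\<bar>)"
    by (rule envelope_le_add[OF K]) (erule g(2), erule g(1))
  ultimately show ?thesis by (simp add: abs_minus_commute abs_le_iff)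
qed

lemma tendsto_integral_envelope:
  fixes K :: "('i \<times> real) set"
  assumes K: "positive_weights K"
    and g: "\<And>i a. (i, a) \<in> K \<Longrightarrow> g i \<in> L_plus \<alpha> \<mu>"
    and h: "\<And>k i a. (i, a) \<in> K \<Longrightarrow> h i k \<in> L_plus \<alpha> \<mu>"
    and lim: "\<And>i a. (i, a) \<in> K \<Longrightarrow> (\<lambda>k. rho \<mu> \<alpha> (h i k) (g i)) \<longlonglongrightarrow> 0"
  shows "(\<lambda>k. \<integral>s. envelope \<alpha> (\<lambda>i. h i k) K s \<partial>\<mu>) \<longlonglongrightarrow> exponent \<alpha> \<mu> g K"
proof (rule LIM_zero_cancel, rule tendsto_rabs_zero_cancel, rule Lim_null_comparison)
  let ?d = "\<lambda>k p s. snd p powr \<alpha> * \<bar>h (fst p) k s powr \<alpha> - g (fst p) s powr \<alpha>\<bar>"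
  have int: "integrable \<mu> (\<lambda>s. \<bar>h i k s powr \<alpha> - g i s powr \<alpha>\<bar>)" if "(i, a) \<in> K" for i a k
    using L_plusD(3)[OF g[OF that]] L_plusD(3)[OF h[OF that]] by auto
  show "\<forall>\<^sub>F k in sequentially. norm \<bar>exponent \<alpha> \<mu> (\<lambda>i. h i k) K - exponent \<alpha> \<mu> g K\<bar>
      \<le> (\<Sum>p\<in>K. snd p powr \<alpha> * rho \<mu> \<alpha> (h (fst p) k) (g (fst p)))"
  proof (intro always_eventually allI)
    fix k
    have ih: "integrable \<mu> (envelope \<alpha> (\<lambda>i. h i k) K)" by (rule integrable_envelope[OF K h])
    have ig: "integrable \<mu> (envelope \<alpha> g K)" by (rule integrable_envelope[OF K g])
    have dint: "integrable \<mu> (?d k p)" if "p \<in> K" for p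
      using int[of "fst p" "snd p" k] that by simp
    have "\<bar>exponent \<alpha> \<mu> (\<lambda>i. h i k) K - exponent \<alpha> \<mu> g K\<bar>
        = \<bar>\<integral>s. envelope \<alpha> (\<lambda>i. h i k) K s - envelope \<alpha> g K s \<partial>\<mu>\<bar>"
      using ih ig by simp
    also have "\<dots> \<le> (\<integral>s. \<bar>envelope \<alpha> (\<lambda>i. h i k) K s - envelope \<alpha> g K s\<bar> \<partial>\<mu>)"
      by (rule integral_abs_bound)
    also have "\<dots> \<le> (\<integral>s. (\<Sum>p\<in>K. ?d k p s) \<partial>\<mu>)"
      using ih ig dint L_plusD(2)[OF g] L_plusD(2)[OF h]
      by (intro integral_mono Bochner_Integration.integrable_abs Bochner_Integration.integrable_diff
          Bochner_Integration.integrable_sum envelope_diff_le K) auto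
    also have "\<dots> = (\<Sum>p\<in>K. \<integral>s. ?d k p s \<partial>\<mu>)"
      using dint by (rule Bochner_Integration.integral_sum)
    also have "\<dots> = (\<Sum>p\<in>K. snd p powr \<alpha> * rho \<mu> \<alpha> (h (fst p) k) (g (fst p)))"
      by (simp add: rho_def)
    finally show "norm \<bar>exponent \<alpha> \<mu> (\<lambda>i. h i k) K - exponent \<alpha> \<mu> g K\<bar>
      \<le> (\<Sum>p\<in>K. snd p powr \<alpha> * rho \<mu> \<alpha> (h (fst p) k) (g (fst p)))" by simp
  qed
  have "(\<lambda>k. \<Sum>p\<in>K. snd p powr \<alpha> * rho \<mu> \<alpha> (h (fst p) k) (g (fst p))) \<longlonglongrightarrow> (\<Sum>p\<in>K. snd p powr \<alpha> * 0)"
  proof (intro tendsto_sum tendsto_mult tendsto_const)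
    fix p assume "p \<in> K"
    then show "(\<lambda>k. rho \<mu> \<alpha> (h (fst p) k) (g (fst p))) \<longlonglongrightarrow> 0" using lim[of "fst p" "snd p"] by simp
  qed
  then show "(\<lambda>k. \<Sum>p\<in>K. snd p powr \<alpha> * rho \<mu> \<alpha> (h (fst p) k) (g (fst p))) \<longlonglongrightarrow> 0" by simp
qed

text \<open>If \<open>a Z \<le> 1\<close> and \<open>r a U > 1\<close>, then \<open>U - Z > (1/r - 1) / a\<close>.  The shrinking factor \<open>r < 1\<close> leaves the
  room that convergence in probability needs.\<close>

lemma box_event_perturb:
  fixes Z U :: "'i \<Rightarrow> 'w \<Rightarrow> real"
  assumes "prob_space Pr" and K: "positive_weights K"
    and Z: "\<And>i a. (i, a) \<in> K \<Longrightarrow> Z i \<in> borel_measurable Pr"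
    and U: "\<And>i a. (i, a) \<in> K \<Longrightarrow> U i \<in> borel_measurable Pr"
    and r: "0 < r" "r < 1"
  shows "measure Pr (box_event Pr Z K) \<le> measure Pr (box_event Pr U ((\<lambda>(i, a). (i, r * a)) ` K))
    + (\<Sum>p\<in>K. measure Pr {\<omega> \<in> space Pr. (1 / r - 1) / snd p < \<bar>U (fst p) \<omega> - Z (fst p) \<omega>\<bar>})"
proof -
  interpret prob_space Pr by fact
  have fin: "finite K" using K by (rule positive_weights_finite)
  let ?D = "\<lambda>p. {\<omega> \<in> space Pr. (1 / r - 1) / snd p < \<bar>U (fst p) \<omega> - Z (fst p) \<omega>\<bar>}"
  let ?B = "box_event Pr U ((\<lambda>(i, a). (i, r * a)) ` K)"
  have D: "?D p \<in> events" if "p \<in> K" for p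
  proof -
    have [measurable]: "U (fst p) \<in> borel_measurable Pr" "Z (fst p) \<in> borel_measurable Pr"
      using U[of "fst p" "snd p"] Z[of "fst p" "snd p"] that by auto
    show ?thesis by measurable
  qed
  have B: "?B \<in> events" using fin U by (intro sets_box_event) auto
  have D': "(\<Union>p\<in>K. ?D p) \<in> events" by (rule sets.finite_UN[OF fin D])
  have sub: "box_event Pr Z K \<subseteq> ?B \<union> (\<Union>p\<in>K. ?D p)"
  proof
    fix \<omega> assume \<omega>: "\<omega> \<in> box_event Pr Z K"
    show "\<omega> \<in> ?B \<union> (\<Union>p\<in>K. ?D p)"
    proof (rule ccontr)
      assume not: "\<omega> \<notin> ?B \<union> (\<Union>p\<in>K. ?D p)"
      have "r * a * U i \<omega> \<le> 1" if ia: "(i, a) \<in> K" for i a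
      proof -
        have a: "0 < a" using positive_weightsD[OF K ia] .
        have Zle: "a * Z i \<omega> \<le> 1" and sp: "\<omega> \<in> space Pr" using \<omega> ia by (auto simp: box_event_def)
        have "\<bar>U i \<omega> - Z i \<omega>\<bar> \<le> (1 / r - 1) / a" using not ia sp by fastforce
        then have "U i \<omega> \<le> Z i \<omega> + (1 / r - 1) / a" by linarith
        then have "a * U i \<omega> \<le> a * (Z i \<omega> + (1 / r - 1) / a)" using a by (intro mult_left_mono) auto
        also have "\<dots> = a * Z i \<omega> + (1 / r - 1)" using a by (simp add: distrib_left)
        also have "\<dots> \<le> 1 / r" using Zle by simp
        finally show ?thesis using r by (simp add: field_simps)
      qed
      then have "\<omega> \<in> ?B" using \<omega> by (auto simp: box_event_def)
      with not show False by simp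
    qed
  qed
  have "prob (box_event Pr Z K) \<le> prob (?B \<union> (\<Union>p\<in>K. ?D p))"
    using sub sets.Un[OF B D'] by (rule finite_measure_mono)
  also have "\<dots> \<le> prob ?B + prob (\<Union>p\<in>K. ?D p)"
    by (rule measure_Un_le[OF B D'])
  also have "prob (\<Union>p\<in>K. ?D p) \<le> (\<Sum>p\<in>K. prob (?D p))"
    using fin D by (intro finite_measure_subadditive_finite) blast+
  finally show ?thesis by simp
qed

lemma has_extremal_integralD:
  assumes "has_extremal_integral Pr \<alpha> \<mu> M f Y"
  shows "f \<in> L_plus \<alpha> \<mu>" "Y \<in> borel_measurable Pr"
  using assms by (auto simp: has_extremal_integral_def)

text \<open>Approximating simple integrals \<open>U\<close> obey the formula.  Comparing the boxes of \<open>Z\<close> with boxes of \<open>U\<close>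
  scaled by \<open>r\<close> and \<open>1/r\<close> bounds the probability by \<open>exp (- r\<^sup>\<alpha> E)\<close> above and \<open>exp (- r\<^sup>-\<^sup>\<alpha> E)\<close> below, where \<open>E\<close> is
  the exponent; then \<open>r\<close> tends to 1 from below.\<close>

lemma extremal_integral_box:
  fixes Z :: "'i \<Rightarrow> 'w \<Rightarrow> real" and g :: "'i \<Rightarrow> 's \<Rightarrow> real"
  assumes Pr: "prob_space Pr" "frechet_sup_measure Pr \<alpha> \<mu> M" "0 < \<alpha>"
    and K: "positive_weights K"
    and ext: "\<And>i a. (i, a) \<in> K \<Longrightarrow> has_extremal_integral Pr \<alpha> \<mu> M (g i) (Z i)"
  shows "measure Pr (box_event Pr Z K) = exp (- exponent \<alpha> \<mu> g K)"
proof -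
  interpret prob_space Pr by fact
  have fin: "finite K" using K by (rule positive_weights_finite)
  have "\<forall>i\<in>fst ` K. \<exists>h. (\<forall>k. simple_function \<mu> (h k) \<and> h k \<in> L_plus \<alpha> \<mu>) \<and>
        (\<lambda>k. rho \<mu> \<alpha> (h k) (g i)) \<longlonglongrightarrow> 0 \<and>
        (\<forall>\<epsilon>>0. (\<lambda>k. prob {\<omega> \<in> space Pr.
            \<epsilon> < \<bar>enn2real (simple_extremal_integral M \<mu> (h k) \<omega>) - Z i \<omega>\<bar>}) \<longlonglongrightarrow> 0)"
    using ext unfolding has_extremal_integral_def by auto
  from bchoice[OF this] obtain h where h': "\<forall>i\<in>fst ` K. (\<forall>k. simple_function \<mu> (h i k) \<and> h i k \<in> L_plus \<alpha> \<mu>) \<and>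
        (\<lambda>k. rho \<mu> \<alpha> (h i k) (g i)) \<longlonglongrightarrow> 0 \<and>
        (\<forall>\<epsilon>>0. (\<lambda>k. prob {\<omega> \<in> space Pr.
            \<epsilon> < \<bar>enn2real (simple_extremal_integral M \<mu> (h i k) \<omega>) - Z i \<omega>\<bar>}) \<longlonglongrightarrow> 0)"
    by blast
  have mem: "i \<in> fst ` K" if "(i, a) \<in> K" for i a using that by force
  have h: "simple_function \<mu> (h i k)" "h i k \<in> L_plus \<alpha> \<mu>" "(\<lambda>k. rho \<mu> \<alpha> (h i k) (g i)) \<longlonglongrightarrow> 0"
    if "(i, a) \<in> K" for i a k
    using bspec[OF h' mem[OF that]] by blast+
  define U where "U k i \<omega> = enn2real (simple_extremal_integral M \<mu> (h i k) \<omega>)" for k i \<omega>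
  have U: "U k i \<in> borel_measurable Pr" if "(i, a) \<in> K" for i a k
    using simple_extremal_integral_measurable[OF Pr(2) h(1)[OF that, of k]]
    unfolding U_def[abs_def] by measurable
  have Z: "Z i \<in> borel_measurable Pr" if "(i, a) \<in> K" for i a
    using has_extremal_integralD(2)[OF ext[OF that]] .
  have g: "g i \<in> L_plus \<alpha> \<mu>" if "(i, a) \<in> K" for i a
    using has_extremal_integralD(1)[OF ext[OF that]] .
  have conv: "(\<lambda>k. prob {\<omega> \<in> space Pr. \<epsilon> < \<bar>U k i \<omega> - Z i \<omega>\<bar>}) \<longlonglongrightarrow> 0" if "(i, a) \<in> K" "0 < \<epsilon>" for i a \<epsilon>
    using bspec[OF h' mem[OF that(1)]] that(2) unfolding U_def by blast
  define E where "E = exponent \<alpha> \<mu> g K"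
  define En where "En k = exponent \<alpha> \<mu> (\<lambda>i. h i k) K" for k
  have En: "En \<longlonglongrightarrow> E"
    unfolding En_def[abs_def] E_def by (rule tendsto_integral_envelope[OF K g h(2,3)])
  let ?s = "\<lambda>r. (\<lambda>(i, a). (i, r * a)) ` K"
  have scale: "positive_weights (?s r)" if "0 < r" for r
    using that positive_weightsD[OF K] by (intro positive_weights_image[OF K]) auto
  have boxU: "prob (box_event Pr (U k) (?s r)) = exp (- (r powr \<alpha> * En k))" if r: "0 < r" for r k
  proof -
    have "prob (box_event Pr (U k) (?s r)) = exp (- exponent \<alpha> \<mu> (\<lambda>i. h i k) (?s r))"
      unfolding U_def using h by (intro simple_extremal_integral_box[OF Pr scale[OF r]]) auto
    also have "exponent \<alpha> \<mu> (\<lambda>i. h i k) (?s r) = (\<integral>s. r powr \<alpha> * envelope \<alpha> (\<lambda>i. h i k) K s \<partial>\<mu>)"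
      using K r L_plusD(2)[OF h(2)] by (intro Bochner_Integration.integral_cong refl envelope_scale) auto
    finally show ?thesis by (simp add: En_def)
  qed
  let ?P = "prob (box_event Pr Z K)"
  let ?err = "\<lambda>r k. \<Sum>p\<in>K. prob {\<omega> \<in> space Pr. (1 / r - 1) / snd p < \<bar>U k (fst p) \<omega> - Z (fst p) \<omega>\<bar>}"
  have err: "?err r \<longlonglongrightarrow> 0" if r: "0 < r" "r < 1" for r
  proof -
    have "?err r \<longlonglongrightarrow> (\<Sum>p\<in>K. 0)"
    proof (intro tendsto_sum)
      fix p assume p: "p \<in> K"
      then have "0 < snd p" using positive_weightsD[OF K, of "fst p" "snd p"] by simp
      then show "(\<lambda>k. prob {\<omega> \<in> space Pr. (1 / r - 1) / snd p < \<bar>U k (fst p) \<omega> - Z (fst p) \<omega>\<bar>}) \<longlonglongrightarrow> 0"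
        using p r by (intro conv[of _ "snd p"]) (auto simp: field_simps)
    qed
    then show ?thesis by simp
  qed
  have upper: "?P \<le> exp (- (r powr \<alpha> * E))" if r: "0 < r" "r < 1" for r
  proof (rule LIMSEQ_le_const)
    have "(\<lambda>k. exp (- (r powr \<alpha> * En k)) + ?err r k) \<longlonglongrightarrow> exp (- (r powr \<alpha> * E)) + 0"
      by (intro tendsto_add err r tendsto_exp tendsto_minus tendsto_mult tendsto_const En)
    then show "(\<lambda>k. exp (- (r powr \<alpha> * En k)) + ?err r k) \<longlonglongrightarrow> exp (- (r powr \<alpha> * E))" by simp
    have "?P \<le> prob (box_event Pr (U k) (?s r)) + ?err r k" for k
      by (rule box_event_perturb[OF Pr(1) K Z U r])
    then show "\<exists>N. \<forall>k\<ge>N. ?P \<le> exp (- (r powr \<alpha> * En k)) + ?err r k"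
      unfolding boxU[OF r(1)] by blast
  qed
  have lower: "exp (- ((1 / r) powr \<alpha> * E)) \<le> ?P" if r: "0 < r" "r < 1" for r
  proof (rule LIMSEQ_le)
    show "(\<lambda>k. exp (- ((1 / r) powr \<alpha> * En k))) \<longlonglongrightarrow> exp (- ((1 / r) powr \<alpha> * E))"
      by (intro tendsto_exp tendsto_minus tendsto_mult tendsto_const En)
    let ?err' = "\<lambda>k. \<Sum>p\<in>?s (1 / r). prob {\<omega> \<in> space Pr. (1 / r - 1) / snd p < \<bar>Z (fst p) \<omega> - U k (fst p) \<omega>\<bar>}"
    have "?err' \<longlonglongrightarrow> (\<Sum>p\<in>?s (1 / r). 0)"
    proof (intro tendsto_sum)
      fix p assume p: "p \<in> ?s (1 / r)"
      then obtain a where "(fst p, a) \<in> K" by auto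
      moreover have "0 < snd p" using p r positive_weightsD[OF K] by auto
      ultimately have "(\<lambda>k. prob {\<omega> \<in> space Pr. (1 / r - 1) / snd p < \<bar>U k (fst p) \<omega> - Z (fst p) \<omega>\<bar>}) \<longlonglongrightarrow> 0"
        using r by (intro conv) (auto simp: field_simps)
      then show "(\<lambda>k. prob {\<omega> \<in> space Pr. (1 / r - 1) / snd p < \<bar>Z (fst p) \<omega> - U k (fst p) \<omega>\<bar>}) \<longlonglongrightarrow> 0"
        by (simp add: abs_minus_commute)
    qed
    then have "(\<lambda>k. ?P + ?err' k) \<longlonglongrightarrow> ?P + 0" by (intro tendsto_add tendsto_const) simp
    then show "(\<lambda>k. ?P + ?err' k) \<longlonglongrightarrow> ?P" by simp
    have "exp (- ((1 / r) powr \<alpha> * En k)) \<le> ?P + ?err' k" for k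
    proof -
      have mem': "\<exists>a. (i, a) \<in> K" if "(i, b) \<in> ?s (1 / r)" for i b using that by auto
      have "prob (box_event Pr (U k) (?s (1 / r))) \<le> prob (box_event Pr Z ((\<lambda>(i, a). (i, r * a)) ` ?s (1 / r))) + ?err' k"
        using r U Z mem' by (intro box_event_perturb[OF Pr(1) scale]) auto
      also have "(\<lambda>(i, a). (i, r * a)) ` ?s (1 / r) = K"
        using r by (force simp: image_iff)
      finally show ?thesis using boxU[of "1 / r"] r by simp
    qed
    then show "\<exists>N. \<forall>k\<ge>N. exp (- ((1 / r) powr \<alpha> * En k)) \<le> ?P + ?err' k" by blast
  qed
  have at1: "((\<lambda>r. exp (- (c r powr \<alpha> * E))) \<longlongrightarrow> exp (- (1 powr \<alpha> * E))) (at_left 1)"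
    if "(c \<longlongrightarrow> 1) (at_left 1)" for c :: "real \<Rightarrow> real"
    using that by (intro tendsto_exp tendsto_minus tendsto_mult tendsto_const tendsto_powr) auto
  have ev: "\<forall>\<^sub>F r in at_left (1::real). 0 < r \<and> r < 1"
    by (rule eventually_at_leftI[of 0]) auto
  have "((\<lambda>r. exp (- (r powr \<alpha> * E))) \<longlongrightarrow> exp (- (1 powr \<alpha> * E))) (at_left 1)"
    by (rule at1) (rule tendsto_ident_at)
  then have "?P \<le> exp (- (1 powr \<alpha> * E))"
  proof (rule tendsto_lowerbound)
    show "\<forall>\<^sub>F r in at_left 1. ?P \<le> exp (- (r powr \<alpha> * E))"
      by (rule eventually_mono[OF ev]) (elim conjE, rule upper)
  qed simp
  moreover have "((\<lambda>r::real. 1 / r) \<longlongrightarrow> 1 / 1) (at_left 1)"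
    by (rule tendsto_divide[OF tendsto_const tendsto_ident_at]) simp
  then have "((\<lambda>r. exp (- ((1 / r) powr \<alpha> * E))) \<longlongrightarrow> exp (- (1 powr \<alpha> * E))) (at_left 1)"
    by (intro at1) simp
  then have "exp (- (1 powr \<alpha> * E)) \<le> ?P"
  proof (rule tendsto_upperbound)
    show "\<forall>\<^sub>F r in at_left 1. exp (- ((1 / r) powr \<alpha> * E)) \<le> ?P"
      by (rule eventually_mono[OF ev]) (elim conjE, rule lower)
  qed simp
  ultimately show ?thesis by (simp add: E_def)
qed

text \<open>A limit in probability of non-negative variables.\<close>

lemma extremal_integral_nonneg:
  assumes Pr: "prob_space Pr" and sup: "frechet_sup_measure Pr \<alpha> \<mu> M"
    and ext: "has_extremal_integral Pr \<alpha> \<mu> M g Z"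
  shows "AE \<omega> in Pr. 0 \<le> Z \<omega>"
proof -
  interpret prob_space Pr by fact
  obtain h where simple: "\<And>k. simple_function \<mu> (h k)"
    and h: "\<And>\<epsilon>. 0 < \<epsilon> \<Longrightarrow> (\<lambda>k. prob {\<omega> \<in> space Pr.
            \<epsilon> < \<bar>enn2real (simple_extremal_integral M \<mu> (h k) \<omega>) - Z \<omega>\<bar>}) \<longlonglongrightarrow> 0"
    using ext unfolding has_extremal_integral_def by blast
  have [measurable]: "Z \<in> borel_measurable Pr" using has_extremal_integralD[OF ext] by auto
  have "AE \<omega> in Pr. \<not> Z \<omega> < - \<epsilon>" if \<epsilon>: "0 < \<epsilon>" for \<epsilon>
  proof -
    let ?N = "{\<omega> \<in> space Pr. Z \<omega> < - \<epsilon>}"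
    have "prob ?N \<le> 0"
    proof (rule LIMSEQ_le_const[OF h[OF \<epsilon>]], intro exI allI impI finite_measure_mono)
      fix k
      have [measurable]: "simple_extremal_integral M \<mu> (h k) \<in> borel_measurable Pr"
        by (rule simple_extremal_integral_measurable[OF sup simple])
      show "{\<omega> \<in> space Pr. \<epsilon> < \<bar>enn2real (simple_extremal_integral M \<mu> (h k) \<omega>) - Z \<omega>\<bar>} \<in> events"
        by measurable
      show "?N \<subseteq> {\<omega> \<in> space Pr. \<epsilon> < \<bar>enn2real (simple_extremal_integral M \<mu> (h k) \<omega>) - Z \<omega>\<bar>}"
      proof clarify
        fix \<omega> assume "Z \<omega> < - \<epsilon>"
        moreover have "0 \<le> enn2real (simple_extremal_integral M \<mu> (h k) \<omega>)" by simp
        ultimately show "\<epsilon> < \<bar>enn2real (simple_extremal_integral M \<mu> (h k) \<omega>) - Z \<omega>\<bar>" by linarith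
      qed
    qed
    then have "prob ?N = 0" by (simp add: measure_le_0_iff)
    then have "?N \<in> null_sets Pr" by (intro null_setsI) (simp_all add: emeasure_eq_measure)
    from AE_not_in[OF this] AE_space[of Pr] show ?thesis by eventually_elim simp
  qed
  then have "AE \<omega> in Pr. \<forall>k. \<not> Z \<omega> < - (1 / real (Suc k))" by (simp add: AE_all_countable)
  then show ?thesis
  proof eventually_elim
    case (elim \<omega>)
    show ?case
    proof (rule ccontr)
      assume "\<not> 0 \<le> Z \<omega>"
      then obtain k where "1 / real (Suc k) < - Z \<omega>" using nat_approx_posE[of "- Z \<omega>"] by auto
      with spec[OF elim, of k] show False by linarith
    qed
  qed
qed

section \<open>Images of standard Borel sets\<close>

lemma borel_measurable_coordinate: "(\<lambda>w :: 'i \<Rightarrow> real. w i) \<in> borel_measurable borel"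
  by (intro borel_measurable_continuous_onI continuous_on_product_coordinates)

text \<open>Take \<open>e\<close> to be the sequence of distances to a dense sequence \<open>q\<close> in a complete metric.  A sequence \<open>w\<close>
  is of this form exactly if it satisfies the triangle inequalities with the numbers \<open>d(q\<^sub>i, q\<^sub>j)\<close> and has
  infimum \<open>0\<close>: indices with small \<open>w\<^sub>i\<close> then give a Cauchy sequence, and its limit is the required point.
  These are countably many closed and open conditions, so the range is Borel, and images of the balls
  around the \<open>q\<^sub>i\<close> are cut out of it by inequalities on one coordinate.\<close>

lemma standard_borel_embedding:
  assumes "standard_borel M"
  obtains e :: "'a \<Rightarrow> nat \<Rightarrow> real"
  where "inj_on e (space M)"
    "\<And>A. A \<in> sets M \<Longrightarrow> e ` A \<in> sets borel"
    "sets M = sigma_sets (space M) (range (\<lambda>(i, q). {s \<in> space M. e s i < real_of_rat q}))"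
proof (cases "space M = {}")
  case True
  then have "sets M = {{}}" using sets.space_closed[of M] sets.top[of M] by auto
  moreover have "sigma_sets {} (range (\<lambda>(i::nat, q). {s \<in> {} :: 'a set. (0::real) < real_of_rat q})) = {{}}"
    using sigma_sets_into_sp[of "range (\<lambda>(i::nat, q). {s \<in> {} :: 'a set. (0::real) < real_of_rat q})" "{}"]
    by (auto intro: sigma_sets.Empty)
  ultimately show ?thesis using True by (intro that[of "\<lambda>_ _. 0"]) auto
next
  case False
  obtain X where X: "completely_metrizable_space X" "separable_space X" "topspace X = space M"
    "sets M = sigma_sets (space M) {U. openin X U}"
    using assms by (auto simp: standard_borel_def)
  obtain Y d where Y: "Metric_space Y d" "Metric_space.mcomplete Y d" "X = Metric_space.mtopology Y d"
    using X(1) by (auto simp: completely_metrizable_space_def)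
  interpret Metric_space Y d by fact
  have YM: "Y = space M" using X(3) Y(3) by simp
  obtain C where C: "countable C" "C \<subseteq> Y" "mtopology closure_of C = Y"
    using X(2,3) Y(3) by (auto simp: separable_space_def)
  have "C \<noteq> {}" using C(3) False YM by auto
  define q where "q = from_nat_into C"
  have q: "q i \<in> Y" for i using C(2) \<open>C \<noteq> {}\<close> by (auto simp: q_def from_nat_into subsetD)
  have dense: "\<exists>i. d x (q i) < r" if "x \<in> Y" "0 < r" for x r
  proof -
    have "x \<in> mtopology closure_of C" using that C(3) by simp
    then have "\<exists>y\<in>C. y \<in> mball x r" using that(2) unfolding metric_closure_of by blast
    then obtain y where "y \<in> C" "y \<in> mball x r" by blast
    then show ?thesis using from_nat_into_surj[OF C(1)] by (auto simp: q_def in_mball)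
  qed
  define e where "e x i = d x (q i)" for x i
  let ?ball = "\<lambda>(i, r). {s \<in> space M. e s i < real_of_rat r}"
  have ball: "?ball (i, r) = mball (q i) (real_of_rat r)" for i r
    using q by (auto simp: e_def in_mball commute simp flip: YM)
  have opn: "openin X U \<Longrightarrow> U \<in> sigma_sets (space M) (range ?ball)" for U
  proof -
    assume U: "openin X U"
    have "U = \<Union>{B \<in> range ?ball. B \<subseteq> U}"
    proof
      show "U \<subseteq> \<Union>{B \<in> range ?ball. B \<subseteq> U}"
      proof
        fix x assume x: "x \<in> U"
        have "U \<subseteq> Y" "\<exists>r>0. mball x r \<subseteq> U"
          using U x unfolding Y(3) openin_mtopology by blast+
        then obtain r where r: "0 < r" "mball x r \<subseteq> U" and "x \<in> Y" using x by blast
        obtain t where t: "0 < real_of_rat t" "real_of_rat t < r / 2"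
          using of_rat_dense[of 0 "r / 2"] r by auto
        obtain i where i: "d x (q i) < real_of_rat t" using dense[OF \<open>x \<in> Y\<close> t(1)] by auto
        have "mball (q i) (real_of_rat t) \<subseteq> mball x r"
        proof
          fix y assume y: "y \<in> mball (q i) (real_of_rat t)"
          then have "d x y \<le> d x (q i) + d (q i) y" using triangle[OF \<open>x \<in> Y\<close> q] by (auto simp: in_mball)
          also have "\<dots> < r" using i y t by (auto simp: in_mball)
          finally show "y \<in> mball x r" using y \<open>x \<in> Y\<close> by (auto simp: in_mball)
        qed
        moreover have "x \<in> mball (q i) (real_of_rat t)"
          using i \<open>x \<in> Y\<close> q by (auto simp: in_mball commute)
        ultimately have "?ball (i, t) \<subseteq> U" "x \<in> ?ball (i, t)"
          using r(2) unfolding ball by blast+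
        then show "x \<in> \<Union>{B \<in> range ?ball. B \<subseteq> U}" by blast
      qed
    qed auto
    also have "\<dots> \<in> sigma_sets (space M) (range ?ball)"
      by (rule sigma_sets_UNION) (auto intro: countable_subset[of _ "range ?ball"] sigma_sets.Basic)
    finally show ?thesis .
  qed
  have gen: "sets M = sigma_sets (space M) (range ?ball)"
  proof
    show "sets M \<subseteq> sigma_sets (space M) (range ?ball)"
      unfolding X(4) using opn by (intro sigma_sets_mono) auto
    have "range ?ball \<subseteq> {U. openin X U}"
    proof
      fix B assume "B \<in> range ?ball"
      then obtain i r where "B = ?ball (i, r)" by auto
      then show "B \<in> {U. openin X U}" unfolding ball Y(3) by simp
    qed
    then show "sigma_sets (space M) (range ?ball) \<subseteq> sets M"
      unfolding X(4) by (intro sigma_sets_mono) (auto intro: sigma_sets.Basic)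
  qed
  have inj: "inj_on e (space M)"
  proof (rule inj_onI, rule ccontr)
    fix x y assume xy: "x \<in> space M" "y \<in> space M" "e x = e y" "x \<noteq> y"
    then have pos: "0 < d x y / 2" using YM by (simp add: order_le_neq_trans)
    obtain i where i: "d x (q i) < d x y / 2" using dense[OF _ pos, of x] xy YM by auto
    have "d x y \<le> d x (q i) + d y (q i)" using triangle[of x "q i" y] xy q YM by (simp add: commute)
    also have "d y (q i) = d x (q i)" using fun_cong[OF xy(3), of i] by (simp add: e_def)
    finally show False using i by simp
  qed
  note [measurable] = borel_measurable_coordinate
  have rng: "e ` space M = {w. (\<forall>i j. d (q i) (q j) \<le> w i + w j \<and> w j \<le> w i + d (q i) (q j)) \<and> (\<forall>k. \<exists>i. w i < 1 / Suc k)}"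
    (is "_ = ?E")
  proof
    show "e ` space M \<subseteq> ?E"
    proof (clarify, intro conjI allI)
      fix x i j assume x: "x \<in> space M"
      show "d (q i) (q j) \<le> e x i + e x j" "e x j \<le> e x i + d (q i) (q j)"
        using triangle[of "q i" x "q j"] triangle[of x "q i" "q j"] x q YM by (auto simp: e_def commute)
      show "\<exists>i. e x i < 1 / Suc k" for k
        using dense[of x "1 / Suc k"] x YM by (simp add: e_def)
    qed
    show "?E \<subseteq> e ` space M"
    proof
      fix w assume w: "w \<in> ?E"
      then have "\<forall>k. \<exists>i. w i < 1 / Suc k" by blast
      then obtain \<iota> where \<iota>: "\<And>k. w (\<iota> k) < 1 / Suc k" by metis
      have w1: "d (q i) (q j) \<le> w i + w j" and w2: "w j \<le> w i + d (q i) (q j)" for i j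
        using w by auto
      have small: "\<exists>N. \<forall>k\<ge>N. w (\<iota> k) < \<epsilon>" if \<epsilon>: "0 < \<epsilon>" for \<epsilon>
      proof -
        obtain N where N: "1 / real (Suc N) < \<epsilon>" by (rule nat_approx_posE[OF \<epsilon>])
        have "w (\<iota> k) < \<epsilon>" if "k \<ge> N" for k
        proof -
          have "1 / real (Suc k) \<le> 1 / real (Suc N)" using that by (simp add: frac_le)
          then show ?thesis using \<iota>[of k] N by linarith
        qed
        then show ?thesis by blast
      qed
      have "MCauchy (\<lambda>k. q (\<iota> k))"
        unfolding MCauchy_def
      proof (intro conjI allI impI)
        fix \<epsilon> :: real assume "0 < \<epsilon>"
        then obtain N where N: "\<And>k. k \<ge> N \<Longrightarrow> w (\<iota> k) < \<epsilon> / 2" using small[of "\<epsilon> / 2"] by auto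
        have "d (q (\<iota> n)) (q (\<iota> n')) < \<epsilon>" if "N \<le> n" "N \<le> n'" for n n'
          using N[OF that(1)] N[OF that(2)] w1[of "\<iota> n" "\<iota> n'"] by linarith
        then show "\<exists>N. \<forall>n n'. N \<le> n \<longrightarrow> N \<le> n' \<longrightarrow> d (q (\<iota> n)) (q (\<iota> n')) < \<epsilon>" by blast
      qed (use q in auto)
      then obtain x where x: "limitin mtopology (\<lambda>k. q (\<iota> k)) x sequentially"
        using Y(2) by (auto simp: mcomplete_def)
      then have xY: "x \<in> Y" by (simp add: limit_metric_sequentially)
      have "e x j = w j" for j
      proof (rule ccontr)
        assume ne: "e x j \<noteq> w j"
        define \<epsilon> where "\<epsilon> = \<bar>e x j - w j\<bar> / 2"
        have \<epsilon>: "0 < \<epsilon>" using ne by (simp add: \<epsilon>_def)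
        obtain N where N: "\<And>k. k \<ge> N \<Longrightarrow> d (q (\<iota> k)) x < \<epsilon>"
          using x \<epsilon> unfolding limit_metric_sequentially by blast
        obtain N' where N': "\<And>k. k \<ge> N' \<Longrightarrow> w (\<iota> k) < \<epsilon>" using small[OF \<epsilon>] by auto
        define k where "k = max N N'"
        have "d (q (\<iota> k)) x < \<epsilon>" "w (\<iota> k) < \<epsilon>" using N[of k] N'[of k] by (auto simp: k_def)
        moreover have "e x j \<le> d (q (\<iota> k)) x + d (q (\<iota> k)) (q j)" "d (q (\<iota> k)) (q j) \<le> d (q (\<iota> k)) x + e x j"
          using triangle[of x "q (\<iota> k)" "q j"] triangle[of "q (\<iota> k)" x "q j"] xY q by (auto simp: e_def commute)
        ultimately have "\<bar>e x j - w j\<bar> < 2 * \<epsilon>" using w1[of "\<iota> k" j] w2[of j "\<iota> k"] by linarith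
        then show False by (simp add: \<epsilon>_def)
      qed
      then have "e x = w" by auto
      with xY YM show "w \<in> e ` space M" by auto
    qed
  qed
  have "?E \<in> sets borel"
  proof -
    have [measurable]: "Measurable.pred borel (\<lambda>w :: nat \<Rightarrow> real. c \<le> w i + w j)"
      "Measurable.pred borel (\<lambda>w :: nat \<Rightarrow> real. w j \<le> w i + c)"
      "Measurable.pred borel (\<lambda>w :: nat \<Rightarrow> real. w i < c)" for i j c
      unfolding pred_def
      by (intro borel_measurable_le borel_measurable_less borel_measurable_add borel_measurable_const
          borel_measurable_coordinate)+
    have "{w \<in> space borel. (\<forall>i j. d (q i) (q j) \<le> w i + w j \<and> w j \<le> w i + d (q i) (q j)) \<and> (\<forall>k. \<exists>i. w i < 1 / Suc k)} \<in> sets borel"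
      by measurable
    then show ?thesis by simp
  qed
  with rng have E: "e ` space M \<in> sets borel" by simp
  have img: "e ` A \<in> sets borel" if "A \<in> sets M" for A
    using that unfolding gen
  proof (induction rule: sigma_sets.induct)
    case (Basic A)
    then obtain i r where A: "A = {s \<in> space M. e s i < real_of_rat r}" by auto
    have "{w \<in> space borel. w i < real_of_rat r} \<in> sets borel" by measurable
    then have "e ` space M \<inter> {w \<in> space borel. w i < real_of_rat r} \<in> sets borel" using E by blast
    also have "e ` space M \<inter> {w \<in> space borel. w i < real_of_rat r} = e ` A" by (auto simp: A)
    finally show ?case .
  next
    case (Compl A)
    have "A \<subseteq> space M" using Compl(1) sets.sets_into_space[of A M] unfolding gen by simp
    then have "e ` (space M - A) = e ` space M - e ` A" using inj by (auto simp: inj_on_def subset_iff)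
    then show ?case using Compl E by auto
  next
    case (Union A)
    then show ?case by (simp add: image_UN)
  qed simp
  show ?thesis by (rule that[OF inj img gen])
qed

text \<open>Embed the graph of \<open>R\<close> over \<open>A\<close> into a countable power of the line.  There it is Borel, because \<open>R\<close> can
  be expressed by the images of its rational sublevel sets, and \<open>R\<close> has become a continuous projection.  By
  inner regularity the graph contains compact sets of almost full measure; the union of their
  projections is the required set.\<close>

lemma standard_borel_image_contains_full_borel_set:
  assumes "standard_borel \<mu>" "finite_measure \<mu>"
    and R: "\<And>i. (\<lambda>s. R s i) \<in> borel_measurable \<mu>" and A: "A \<in> sets \<mu>"
  obtains C :: "(nat \<Rightarrow> real) set"
  where "C \<in> sets borel" "C \<subseteq> R ` A" "AE s in \<mu>. s \<in> A \<longrightarrow> R s \<in> C"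
proof -
  interpret finite_measure \<mu> by fact
  obtain e :: "_ \<Rightarrow> nat \<Rightarrow> real" where e: "inj_on e (space \<mu>)" "\<And>A. A \<in> sets \<mu> \<Longrightarrow> e ` A \<in> sets borel"
    "sets \<mu> = sigma_sets (space \<mu>) (range (\<lambda>(i, q). {s \<in> space \<mu>. e s i < real_of_rat q}))"
    using standard_borel_embedding[OF assms(1)] by blast
  have e_meas: "(\<lambda>s. e s i) \<in> borel_measurable \<mu>" for i
  proof (rule borel_measurableI_less)
    fix y :: real
    have "{s \<in> space \<mu>. e s i < y} = (\<Union>q\<in>{q. real_of_rat q < y}. {s \<in> space \<mu>. e s i < real_of_rat q})"
      using of_rat_dense by fastforce
    also have "\<dots> \<in> sets \<mu>"
      by (intro sets.countable_UN') (auto simp: e(3) intro!: sigma_sets.Basic)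
    finally show "{s \<in> space \<mu>. e s i < y} \<in> sets \<mu>" .
  qed
  note [measurable] = borel_measurable_coordinate R e_meas
  define G where "G s = (\<lambda>k. case k of Inl i \<Rightarrow> e s i | Inr i \<Rightarrow> R s i)" for s and k :: "nat + nat"
  have G_meas: "G \<in> measurable \<mu> borel"
  proof -
    have "(\<lambda>s k. G s k) \<in> measurable \<mu> (\<Pi>\<^sub>M k\<in>UNIV. borel)"
    proof (rule measurable_PiM_single')
      fix k show "(\<lambda>s. G s k) \<in> borel_measurable \<mu>" by (cases k) (simp_all add: G_def)
    qed (auto simp: PiE_def)
    then show ?thesis by (simp add: measurable_cong_sets[OF refl sets_PiM_equal_borel])
  qed
  let ?\<pi> = "\<lambda>w :: nat + nat \<Rightarrow> real. (\<lambda>i. w (Inr i))" and ?\<pi>e = "\<lambda>w :: nat + nat \<Rightarrow> real. (\<lambda>i. w (Inl i))"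
  have \<pi>_cont: "continuous_on UNIV ?\<pi>" "continuous_on UNIV ?\<pi>e"
    by (rule continuous_on_coordinatewise_then_product, rule continuous_on_product_coordinates)+
  have \<pi>e_meas [measurable]: "?\<pi>e \<in> measurable borel borel"
    by (intro borel_measurable_continuous_onI \<pi>_cont)
  let ?L = "\<lambda>i q. {s \<in> space \<mu>. R s i < real_of_rat q}"
  \<comment> \<open>A real number is determined by the rationals above it.\<close>
  have GA: "G ` A = {w. ?\<pi>e w \<in> e ` A \<and> (\<forall>i q. w (Inr i) < real_of_rat q \<longleftrightarrow> ?\<pi>e w \<in> e ` ?L i q)}" (is "_ = ?GA")
  proof
    show "G ` A \<subseteq> ?GA"
    proof clarify
      fix s assume s: "s \<in> A"
      then have sp: "s \<in> space \<mu>" using sets.sets_into_space[OF A] by auto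
      have 1: "?\<pi>e (G s) = e s" by (simp add: G_def)
      have "e s \<in> e ` ?L i q \<longleftrightarrow> s \<in> ?L i q" for i q
        by (rule inj_on_image_mem_iff[OF e(1) sp]) auto
      then show "?\<pi>e (G s) \<in> e ` A \<and> (\<forall>i q. G s (Inr i) < real_of_rat q \<longleftrightarrow> ?\<pi>e (G s) \<in> e ` ?L i q)"
        using s sp unfolding 1 by (simp add: G_def)
    qed
    show "?GA \<subseteq> G ` A"
    proof
      fix w assume w: "w \<in> ?GA"
      then obtain s where s: "s \<in> A" "?\<pi>e w = e s" by auto
      then have sp: "s \<in> space \<mu>" using sets.sets_into_space[OF A] by auto
      have "w (Inr i) = R s i" for i
      proof -
        have "w (Inr i) < real_of_rat q \<longleftrightarrow> R s i < real_of_rat q" for q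
        proof -
          have "w (Inr i) < real_of_rat q \<longleftrightarrow> e s \<in> e ` ?L i q" using w s(2) by simp
          also have "\<dots> \<longleftrightarrow> s \<in> ?L i q" by (rule inj_on_image_mem_iff[OF e(1) sp]) auto
          finally show ?thesis using sp by simp
        qed
        then show ?thesis
          using of_rat_dense[of "w (Inr i)" "R s i"] of_rat_dense[of "R s i" "w (Inr i)"]
          by (metis less_asym' linorder_less_linear)
      qed
      then have "w = G s" using fun_cong[OF s(2)] by (auto simp: G_def fun_eq_iff split: sum.split)
      with s show "w \<in> G ` A" by blast
    qed
  qed
  have "?GA \<in> sets borel"
  proof -
    have [measurable]: "e ` A \<in> sets borel" "e ` ?L i q \<in> sets borel" for i q
      using A by (auto intro!: e(2))
    have "{w \<in> space borel. ?\<pi>e w \<in> e ` A \<and> (\<forall>i q. w (Inr i) < real_of_rat q \<longleftrightarrow> ?\<pi>e w \<in> e ` ?L i q)} \<in> sets borel"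
      by measurable
    then show ?thesis by simp
  qed
  with GA have GA_borel: "G ` A \<in> sets borel" by simp
  let ?\<nu> = "distr \<mu> borel G"
  interpret \<nu>: finite_measure ?\<nu> by (rule finite_measure_distr[OF G_meas])
  have inner: "emeasure ?\<nu> (G ` A) = (SUP K\<in>{K. K \<subseteq> G ` A \<and> compact K}. emeasure ?\<nu> K)"
    using GA_borel by (intro inner_regular) (auto simp: \<nu>.emeasure_eq_measure)
  have "\<exists>K. K \<subseteq> G ` A \<and> compact K \<and> measure ?\<nu> (G ` A) < measure ?\<nu> K + 1 / Suc n" for n
  proof (rule ccontr)
    assume not: "\<not> ?thesis"
    have "emeasure ?\<nu> K \<le> ennreal (measure ?\<nu> (G ` A) - 1 / Suc n)" if "K \<subseteq> G ` A" "compact K" for K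
    proof -
      have "measure ?\<nu> (G ` A) \<ge> measure ?\<nu> K + 1 / Suc n" using not that by force
      then show ?thesis by (simp add: \<nu>.emeasure_eq_measure ennreal_leI)
    qed
    then have "emeasure ?\<nu> (G ` A) \<le> ennreal (measure ?\<nu> (G ` A) - 1 / Suc n)"
      unfolding inner by (intro SUP_least) auto
    moreover have "measure ?\<nu> (G ` A) \<ge> measure ?\<nu> {} + 1 / Suc n" using not by force
    ultimately show False
      by (simp add: \<nu>.emeasure_eq_measure)
  qed
  then obtain K where K: "\<And>n. K n \<subseteq> G ` A" "\<And>n. compact (K n)"
    "\<And>n. measure ?\<nu> (G ` A) < measure ?\<nu> (K n) + 1 / Suc n" by metis
  have K_borel: "K n \<in> sets borel" for n using K(2) by (simp add: compact_imp_closed)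
  define C where "C = (\<Union>n. ?\<pi> ` K n)"
  show thesis
  proof
    show "C \<in> sets borel"
      unfolding C_def
      using K(2) compact_continuous_image[OF continuous_on_subset[OF \<pi>_cont(1) subset_UNIV]] by (intro sets.countable_UN) (auto intro!: borel_closed compact_imp_closed)
    show "C \<subseteq> R ` A"
      using K(1) by (fastforce simp: C_def G_def)
    let ?N = "G ` A - (\<Union>n. K n)"
    have "measure ?\<nu> ?N \<le> 1 / Suc n" for n
    proof -
      have "measure ?\<nu> ?N \<le> measure ?\<nu> (G ` A - K n)"
        using GA_borel K_borel by (intro \<nu>.finite_measure_mono) auto
      also have "\<dots> = measure ?\<nu> (G ` A) - measure ?\<nu> (K n)"
        using GA_borel K_borel K(1) by (intro \<nu>.finite_measure_Diff) auto
      finally show ?thesis using K(3)[of n] by linarith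
    qed
    then have "measure ?\<nu> ?N \<le> 0"
      using LIMSEQ_le_const[OF LIMSEQ_inverse_real_of_nat] by (auto simp: inverse_eq_divide)
    then have "?N \<in> null_sets ?\<nu>"
      using GA_borel K_borel by (intro null_setsI) (auto simp: \<nu>.emeasure_eq_measure measure_le_0_iff)
    from AE_not_in[OF this] have "AE s in \<mu>. G s \<notin> ?N"
      by (subst (asm) AE_distr_iff[OF G_meas]) (use GA_borel K_borel in auto)
    then show "AE s in \<mu>. s \<in> A \<longrightarrow> R s \<in> C"
    proof eventually_elim
      case (elim s)
      show ?case
      proof
        assume "s \<in> A"
        with elim obtain n where "G s \<in> K n" by auto
        then have "?\<pi> (G s) \<in> C" by (auto simp: C_def)
        then show "R s \<in> C" by (simp add: G_def)
      qed
    qed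
  qed
qed

section \<open>Separability of L1\<close>

text \<open>Rational step functions over finite intersections of the sets \<open>b i\<close>.  The lists that describe them
  form a countable type, and concatenation of lists is addition of functions.\<close>

definition step_function :: "(nat \<Rightarrow> 'a set) \<Rightarrow> (rat \<times> nat list) list \<Rightarrow> 'a \<Rightarrow> real" where
  "step_function b xs s = (\<Sum>(q, l)\<leftarrow>xs. of_rat q * (if \<forall>i\<in>set l. s \<in> b i then 1 else 0))"

lemma step_function_simps [simp]:
  "step_function b [] s = 0"
  "step_function b ((q, l) # xs) s = of_rat q * (if \<forall>i\<in>set l. s \<in> b i then 1 else 0) + step_function b xs s"
  "step_function b (xs @ ys) s = step_function b xs s + step_function b ys s"
  by (simp_all add: step_function_def)

lemma step_function_scale:
  "step_function b (map (\<lambda>(p, l). (q * p, l)) xs) s = of_rat q * step_function b xs s"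
  by (induction xs) (auto simp: of_rat_mult algebra_simps)

lemma integrable_step_function:
  assumes "finite_measure M" "range b \<subseteq> sets M"
  shows "integrable M (step_function b xs)"
proof (induction xs)
  case (Cons x xs)
  interpret finite_measure M by fact
  obtain q l where x: "x = (q, l)" by (cases x)
  have [measurable]: "b i \<in> sets M" for i using assms(2) by auto
  have "integrable M (\<lambda>s. if \<forall>i\<in>set l. s \<in> b i then 1 else 0 :: real)"
    by (rule integrable_const_bound[of _ 1]) auto
  then show ?case using Cons unfolding x step_function_simps by (intro Bochner_Integration.integrable_add) auto
qed (simp add: step_function_def[abs_def])

definition approximable :: "'a measure \<Rightarrow> (nat \<Rightarrow> 'a set) \<Rightarrow> ('a \<Rightarrow> real) \<Rightarrow> bool" where
  "approximable M b f \<longleftrightarrow> integrable M f \<and> (\<forall>\<epsilon>>0. \<exists>xs. (\<integral>s. \<bar>f s - step_function b xs s\<bar> \<partial>M) < \<epsilon>)"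

context
  fixes M :: "'a measure" and b :: "nat \<Rightarrow> 'a set"
  assumes fin: "finite_measure M" and gen: "sets M = sigma_sets (space M) (range b)" and sub: "range b \<subseteq> Pow (space M)"
begin

interpretation finite_measure M by (rule fin)

lemma range_b: "range b \<subseteq> sets M"
  unfolding gen by (auto intro: sigma_sets.Basic)

lemma approximable_close:
  assumes f: "integrable M f"
    and *: "\<And>\<epsilon>. 0 < \<epsilon> \<Longrightarrow> \<exists>g. approximable M b g \<and> (\<integral>s. \<bar>f s - g s\<bar> \<partial>M) < \<epsilon>"
  shows "approximable M b f"
  unfolding approximable_def
proof (intro conjI allI impI f)
  fix \<epsilon> :: real assume \<epsilon>: "0 < \<epsilon>"
  then obtain g where g: "approximable M b g" "(\<integral>s. \<bar>f s - g s\<bar> \<partial>M) < \<epsilon> / 2" using *[of "\<epsilon> / 2"] by auto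
  then obtain xs where xs: "(\<integral>s. \<bar>g s - step_function b xs s\<bar> \<partial>M) < \<epsilon> / 2"
    using \<epsilon> unfolding approximable_def by (meson half_gt_zero)
  have gi: "integrable M g" using g by (simp add: approximable_def)
  note si = integrable_step_function[OF fin range_b, of xs]
  have "(\<integral>s. \<bar>f s - step_function b xs s\<bar> \<partial>M) \<le> (\<integral>s. \<bar>f s - g s\<bar> + \<bar>g s - step_function b xs s\<bar> \<partial>M)"
    using f gi si by (intro integral_mono) auto
  also have "\<dots> = (\<integral>s. \<bar>f s - g s\<bar> \<partial>M) + (\<integral>s. \<bar>g s - step_function b xs s\<bar> \<partial>M)"
    using f gi si by (intro Bochner_Integration.integral_add) auto
  finally show "\<exists>xs. (\<integral>s. \<bar>f s - step_function b xs s\<bar> \<partial>M) < \<epsilon>" using g xs by (intro exI[of _ xs]) linarith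
qed

lemma approximable_add:
  assumes "approximable M b f" "approximable M b g"
  shows "approximable M b (\<lambda>s. f s + g s)"
  unfolding approximable_def
proof (intro conjI allI impI)
  have fi: "integrable M f" and gi: "integrable M g" using assms by (simp_all add: approximable_def)
  then show "integrable M (\<lambda>s. f s + g s)" by simp
  fix \<epsilon> :: real assume \<epsilon>: "0 < \<epsilon>"
  obtain xs where xs: "(\<integral>s. \<bar>f s - step_function b xs s\<bar> \<partial>M) < \<epsilon> / 2"
    using assms(1) \<epsilon> unfolding approximable_def by (meson half_gt_zero)
  obtain ys where ys: "(\<integral>s. \<bar>g s - step_function b ys s\<bar> \<partial>M) < \<epsilon> / 2"
    using assms(2) \<epsilon> unfolding approximable_def by (meson half_gt_zero)
  note si = integrable_step_function[OF fin range_b]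
  have "(\<integral>s. \<bar>f s + g s - step_function b (xs @ ys) s\<bar> \<partial>M)
      \<le> (\<integral>s. \<bar>f s - step_function b xs s\<bar> + \<bar>g s - step_function b ys s\<bar> \<partial>M)"
    using fi gi si[of xs] si[of ys] si[of "xs @ ys"] by (intro integral_mono) auto
  also have "\<dots> = (\<integral>s. \<bar>f s - step_function b xs s\<bar> \<partial>M) + (\<integral>s. \<bar>g s - step_function b ys s\<bar> \<partial>M)"
    using fi gi si by (intro Bochner_Integration.integral_add) auto
  finally show "\<exists>xs. (\<integral>s. \<bar>f s + g s - step_function b xs s\<bar> \<partial>M) < \<epsilon>"
    using xs ys by (intro exI[of _ "xs @ ys"]) linarith
qed

lemma approximable_scale:
  assumes "approximable M b f"
  shows "approximable M b (\<lambda>s. c * f s)"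
  unfolding approximable_def
proof (intro conjI allI impI)
  have fi: "integrable M f" using assms by (simp add: approximable_def)
  then show "integrable M (\<lambda>s. c * f s)" by simp
  fix \<epsilon> :: real assume \<epsilon>: "0 < \<epsilon>"
  define I where "I = (\<integral>s. \<bar>f s\<bar> \<partial>M)"
  have I: "0 \<le> I" by (simp add: I_def)
  \<comment> \<open>The error from rounding \<open>c\<close> to a rational is at most \<open>\<epsilon>/2\<close>, and so is that from approximating \<open>f\<close>.\<close>
  obtain q where q: "c < real_of_rat q" "real_of_rat q < c + \<epsilon> / (2 * (I + 1))"
    using of_rat_dense[of c "c + \<epsilon> / (2 * (I + 1))"] \<epsilon> I by auto
  define r where "r = real_of_rat q"
  note q = q[folded r_def]
  have "0 < \<epsilon> / (2 * (\<bar>r\<bar> + 1))" using \<epsilon> by simp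
  then obtain xs where xs: "(\<integral>s. \<bar>f s - step_function b xs s\<bar> \<partial>M) < \<epsilon> / (2 * (\<bar>r\<bar> + 1))"
    using assms unfolding approximable_def by meson
  let ?ys = "map (\<lambda>(p, l). (q * p, l)) xs"
  note si = integrable_step_function[OF fin range_b]
  have "(\<integral>s. \<bar>c * f s - step_function b ?ys s\<bar> \<partial>M)
      \<le> (\<integral>s. \<bar>c - r\<bar> * \<bar>f s\<bar> + \<bar>r\<bar> * \<bar>f s - step_function b xs s\<bar> \<partial>M)"
  proof (rule integral_mono)
    fix s
    have "c * f s - step_function b ?ys s = (c - r) * f s + r * (f s - step_function b xs s)"
      unfolding step_function_scale r_def[symmetric] by (simp add: algebra_simps)
    then show "\<bar>c * f s - step_function b ?ys s\<bar> \<le> \<bar>c - r\<bar> * \<bar>f s\<bar> + \<bar>r\<bar> * \<bar>f s - step_function b xs s\<bar>"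
      by (metis abs_mult abs_triangle_ineq)
  qed (use fi si in auto)
  also have "\<dots> = \<bar>c - r\<bar> * I + \<bar>r\<bar> * (\<integral>s. \<bar>f s - step_function b xs s\<bar> \<partial>M)"
    using fi si by (simp add: I_def)
  also have "\<dots> \<le> (\<epsilon> / (2 * (I + 1))) * (I + 1) + (\<bar>r\<bar> + 1) * (\<integral>s. \<bar>f s - step_function b xs s\<bar> \<partial>M)"
    using q I \<epsilon> by (intro add_mono mult_mono mult_right_mono) auto
  also have "\<dots> < (\<epsilon> / (2 * (I + 1))) * (I + 1) + (\<bar>r\<bar> + 1) * (\<epsilon> / (2 * (\<bar>r\<bar> + 1)))"
    using xs by (intro add_strict_left_mono mult_strict_left_mono) auto
  also have "\<dots> = \<epsilon> / 2 + \<epsilon> / 2"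
    using I by (intro arg_cong2[where f = "(+)"]) (auto simp: field_simps)
  finally show "\<exists>xs. (\<integral>s. \<bar>c * f s - step_function b xs s\<bar> \<partial>M) < \<epsilon>" by (intro exI[of _ ?ys]) simp
qed

lemma approximable_zero: "approximable M b (\<lambda>_. 0)"
  unfolding approximable_def by (auto intro!: exI[of _ "[]"])

lemma approximable_inter: "approximable M b (\<lambda>s. if \<forall>i\<in>set l. s \<in> b i then 1 else 0)"
  unfolding approximable_def
proof (intro conjI allI impI)
  show "integrable M (\<lambda>s. if \<forall>i\<in>set l. s \<in> b i then 1 else 0 :: real)"
    using integrable_step_function[OF fin range_b, of "[(1, l)]"] by (simp add: step_function_def[abs_def])
  fix \<epsilon> :: real assume "0 < \<epsilon>"
  then show "\<exists>xs. (\<integral>s. \<bar>(if \<forall>i\<in>set l. s \<in> b i then 1 else 0) - step_function b xs s\<bar> \<partial>M) < \<epsilon>"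
    by (intro exI[of _ "[(1, l)]"]) (simp add: step_function_def)
qed

lemma approximable_cong:
  assumes "approximable M b f" "\<And>s. s \<in> space M \<Longrightarrow> f s = g s"
  shows "approximable M b g"
proof -
  have "(\<integral>s. \<bar>g s - step_function b xs s\<bar> \<partial>M) = (\<integral>s. \<bar>f s - step_function b xs s\<bar> \<partial>M)" for xs
    using assms(2) by (intro Bochner_Integration.integral_cong) auto
  moreover have "integrable M g \<longleftrightarrow> integrable M f"
    using assms(2) by (intro Bochner_Integration.integrable_cong) auto
  ultimately show ?thesis using assms(1) by (simp add: approximable_def)
qed

text \<open>The sets with approximable indicator form a Dynkin system that contains the finite intersections of
  the generating sets.\<close>

lemma approximable_indicator:
  assumes "A \<in> sets M"
  shows "approximable M b (indicator A)"
proof -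
  let ?G = "{{s \<in> space M. \<forall>i\<in>set l. s \<in> b i} | l. True}"
  have "range b \<subseteq> ?G"
  proof clarify
    fix i show "\<exists>l. b i = {s \<in> space M. \<forall>i\<in>set l. s \<in> b i} \<and> True"
      using sub by (intro exI[of _ "[i]"]) auto
  qed
  then have "sets M \<subseteq> sigma_sets (space M) ?G"
    unfolding gen by (rule sigma_sets_subseteq)
  with assms have "A \<in> sigma_sets (space M) ?G" by blast
  have G_sets: "sigma_sets (space M) ?G \<subseteq> sets M"
  proof (rule sets.sigma_sets_subset, clarify)
    fix l
    have [measurable]: "b i \<in> sets M" for i using range_b by auto
    show "{s \<in> space M. \<forall>i\<in>set l. s \<in> b i} \<in> sets M" by measurable
  qed
  have "Int_stable ?G"
  proof (rule Int_stableI, clarify)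
    fix l l'
    show "\<exists>m. {s \<in> space M. \<forall>i\<in>set l. s \<in> b i} \<inter> {s \<in> space M. \<forall>i\<in>set l'. s \<in> b i}
        = {s \<in> space M. \<forall>i\<in>set m. s \<in> b i} \<and> True"
      by (intro exI[of _ "l @ l'"]) auto
  qed
  moreover have "?G \<subseteq> Pow (space M)" by auto
  ultimately show ?thesis
    using \<open>A \<in> sigma_sets (space M) ?G\<close>
  proof (induction rule: sigma_sets_induct_disjoint)
    case (basic A)
    then obtain l where A: "A = {s \<in> space M. \<forall>i\<in>set l. s \<in> b i}" by auto
    show ?case by (rule approximable_cong[OF approximable_inter[of l]]) (simp add: A indicator_def)
  next
    case empty
    show ?case using approximable_zero by (simp add: indicator_def[abs_def])
  next
    case (compl A)
    have "approximable M b (\<lambda>s. 1 + (- 1) * indicator A s)"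
      using approximable_inter[of "[]"] compl by (intro approximable_add approximable_scale) auto
    then show ?case by (rule approximable_cong) (auto simp: indicator_def)
  next
    case (union A)
    have A: "A i \<in> sets M" for i using union(2) G_sets by auto
    have disj: "A i \<inter> A n = {}" if "i \<noteq> n" for i n
      using union(1) that unfolding disjoint_family_on_def by blast
    have part: "approximable M b (indicator (\<Union>i<n. A i))" for n
    proof (induction n)
      case 0
      then show ?case using approximable_zero by (simp add: indicator_def[abs_def])
    next
      case (Suc n)
      have *: "approximable M b (\<lambda>s. indicator (\<Union>i<n. A i) s + indicator (A n) s)"
        using Suc union(3) by (rule approximable_add)
      have d: "(\<Union>i<n. A i) \<inter> A n = {}"
        using disj[OF less_imp_neq] by blast
      show ?case
      proof (rule approximable_cong[OF *])
        fix s
        show "indicator (\<Union>i<n. A i) s + indicator (A n) s = (indicator (\<Union>i<Suc n. A i) s :: real)"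
          by (subst indicator_add[OF d]) (simp add: lessThan_Suc Un_commute)
      qed
    qed
    show ?case
    proof (rule approximable_close)
      show "integrable M (indicator (\<Union>i. A i) :: _ \<Rightarrow> real)" using A by (simp add: less_top[symmetric])
      fix \<epsilon> :: real assume \<epsilon>: "0 < \<epsilon>"
      have "(\<lambda>n. measure M (\<Union>i<n. A i)) \<longlonglongrightarrow> measure M (\<Union>n. \<Union>i<n. A i)"
        using A by (intro finite_Lim_measure_incseq) (auto simp: incseq_def intro: less_le_trans)
      moreover have "(\<Union>n. \<Union>i<n. A i) = (\<Union>i. A i)" by (auto intro: lessI)
      ultimately have "\<forall>\<^sub>F n in sequentially. measure M (\<Union>i. A i) - \<epsilon> < measure M (\<Union>i<n. A i)"
        using \<epsilon> by (auto intro: order_tendstoD(1))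
      then obtain n where n: "measure M (\<Union>i. A i) - \<epsilon> < measure M (\<Union>i<n. A i)"
        by (auto simp: eventually_sequentially)
      have "(\<integral>s. \<bar>indicator (\<Union>i. A i) s - indicator (\<Union>i<n. A i) s :: real\<bar> \<partial>M)
          = (\<integral>s. indicator ((\<Union>i. A i) - (\<Union>i<n. A i)) s \<partial>M)"
        by (intro Bochner_Integration.integral_cong) (auto simp: indicator_def)
      also have "\<dots> = measure M ((\<Union>i. A i) - (\<Union>i<n. A i))" using A by simp
      also have "\<dots> = measure M (\<Union>i. A i) - measure M (\<Union>i<n. A i)"
        using A by (intro finite_measure_Diff) auto
      finally show "\<exists>g. approximable M b g \<and> (\<integral>s. \<bar>indicator (\<Union>i. A i) s - g s\<bar> \<partial>M) < \<epsilon>"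
        using part n by (intro exI[of _ "indicator (\<Union>i<n. A i)"]) simp
    qed
  qed
qed

lemma approximable_integrable:
  assumes "integrable M f"
  shows "approximable M b f"
  using assms
proof (induction rule: integrable_induct)
  case (base A c)
  then show ?case using approximable_scale[OF approximable_indicator, of A c] by (simp add: mult.commute)
next
  case (add f g)
  then show ?case by (intro approximable_add)
next
  case (lim f s)
  show ?case
  proof (rule approximable_close)
    fix \<epsilon> :: real assume \<epsilon>: "0 < \<epsilon>"
    have "(\<lambda>i. \<integral>x. \<bar>f x - s i x\<bar> \<partial>M) \<longlonglongrightarrow> (\<integral>x. 0 \<partial>M)"
    proof (rule integral_dominated_convergence[where w = "\<lambda>x. 3 * \<bar>f x\<bar>"])
      show "integrable M (\<lambda>x. 3 * \<bar>f x\<bar>)" using lim.hyps by simp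
      show "(\<lambda>x. \<bar>f x - s i x\<bar>) \<in> borel_measurable M" for i using lim.hyps(1)[of i] lim.hyps(4) by auto
      show "AE x in M. (\<lambda>i. \<bar>f x - s i x\<bar>) \<longlonglongrightarrow> 0"
      proof (rule AE_I2)
        fix x assume "x \<in> space M"
        from tendsto_diff[OF tendsto_const lim.hyps(2)[OF this], of "f x"]
        show "(\<lambda>i. \<bar>f x - s i x\<bar>) \<longlonglongrightarrow> 0" using tendsto_rabs_zero by fastforce
      qed
      show "AE x in M. norm \<bar>f x - s i x\<bar> \<le> 3 * \<bar>f x\<bar>" for i
        using lim.hyps(3)[of _ i] by (intro AE_I2) (fastforce simp: abs_if split: if_splits)
    qed simp
    then have "\<forall>\<^sub>F i in sequentially. (\<integral>x. \<bar>f x - s i x\<bar> \<partial>M) < \<epsilon>"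
      using \<epsilon> by (auto intro: order_tendstoD(2))
    then obtain i where "(\<integral>x. \<bar>f x - s i x\<bar> \<partial>M) < \<epsilon>" by (auto simp: eventually_sequentially)
    then show "\<exists>g. approximable M b g \<and> (\<integral>x. \<bar>f x - g x\<bar> \<partial>M) < \<epsilon>" using lim.IH by blast
  qed (fact lim.hyps)
qed

end

section \<open>Co-spectral functions from countably many coordinates\<close>

text \<open>A positive integrable weight \<open>w\<close> turns the \<open>\<sigma>\<close>-finite measure into a finite one and \<open>g t\<close> into
  \<open>g t / w\<close>, without change of distances.  For every step function and precision, \<open>D\<close> contains a member of
  the family that is this close to it, if there is one; so the family need not contain step
  functions itself.\<close>

lemma L1_family_separable:
  fixes g :: "'t \<Rightarrow> 's \<Rightarrow> real"
  assumes "standard_borel \<mu>" "sigma_finite_measure \<mu>" and g: "\<And>t. integrable \<mu> (g t)"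
  obtains D :: "nat \<Rightarrow> 't" where "\<And>t \<epsilon>. 0 < \<epsilon> \<Longrightarrow> \<exists>n. (\<integral>s. \<bar>g t s - g (D n) s\<bar> \<partial>\<mu>) < \<epsilon>"
proof -
  interpret sigma_finite_measure \<mu> by fact
  obtain h where h: "h \<in> borel_measurable \<mu>" "integral\<^sup>N \<mu> h \<noteq> \<infinity>" "\<And>s. s \<in> space \<mu> \<Longrightarrow> 0 < h s \<and> h s < \<infinity>"
    using Ex_finite_integrable_function by blast
  define w where "w s = enn2real (h s)" for s
  have w_meas [measurable]: "w \<in> borel_measurable \<mu>" using h(1) unfolding w_def[abs_def] by measurable
  have w_pos: "0 < w s" if "s \<in> space \<mu>" for s
    using h(3)[OF that] by (simp add: w_def enn2real_positive_iff)
  have w_nonneg: "0 \<le> w s" for s by (simp add: w_def)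
  define M where "M = density \<mu> (\<lambda>s. ennreal (w s))"
  have sM: "sets M = sets \<mu>" "space M = space \<mu>" by (simp_all add: M_def)
  have "emeasure M (space M) = (\<integral>\<^sup>+s. ennreal (w s) \<partial>\<mu>)"
    by (simp add: M_def emeasure_density cong: nn_integral_cong)
  also have "\<dots> = integral\<^sup>N \<mu> h"
    using h(3) by (intro nn_integral_cong) (auto simp: w_def)
  finally have fin: "finite_measure M" using h(2) by (intro finite_measureI) simp
  obtain e :: "'s \<Rightarrow> nat \<Rightarrow> real" where
    e: "sets \<mu> = sigma_sets (space \<mu>) (range (\<lambda>(i, q). {s \<in> space \<mu>. e s i < real_of_rat q}))"
    by (rule standard_borel_embedding[OF assms(1)]) (rule that)
  define b where "b n = (\<lambda>(i, q). {s \<in> space \<mu>. e s i < real_of_rat q}) (from_nat n :: nat \<times> rat)" for n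
  have rb: "range b = range (\<lambda>(i, q). {s \<in> space \<mu>. e s i < real_of_rat q})"
    unfolding b_def using surj_from_nat by (subst image_comp[symmetric, unfolded comp_def, of _ from_nat]) simp
  have gen: "sets M = sigma_sets (space M) (range b)" by (simp add: sM rb e)
  have sub: "range b \<subseteq> Pow (space M)" by (auto simp: rb sM)
  define k where "k t s = g t s / w s" for t s
  have k_meas: "k t \<in> borel_measurable \<mu>" for t
    using borel_measurable_integrable[OF g[of t]] unfolding k_def[abs_def] by measurable
  have wk: "w s * k t s = g t s" if "s \<in> space \<mu>" for t s using w_pos[OF that] by (simp add: k_def)
  have k_int: "integrable M (k t)" for t
  proof -
    have "integrable \<mu> (\<lambda>s. w s *\<^sub>R k t s)"
      using g[of t] by (rule Bochner_Integration.integrable_cong[THEN iffD1, rotated 2]) (simp_all add: wk)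
    then show ?thesis unfolding M_def using k_meas w_nonneg by (subst integrable_density) auto
  qed
  have dist: "(\<integral>s. \<bar>k t s - k u s\<bar> \<partial>M) = (\<integral>s. \<bar>g t s - g u s\<bar> \<partial>\<mu>)" for t u
  proof -
    have "(\<integral>s. \<bar>k t s - k u s\<bar> \<partial>M) = (\<integral>s. w s *\<^sub>R \<bar>k t s - k u s\<bar> \<partial>\<mu>)"
      unfolding M_def using k_meas[of t] k_meas[of u] w_nonneg by (intro integral_density) auto
    also have "\<dots> = (\<integral>s. \<bar>g t s - g u s\<bar> \<partial>\<mu>)"
    proof (intro Bochner_Integration.integral_cong refl)
      fix s assume s: "s \<in> space \<mu>"
      have "w s *\<^sub>R \<bar>k t s - k u s\<bar> = \<bar>w s * k t s - w s * k u s\<bar>"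
        using w_nonneg[of s] by (simp add: abs_mult right_diff_distrib[symmetric])
      then show "w s *\<^sub>R \<bar>k t s - k u s\<bar> = \<bar>g t s - g u s\<bar>" by (simp add: wk[OF s])
    qed
    finally show ?thesis .
  qed
  define near where "near = (\<lambda>(xs, n :: nat) t. (\<integral>s. \<bar>k t s - step_function b xs s\<bar> \<partial>M) < 1 / Suc n)"
  define D where "D m = (SOME t. near (from_nat m) t)" for m
  show thesis
  proof
    fix t and \<epsilon> :: real assume "0 < \<epsilon>"
    then have "0 < \<epsilon> / 2" by simp
    then obtain n where n: "1 / real (Suc n) < \<epsilon> / 2" by (rule nat_approx_posE)
    have "approximable M b (k t)" by (rule approximable_integrable[OF fin gen sub k_int])
    moreover have "0 < 1 / real (Suc n)" by simp
    ultimately obtain xs where xs: "near (xs, n) t" unfolding approximable_def near_def by blast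
    define m where "m = to_nat (xs, n)"
    have D: "near (xs, n) (D m)" unfolding D_def m_def from_nat_to_nat using xs by (rule someI)
    have si: "integrable M (step_function b xs)"
      by (rule integrable_step_function[OF fin]) (use gen in \<open>auto intro: sigma_sets.Basic\<close>)
    have "(\<integral>s. \<bar>k t s - k (D m) s\<bar> \<partial>M)
        \<le> (\<integral>s. \<bar>k t s - step_function b xs s\<bar> + \<bar>k (D m) s - step_function b xs s\<bar> \<partial>M)"
      using k_int[of t] k_int[of "D m"] si by (intro integral_mono) simp_all
    also have "\<dots> = (\<integral>s. \<bar>k t s - step_function b xs s\<bar> \<partial>M) + (\<integral>s. \<bar>k (D m) s - step_function b xs s\<bar> \<partial>M)"
      using k_int[of t] k_int[of "D m"] si by (intro Bochner_Integration.integral_add) simp_all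
    also have "\<dots> < \<epsilon>" using xs D n by (simp add: near_def)
    finally show "\<exists>n. (\<integral>s. \<bar>g t s - g (D n) s\<bar> \<partial>\<mu>) < \<epsilon>" unfolding dist by blast
  qed
qed

text \<open>Since \<open>\<bar>x - y\<bar> = 2 max(x, y) - x - y\<close>, distances are determined by the exponents, hence by the law of
  the represented process.\<close>

lemma rho_eq_envelope:
  assumes f: "\<And>t. f t \<in> L_plus \<alpha> \<mu>"
  shows "rho \<mu> \<alpha> (f t) (f u) = 2 * exponent \<alpha> \<mu> f {(t, 1), (u, 1)}
    - exponent \<alpha> \<mu> f {(t, 1)} - exponent \<alpha> \<mu> f {(u, 1)}"
proof -
  have w: "positive_weights {(t, 1)}" "positive_weights {(u, 1)}" "positive_weights {(t, 1), (u, 1)}"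
    by (simp_all add: positive_weights_def)
  have i: "integrable \<mu> (envelope \<alpha> f K)" if "positive_weights K" for K
    by (rule integrable_envelope[OF that f])
  have one: "envelope \<alpha> f {(t, 1)} s = f t s powr \<alpha>" for t s by (simp add: envelope_def)
  have two: "envelope \<alpha> f {(t, 1), (u, 1)} s = max (f t s powr \<alpha>) (f u s powr \<alpha>)" for s
    by (simp add: envelope_def max_def)
  have "rho \<mu> \<alpha> (f t) (f u) = (\<integral>s. 2 * envelope \<alpha> f {(t, 1), (u, 1)} s - envelope \<alpha> f {(t, 1)} s - envelope \<alpha> f {(u, 1)} s \<partial>\<mu>)"
    unfolding rho_def one two by (intro Bochner_Integration.integral_cong) (auto simp: max_def)
  also have "\<dots> = 2 * exponent \<alpha> \<mu> f {(t, 1), (u, 1)}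
    - exponent \<alpha> \<mu> f {(t, 1)} - exponent \<alpha> \<mu> f {(u, 1)}"
    using i[OF w(1)] i[OF w(2)] i[OF w(3)] by simp
  finally show ?thesis .
qed

lemma jointly_measurable_section:
  assumes "jointly_measurable \<mu> f" "sets lam = sets borel"
  shows "s \<in> space \<mu> \<Longrightarrow> (\<lambda>t. f t s) \<in> borel_measurable lam"
    "(\<lambda>(t, s). f t s) \<in> borel_measurable (lam \<Otimes>\<^sub>M \<mu>)"
proof -
  show *: "(\<lambda>(t, s). f t s) \<in> borel_measurable (lam \<Otimes>\<^sub>M \<mu>)"
    using assms(1) unfolding jointly_measurable_def
    by (simp cong: measurable_cong_sets sets_pair_measure_cong add: assms(2))
  show "s \<in> space \<mu> \<Longrightarrow> (\<lambda>t. f t s) \<in> borel_measurable lam"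
    using measurable_compose[OF measurable_Pair2' *, of s] by simp
qed

text \<open>The first index that is close enough depends measurably on \<open>t\<close>, as distances do by Fubini.\<close>

lemma measurable_selection:
  fixes f :: "'t::topological_space \<Rightarrow> 's \<Rightarrow> real"
  assumes \<mu>: "standard_borel \<mu>" "sigma_finite_measure \<mu>"
    and f: "\<And>t. f t \<in> L_plus \<alpha> \<mu>" and jm: "jointly_measurable \<mu> f"
  obtains D :: "nat \<Rightarrow> 't" and \<tau> :: "nat \<Rightarrow> 't \<Rightarrow> nat"
  where "\<And>k. \<tau> k \<in> measurable borel (count_space UNIV)"
    "\<And>k t. rho \<mu> \<alpha> (f t) (f (D (\<tau> k t))) < (1 / 2) ^ k"
proof -
  interpret sigma_finite_measure \<mu> by fact
  have g: "integrable \<mu> (\<lambda>s. f t s powr \<alpha>)" for t using L_plusD(3)[OF f] .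
  obtain D :: "nat \<Rightarrow> 't" where D: "\<And>t \<epsilon>. 0 < \<epsilon> \<Longrightarrow> \<exists>n. rho \<mu> \<alpha> (f t) (f (D n)) < \<epsilon>"
    using L1_family_separable[OF \<mu>, of "\<lambda>t s. f t s powr \<alpha>", OF g] unfolding rho_def by blast
  define \<tau> where "\<tau> k t = (LEAST n. rho \<mu> \<alpha> (f t) (f (D n)) < (1 / 2) ^ k)" for k t
  have rho_meas [measurable]: "(\<lambda>t. rho \<mu> \<alpha> (f t) (f u)) \<in> borel_measurable borel" for u
  proof -
    have [measurable]: "(\<lambda>(t, s). f t s) \<in> borel_measurable (borel \<Otimes>\<^sub>M \<mu>)" "f u \<in> borel_measurable \<mu>"
      using jm L_plusD(1)[OF f] by (simp_all add: jointly_measurable_def)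
    show ?thesis unfolding rho_def by measurable
  qed
  show thesis
  proof
    show "\<tau> k \<in> measurable borel (count_space UNIV)" for k
      unfolding \<tau>_def by measurable
    show "rho \<mu> \<alpha> (f t) (f (D (\<tau> k t))) < (1 / 2) ^ k" for k t
      unfolding \<tau>_def by (rule LeastI_ex) (simp add: D)
  qed
qed

text \<open>The series of the differences has a finite integral, so it converges almost everywhere.\<close>

lemma AE_tendsto_of_rho_summable:
  assumes f: "f \<in> L_plus \<alpha> \<mu>" "\<And>k. h k \<in> L_plus \<alpha> \<mu>" and small: "\<And>k. rho \<mu> \<alpha> f (h k) < (1 / 2) ^ k"
  shows "AE s in \<mu>. (\<lambda>k. h k s powr \<alpha>) \<longlonglongrightarrow> f s powr \<alpha>"
proof -
  have i: "integrable \<mu> (\<lambda>s. \<bar>f s powr \<alpha> - h k s powr \<alpha>\<bar>)" for k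
    by (intro Bochner_Integration.integrable_abs Bochner_Integration.integrable_diff L_plusD(3) f)
  have "(\<integral>\<^sup>+s. (\<Sum>k. ennreal \<bar>f s powr \<alpha> - h k s powr \<alpha>\<bar>) \<partial>\<mu>)
      = (\<Sum>k. \<integral>\<^sup>+s. ennreal \<bar>f s powr \<alpha> - h k s powr \<alpha>\<bar> \<partial>\<mu>)"
    using i by (intro nn_integral_suminf) (auto dest: borel_measurable_integrable)
  also have "\<dots> = (\<Sum>k. ennreal (rho \<mu> \<alpha> f (h k)))"
    unfolding rho_def using i by (intro suminf_cong nn_integral_eq_integral) auto
  also have "\<dots> \<le> (\<Sum>k. ennreal ((1 / 2) ^ k))"
    using small by (intro suminf_le ennreal_leI) (auto intro: less_imp_le)
  also have "\<dots> = ennreal (\<Sum>k. (1 / 2) ^ k)"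
    by (intro suminf_ennreal2) (auto intro: summable_geometric)
  also have "\<dots> < \<infinity>" by simp
  finally have "(\<integral>\<^sup>+s. (\<Sum>k. ennreal \<bar>f s powr \<alpha> - h k s powr \<alpha>\<bar>) \<partial>\<mu>) < \<infinity>" .
  then have "(\<integral>\<^sup>+s. (\<Sum>k. ennreal \<bar>f s powr \<alpha> - h k s powr \<alpha>\<bar>) \<partial>\<mu>) \<noteq> \<infinity>" by simp
  moreover have "(\<lambda>s. \<Sum>k. ennreal \<bar>f s powr \<alpha> - h k s powr \<alpha>\<bar>) \<in> borel_measurable \<mu>"
    using borel_measurable_integrable[OF i] by measurable
  ultimately have "AE s in \<mu>. (\<Sum>k. ennreal \<bar>f s powr \<alpha> - h k s powr \<alpha>\<bar>) \<noteq> \<infinity>"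
    by (intro nn_integral_PInf_AE)
  then show ?thesis
  proof eventually_elim
    case (elim s)
    then have "summable (\<lambda>k. \<bar>f s powr \<alpha> - h k s powr \<alpha>\<bar>)"
      by (intro summable_suminf_not_top) auto
    then have "(\<lambda>k. \<bar>f s powr \<alpha> - h k s powr \<alpha>\<bar>) \<longlonglongrightarrow> 0" by (rule summable_LIMSEQ_zero)
    then have "(\<lambda>k. f s powr \<alpha> - h k s powr \<alpha>) \<longlonglongrightarrow> 0" by (rule tendsto_rabs_zero_cancel)
    from tendsto_diff[OF tendsto_const[of "f s powr \<alpha>"] this] show ?case by simp
  qed
qed

text \<open>For each \<open>t\<close> convergence holds for almost all \<open>s\<close>; by Fubini the quantifiers may be exchanged.  For such
  \<open>s\<close>, the values \<open>f (D i) s\<close> determine \<open>f t s\<close> for almost all \<open>t\<close> by a limit that is the same for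
  every family with which \<open>\<tau>\<close> is used.\<close>

lemma AE_recovered_from_selection:
  fixes f :: "'t::topological_space \<Rightarrow> 's \<Rightarrow> real"
  assumes lam: "sets lam = sets borel" "sigma_finite_measure lam"
    and \<mu>: "sigma_finite_measure \<mu>"
    and f: "\<And>t. f t \<in> L_plus \<alpha> \<mu>" and jm: "jointly_measurable \<mu> f"
    and \<tau>: "\<And>k. \<tau> k \<in> measurable borel (count_space UNIV)"
    and small: "\<And>k t. rho \<mu> \<alpha> (f t) (f (D (\<tau> k t))) < (1 / 2) ^ k"
  shows "AE s in \<mu>. AE t in lam. (\<lambda>k. f (D (\<tau> k t :: nat)) s powr \<alpha>) \<longlonglongrightarrow> f t s powr \<alpha>"
proof -
  interpret lam: sigma_finite_measure lam by fact
  interpret \<mu>: sigma_finite_measure \<mu> by fact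
  interpret pair_sigma_finite lam \<mu> ..
  have [measurable]: "(\<lambda>p. f (fst p) (snd p)) \<in> borel_measurable (lam \<Otimes>\<^sub>M \<mu>)"
    using jointly_measurable_section(2)[OF jm lam(1)] unfolding case_prod_unfold .
  have \<tau>' [measurable]: "\<tau> k \<in> measurable lam (count_space UNIV)" for k
    using \<tau>[of k] unfolding measurable_cong_sets[OF lam(1) refl] .
  have fD: "f u \<in> borel_measurable \<mu>" for u using L_plusD(1)[OF f] .
  have [measurable]: "(\<lambda>p. f (D (\<tau> k (fst p))) (snd p)) \<in> borel_measurable (lam \<Otimes>\<^sub>M \<mu>)" for k
  proof (rule measurable_compose_countable[where f = "\<lambda>n p. f (D n) (snd p)" and g = "\<lambda>p. \<tau> k (fst p)"])
    show "(\<lambda>p. f (D n) (snd p)) \<in> borel_measurable (lam \<Otimes>\<^sub>M \<mu>)" for n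
      by (rule measurable_compose[OF measurable_snd fD])
  qed measurable
  have "AE t in lam. AE s in \<mu>. (\<lambda>k. f (D (\<tau> k t)) s powr \<alpha>) \<longlonglongrightarrow> f t s powr \<alpha>"
    using f small by (intro AE_I2 AE_tendsto_of_rho_summable) auto
  then show ?thesis
    by (subst (asm) AE_commute) measurable
qed

section \<open>The law of normalized coordinates\<close>

text \<open>The function \<open>y \<mapsto> max(y q, Q)\<close> has right derivative \<open>q\<close> at 1 if \<open>Q \<le> q\<close> and \<open>0\<close> otherwise, and its
  difference quotients are bounded by \<open>q\<close>.\<close>

lemma tendsto_right_derivative_max:
  fixes q Q :: "'s \<Rightarrow> real"
  assumes q: "integrable \<mu> q" "\<And>s. 0 \<le> q s" and Q: "integrable \<mu> Q" "\<And>s. 0 \<le> Q s"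
  shows "(\<lambda>k. real (Suc k) * ((\<integral>s. max ((1 + 1 / Suc k) * q s) (Q s) \<partial>\<mu>) - (\<integral>s. max (q s) (Q s) \<partial>\<mu>)))
    \<longlonglongrightarrow> (\<integral>s. q s * of_bool (Q s \<le> q s) \<partial>\<mu>)"
proof -
  note [measurable] = borel_measurable_integrable[OF q(1)] borel_measurable_integrable[OF Q(1)]
  let ?d = "\<lambda>k s. real (Suc k) * (max ((1 + 1 / Suc k) * q s) (Q s) - max (q s) (Q s))"
  have "(\<lambda>k. \<integral>s. ?d k s \<partial>\<mu>) \<longlonglongrightarrow> (\<integral>s. q s * of_bool (Q s \<le> q s) \<partial>\<mu>)"
  proof (rule integral_dominated_convergence[where w = q])
    show "(\<lambda>s. ?d k s) \<in> borel_measurable \<mu>" for k by measurable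
    show "(\<lambda>s. q s * of_bool (Q s \<le> q s)) \<in> borel_measurable \<mu>" by measurable
    show "AE s in \<mu>. norm (?d k s) \<le> q s" for k
    proof (rule AE_I2)
      fix s
      have "(1 + 1 / real (Suc k)) * q s = q s + q s / Suc k" by (simp add: distrib_right)
      moreover have "0 \<le> q s / Suc k" using q(2)[of s] by simp
      ultimately have "\<bar>max ((1 + 1 / Suc k) * q s) (Q s) - max (q s) (Q s)\<bar> \<le> q s / Suc k"
        by (auto simp: max_def abs_if)
      then have "real (Suc k) * \<bar>max ((1 + 1 / Suc k) * q s) (Q s) - max (q s) (Q s)\<bar> \<le> real (Suc k) * (q s / Suc k)"
        by (rule mult_left_mono) simp
      then show "norm (?d k s) \<le> q s" by (simp add: abs_mult del: of_nat_Suc)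
    qed
    show "AE s in \<mu>. (\<lambda>k. ?d k s) \<longlonglongrightarrow> q s * of_bool (Q s \<le> q s)"
    proof (rule AE_I2)
      fix s
      show "(\<lambda>k. ?d k s) \<longlonglongrightarrow> q s * of_bool (Q s \<le> q s)"
      proof (cases "Q s \<le> q s")
        case True
        have "?d k s = q s" for k
        proof -
          have "(1 + 1 / real (Suc k)) * q s = q s + q s / Suc k" by (simp add: distrib_right)
          moreover have "0 \<le> q s / Suc k" using q(2)[of s] by simp
          ultimately have "max ((1 + 1 / Suc k) * q s) (Q s) - max (q s) (Q s) = q s / Suc k"
            using True by simp
          then show ?thesis by (simp del: of_nat_Suc)
        qed
        with True show ?thesis by simp
      next
        case False
        have "(\<lambda>k. (1 + 1 / real (Suc k)) * q s) \<longlonglongrightarrow> (1 + 0) * q s"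
          using LIMSEQ_inverse_real_of_nat
          by (intro tendsto_mult tendsto_add tendsto_const) (simp add: inverse_eq_divide)
        then have "\<forall>\<^sub>F k in sequentially. (1 + 1 / real (Suc k)) * q s < Q s"
          using False by (intro order_tendstoD(2)) auto
        then have "\<forall>\<^sub>F k in sequentially. ?d k s = q s * of_bool (Q s \<le> q s)"
          by eventually_elim (use False in \<open>simp add: max_def\<close>)
        then show ?thesis by (rule tendsto_eventually)
      qed
    qed
  qed (rule q(1))
  moreover have "(\<integral>s. ?d k s \<partial>\<mu>)
      = real (Suc k) * ((\<integral>s. max ((1 + 1 / Suc k) * q s) (Q s) \<partial>\<mu>) - (\<integral>s. max (q s) (Q s) \<partial>\<mu>))" for k
  proof -
    have "integrable \<mu> (\<lambda>s. max (c * q s) (Q s))" for c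
      using q(1) Q(1) by (intro integrable_max) auto
    from this[of "1 + 1 / Suc k"] this[of 1] show ?thesis by simp
  qed
  ultimately show ?thesis by simp
qed

definition weighted :: "real \<Rightarrow> 's measure \<Rightarrow> ('t \<Rightarrow> 's \<Rightarrow> real) \<Rightarrow> ('t \<times> real) set \<Rightarrow> 's measure" where
  "weighted \<alpha> \<mu> f K = density \<mu> (\<lambda>s. ennreal (envelope \<alpha> f K s))"

text \<open>Dividing by the envelope, which is positive almost everywhere for \<open>weighted\<close>, leaves the co-spectral
  function only up to a positive factor, which a cone does not see.\<close>

definition ratio :: "real \<Rightarrow> ('t \<Rightarrow> 's \<Rightarrow> real) \<Rightarrow> ('t \<times> real) set \<Rightarrow> (nat \<Rightarrow> 't) \<Rightarrow> 's \<Rightarrow> nat \<Rightarrow> real" where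
  "ratio \<alpha> f K D s i = f (D i) s powr \<alpha> / envelope \<alpha> f K s"

lemma sets_weighted [simp]: "sets (weighted \<alpha> \<mu> f K) = sets \<mu>" "space (weighted \<alpha> \<mu> f K) = space \<mu>"
  by (simp_all add: weighted_def)

lemma weighted_measure:
  assumes K: "positive_weights K" and f: "\<And>t. f t \<in> L_plus \<alpha> \<mu>" and A: "A \<in> sets \<mu>"
  shows "emeasure (weighted \<alpha> \<mu> f K) A = ennreal (\<integral>s. envelope \<alpha> f K s * indicator A s \<partial>\<mu>)"
    "finite_measure (weighted \<alpha> \<mu> f K)"
    "measure (weighted \<alpha> \<mu> f K) A = (\<integral>s. envelope \<alpha> f K s * indicator A s \<partial>\<mu>)"
proof -
  have i: "integrable \<mu> (envelope \<alpha> f K)" by (rule integrable_envelope[OF K f])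
  note [measurable] = borel_measurable_integrable[OF i]
  note nn = envelope_nonneg[OF positive_weights_finite[OF K], of \<alpha> f]
  have e: "emeasure (weighted \<alpha> \<mu> f K) A = ennreal (\<integral>s. envelope \<alpha> f K s * indicator A s \<partial>\<mu>)" if "A \<in> sets \<mu>" for A
  proof -
    have "emeasure (weighted \<alpha> \<mu> f K) A = (\<integral>\<^sup>+s. ennreal (envelope \<alpha> f K s * indicator A s) \<partial>\<mu>)"
      unfolding weighted_def using that nn
      by (subst emeasure_density) (auto intro!: nn_integral_cong simp: ennreal_mult' ennreal_indicator)
    also have "\<dots> = ennreal (\<integral>s. envelope \<alpha> f K s * indicator A s \<partial>\<mu>)"
      using i that nn by (intro nn_integral_eq_integral integrable_real_mult_indicator) auto
    finally show ?thesis .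
  qed
  show "emeasure (weighted \<alpha> \<mu> f K) A = ennreal (\<integral>s. envelope \<alpha> f K s * indicator A s \<partial>\<mu>)" by (rule e[OF A])
  show "finite_measure (weighted \<alpha> \<mu> f K)"
    by (rule finite_measureI) (simp add: e[OF sets.top])
  show "measure (weighted \<alpha> \<mu> f K) A = (\<integral>s. envelope \<alpha> f K s * indicator A s \<partial>\<mu>)"
    unfolding measure_def e[OF A] using nn by (simp add: integral_nonneg_AE)
qed

lemma ratio_measurable:
  assumes K: "positive_weights K" and f: "\<And>t. f t \<in> L_plus \<alpha> \<mu>"
  shows "(\<lambda>s. ratio \<alpha> f K D s i) \<in> borel_measurable \<mu>"
proof -
  note [measurable] = measurable_envelope[OF positive_weights_finite[OF K] L_plusD(1)[OF f]] L_plusD(1)[OF f]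
  show ?thesis unfolding ratio_def by measurable
qed

lemma AE_weighted:
  assumes K: "positive_weights K" and f: "\<And>t. f t \<in> L_plus \<alpha> \<mu>"
  shows "(AE s in weighted \<alpha> \<mu> f K. P s) \<longleftrightarrow> (AE s in \<mu>. 0 < envelope \<alpha> f K s \<longrightarrow> P s)"
proof -
  note [measurable] = measurable_envelope[OF positive_weights_finite[OF K] L_plusD(1)[OF f]]
  show ?thesis unfolding weighted_def by (subst AE_density) auto
qed

lemma positive_weights_powr:
  assumes L: "positive_weights L"
  shows "positive_weights ((\<lambda>(i, b). (\<phi> i, b powr c)) ` L)"
proof (rule positive_weights_image[OF L])
  fix i b assume "(i, b) \<in> L"
  from positive_weightsD[OF L this] show "0 < b powr c" by simp
qed

text \<open>The condition \<open>b f\<^sub>D\<^sub>i\<^sup>\<alpha> / q \<le> 1\<close> compares \<open>q\<close> with the envelope \<open>Q\<close> for the weights \<open>b\<^sup>1\<^sup>/\<^sup>\<alpha>\<close>, and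
  \<open>max(y q, Q)\<close> is the envelope for the union of those weights with \<open>K\<close> scaled by \<open>y\<^sup>1\<^sup>/\<^sup>\<alpha>\<close>.  So the
  right derivative above is taken along exponents.\<close>

lemma weighted_ratio_box:
  assumes "0 < \<alpha>" and K: "positive_weights K" and f: "\<And>t. f t \<in> L_plus \<alpha> \<mu>" and L: "positive_weights L"
  shows "(\<lambda>k. real (Suc k) *
      ((\<integral>s. envelope \<alpha> f ((\<lambda>(t, a). (t, (1 + 1 / Suc k) powr (1 / \<alpha>) * a)) ` K
            \<union> (\<lambda>(i, b). (D i, b powr (1 / \<alpha>))) ` L) s \<partial>\<mu>)
        - (\<integral>s. envelope \<alpha> f (K \<union> (\<lambda>(i, b). (D i, b powr (1 / \<alpha>))) ` L) s \<partial>\<mu>)))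
    \<longlonglongrightarrow> measure (weighted \<alpha> \<mu> f K) (box_event (weighted \<alpha> \<mu> f K) (\<lambda>i s. ratio \<alpha> f K D s i) L)"
proof -
  let ?L = "(\<lambda>(i, b). (D i, b powr (1 / \<alpha>))) ` L"
  let ?q = "envelope \<alpha> f K" and ?Q = "envelope \<alpha> f ?L"
  have L': "positive_weights ?L"
    by (rule positive_weights_powr[OF L])
  note finK = positive_weights_finite[OF K] and finL = positive_weights_finite[OF L']
  have lhs: "(\<integral>s. envelope \<alpha> f ((\<lambda>(t, a). (t, c powr (1 / \<alpha>) * a)) ` K \<union> ?L) s \<partial>\<mu>)
      = (\<integral>s. max (c * ?q s) (?Q s) \<partial>\<mu>)" if c: "0 < c" for c
  proof (intro Bochner_Integration.integral_cong refl)
    fix s assume s: "s \<in> space \<mu>"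
    have "envelope \<alpha> f ((\<lambda>(t, a). (t, c powr (1 / \<alpha>) * a)) ` K) s = (c powr (1 / \<alpha>)) powr \<alpha> * ?q s"
      using c L_plusD(2)[OF f s] by (intro envelope_scale[OF K]) auto
    then show "envelope \<alpha> f ((\<lambda>(t, a). (t, c powr (1 / \<alpha>) * a)) ` K \<union> ?L) s = max (c * ?q s) (?Q s)"
      using c assms(1) finK finL by (simp add: envelope_Un powr_powr)
  qed
  have base: "exponent \<alpha> \<mu> f (K \<union> ?L) = (\<integral>s. max (?q s) (?Q s) \<partial>\<mu>)"
    by (intro Bochner_Integration.integral_cong refl) (simp add: envelope_Un finK finL)
  have box_sets: "box_event (weighted \<alpha> \<mu> f K) (\<lambda>i s. ratio \<alpha> f K D s i) L \<in> sets \<mu>"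
    using sets_box_event[OF positive_weights_finite[OF L], of "\<lambda>i s. ratio \<alpha> f K D s i" "weighted \<alpha> \<mu> f K"]
      ratio_measurable[OF K f] by (simp cong: measurable_cong_sets)
  have "(\<integral>s. ?q s * of_bool (?Q s \<le> ?q s) \<partial>\<mu>)
      = (\<integral>s. ?q s * indicator (box_event (weighted \<alpha> \<mu> f K) (\<lambda>i s. ratio \<alpha> f K D s i) L) s \<partial>\<mu>)"
  proof (intro Bochner_Integration.integral_cong refl)
    fix s assume s: "s \<in> space \<mu>"
    show "?q s * of_bool (?Q s \<le> ?q s)
      = ?q s * indicator (box_event (weighted \<alpha> \<mu> f K) (\<lambda>i s. ratio \<alpha> f K D s i) L) s"
    proof (cases "?q s = 0")
      case False
      then have q: "0 < ?q s" using envelope_nonneg[OF finK, of \<alpha> f s] by simp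
      have "?Q s \<le> ?q s \<longleftrightarrow> (\<forall>(i, b)\<in>L. (b powr (1 / \<alpha>) * f (D i) s) powr \<alpha> \<le> ?q s)"
        using q by (subst envelope_le_iff[OF finL]) auto
      also have "\<dots> \<longleftrightarrow> (\<forall>(i, b)\<in>L. b * ratio \<alpha> f K D s i \<le> 1)"
      proof (intro ball_cong refl, clarify)
        fix i b assume "(i, b) \<in> L"
        then have b: "0 < b" by (rule positive_weightsD[OF L])
        have "(b powr (1 / \<alpha>) * f (D i) s) powr \<alpha> = b * f (D i) s powr \<alpha>"
          using b assms(1) L_plusD(2)[OF f s] by (simp add: powr_mult powr_powr)
        then show "((b powr (1 / \<alpha>) * f (D i) s) powr \<alpha> \<le> ?q s) = (b * ratio \<alpha> f K D s i \<le> 1)"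
          using q by (simp add: ratio_def divide_le_eq)
      qed
      finally show ?thesis using s by (simp add: box_event_def indicator_def)
    qed simp
  qed
  also have "\<dots> = measure (weighted \<alpha> \<mu> f K) (box_event (weighted \<alpha> \<mu> f K) (\<lambda>i s. ratio \<alpha> f K D s i) L)"
    by (rule weighted_measure(3)[OF K f box_sets, symmetric])
  finally have lim: "(\<integral>s. ?q s * of_bool (?Q s \<le> ?q s) \<partial>\<mu>)
      = measure (weighted \<alpha> \<mu> f K) (box_event (weighted \<alpha> \<mu> f K) (\<lambda>i s. ratio \<alpha> f K D s i) L)" .
  have pos: "0 < 1 + 1 / real (Suc k)" for k by (simp add: add_pos_pos)
  show ?thesis
    unfolding lim[symmetric] lhs[OF pos] base
    by (rule tendsto_right_derivative_max)
       (simp_all add: integrable_envelope K L' f envelope_nonneg finK finL)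
qed

text \<open>Equal exponents give equal difference quotients, hence equal box probabilities.\<close>

lemma distr_ratio_eq:
  fixes f :: "'t \<Rightarrow> 's \<Rightarrow> real" and f' :: "'t \<Rightarrow> 's2 \<Rightarrow> real" and D :: "nat \<Rightarrow> 't"
  assumes \<alpha>: "0 < \<alpha>" and K: "positive_weights K"
    and f: "\<And>t. f t \<in> L_plus \<alpha> \<mu>" and f': "\<And>t. f' t \<in> L_plus \<alpha> \<mu>'"
    and eq: "\<And>K. positive_weights K \<Longrightarrow> exponent \<alpha> \<mu> f K = exponent \<alpha> \<mu>' f' K"
  shows "distr (weighted \<alpha> \<mu> f K) (\<Pi>\<^sub>M i\<in>UNIV. borel) (ratio \<alpha> f K D)
    = distr (weighted \<alpha> \<mu>' f' K) (\<Pi>\<^sub>M i\<in>UNIV. borel) (ratio \<alpha> f' K D)"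
proof -
  have "distr (weighted \<alpha> \<mu> f K) (\<Pi>\<^sub>M i\<in>UNIV. borel) (\<lambda>s i. ratio \<alpha> f K D s i)
    = distr (weighted \<alpha> \<mu>' f' K) (\<Pi>\<^sub>M i\<in>UNIV. borel) (\<lambda>s i. ratio \<alpha> f' K D s i)"
  proof (rule distr_eqI_box_events)
    show "finite_measure (weighted \<alpha> \<mu> f K)" "finite_measure (weighted \<alpha> \<mu>' f' K)"
      by (rule weighted_measure(2)[OF K f sets.top], rule weighted_measure(2)[OF K f' sets.top])
    show "(\<lambda>s. ratio \<alpha> f K D s i) \<in> borel_measurable (weighted \<alpha> \<mu> f K)" for i
      using ratio_measurable[OF K f] by (simp cong: measurable_cong_sets)
    show "(\<lambda>s. ratio \<alpha> f' K D s i) \<in> borel_measurable (weighted \<alpha> \<mu>' f' K)" for i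
      using ratio_measurable[OF K f'] by (simp cong: measurable_cong_sets)
    show "AE s in weighted \<alpha> \<mu> f K. 0 \<le> ratio \<alpha> f K D s i" "AE s in weighted \<alpha> \<mu>' f' K. 0 \<le> ratio \<alpha> f' K D s i" for i
      by (simp_all add: ratio_def envelope_nonneg positive_weights_finite[OF K])
    fix L :: "(nat \<times> real) set" assume L: "positive_weights L"
    let ?L = "(\<lambda>(i, b). (D i, b powr (1 / \<alpha>))) ` L"
    have L': "positive_weights ?L"
      by (rule positive_weights_powr[OF L])
    have Kc: "positive_weights ((\<lambda>(t, a). (t, (1 + 1 / real (Suc k)) powr (1 / \<alpha>) * a)) ` K)" for k
    proof (rule positive_weights_image[OF K])
      fix t a assume "(t, a) \<in> K"
      then have "0 < a" by (rule positive_weightsD[OF K])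
      moreover have "0 < 1 + 1 / real (Suc k)" by (simp add: add_pos_pos)
      ultimately show "0 < (1 + 1 / real (Suc k)) powr (1 / \<alpha>) * a" by simp
    qed
    have "(\<lambda>k. real (Suc k) *
      ((\<integral>s. envelope \<alpha> f' ((\<lambda>(t, a). (t, (1 + 1 / real (Suc k)) powr (1 / \<alpha>) * a)) ` K \<union> ?L) s \<partial>\<mu>')
        - exponent \<alpha> \<mu>' f' (K \<union> ?L)))
      \<longlonglongrightarrow> measure (weighted \<alpha> \<mu> f K) (box_event (weighted \<alpha> \<mu> f K) (\<lambda>i s. ratio \<alpha> f K D s i) L)"
      using weighted_ratio_box[where f = f and D = D, OF \<alpha> K f L]
      unfolding eq[OF positive_weights_Un[OF Kc L']] eq[OF positive_weights_Un[OF K L']] .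
    then show "measure (weighted \<alpha> \<mu> f K) (box_event (weighted \<alpha> \<mu> f K) (\<lambda>i s. ratio \<alpha> f K D s i) L)
      = measure (weighted \<alpha> \<mu>' f' K) (box_event (weighted \<alpha> \<mu>' f' K) (\<lambda>i s. ratio \<alpha> f' K D s i) L)"
      by (rule LIMSEQ_unique) (rule weighted_ratio_box[where f = f' and D = D, OF \<alpha> K f' L])
  qed
  then show ?thesis by simp
qed

text \<open>Choose Borel sets \<open>C i\<close> inside the images of the \<open>A i\<close>, restricted to \<open>G\<close>, that carry all of their mass.
  Together they have full measure for the common law, so \<open>R'\<close> takes values in them almost surely; by
  separation a point of \<open>A' j\<close> can only be sent to \<open>C j\<close>.\<close>

lemma measure_eq_of_separated_images:
  fixes R :: "'s \<Rightarrow> nat \<Rightarrow> real" and R' :: "'s2 \<Rightarrow> nat \<Rightarrow> real"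
  assumes N: "standard_borel N" "finite_measure N" and N': "finite_measure N'"
    and R: "\<And>i. (\<lambda>s. R s i) \<in> borel_measurable N" and R': "\<And>i. (\<lambda>s. R' s i) \<in> borel_measurable N'"
    and law: "distr N (\<Pi>\<^sub>M i\<in>UNIV. borel) R = distr N' (\<Pi>\<^sub>M i\<in>UNIV. borel) R'"
    and J: "finite J"
    and A: "\<And>j. j \<in> J \<Longrightarrow> A j \<in> sets N" "AE s in N. s \<in> (\<Union>j\<in>J. A j)"
    and A': "\<And>j. j \<in> J \<Longrightarrow> A' j \<in> sets N'" "AE s in N'. s \<in> (\<Union>j\<in>J. A' j)"
    and G: "AE s in N. s \<in> G" and G': "AE s in N'. s \<in> G'"
    and sep: "\<And>i j s u. i \<in> J \<Longrightarrow> j \<in> J \<Longrightarrow> s \<in> A i \<inter> G \<Longrightarrow> u \<in> A j \<inter> G \<Longrightarrow> R s = R u \<Longrightarrow> i = j"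
    and sep': "\<And>i j s u. i \<in> J \<Longrightarrow> j \<in> J \<Longrightarrow> s \<in> A i \<inter> G \<Longrightarrow> u \<in> A' j \<inter> G' \<Longrightarrow> R s = R' u \<Longrightarrow> i = j"
    and j: "j \<in> J"
  shows "measure N (A j) = measure N' (A' j)"
proof -
  interpret N: finite_measure N by fact
  interpret N': finite_measure N' by fact
  let ?P = "\<Pi>\<^sub>M i\<in>(UNIV::nat set). (borel :: real measure)"
  have Rm: "R \<in> measurable N ?P"
    using measurable_PiM_single'[of UNIV "\<lambda>i s. R s i" N "\<lambda>_. borel"] R by (simp add: PiE_def)
  have R'm: "R' \<in> measurable N' ?P"
    using measurable_PiM_single'[of UNIV "\<lambda>i s. R' s i" N' "\<lambda>_. borel"] R' by (simp add: PiE_def)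
  obtain B where B: "{s \<in> space N. \<not> s \<in> G} \<subseteq> B" "B \<in> null_sets N"
    using G by (auto simp: eventually_ae_filter)
  have "\<exists>C. C \<in> sets borel \<and> C \<subseteq> R ` (A i - B) \<and> (AE s in N. s \<in> A i - B \<longrightarrow> R s \<in> C)" if "i \<in> J" for i
  proof -
    have AB: "A i - B \<in> sets N" using A(1)[OF that] B(2) by auto
    obtain C where "C \<in> sets borel" "C \<subseteq> R ` (A i - B)" "AE s in N. s \<in> A i - B \<longrightarrow> R s \<in> C"
      by (rule standard_borel_image_contains_full_borel_set[OF N R AB]) (rule that)
    then show ?thesis by blast
  qed
  then have "\<forall>i\<in>J. \<exists>C. C \<in> sets borel \<and> C \<subseteq> R ` (A i - B) \<and> (AE s in N. s \<in> A i - B \<longrightarrow> R s \<in> C)" by blast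
  from bchoice[OF this] obtain C where C': "\<forall>i\<in>J. C i \<in> sets borel \<and> C i \<subseteq> R ` (A i - B)
      \<and> (AE s in N. s \<in> A i - B \<longrightarrow> R s \<in> C i)" by blast
  have C: "C i \<in> sets ?P" "AE s in N. s \<in> A i - B \<longrightarrow> R s \<in> C i" if "i \<in> J" for i
    using bspec[OF C' that] by (simp_all add: sets_PiM_equal_borel)
  have Cimg: "\<exists>u\<in>A i \<inter> G. r = R u" if i: "i \<in> J" and r: "r \<in> C i" for i r
  proof -
    obtain u where u: "u \<in> A i - B" "r = R u" using bspec[OF C' i] r by blast
    moreover have "u \<in> space N" using u(1) A(1)[OF i] sets.sets_into_space by blast
    ultimately have "u \<in> G" using B(1) by blast
    with u show ?thesis by blast
  qed
  have full: "AE s in N. \<forall>i\<in>J. s \<in> A i \<longrightarrow> R s \<in> C i"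
  proof (rule AE_finite_allI[OF J])
    fix i assume "i \<in> J"
    show "AE s in N. s \<in> A i \<longrightarrow> R s \<in> C i"
      using C(2)[OF \<open>i \<in> J\<close>] AE_not_in[OF B(2)] by eventually_elim blast
  qed
  have "(\<Union>i\<in>J. C i) \<in> sets ?P" using C(1) J by auto
  moreover from sets.sets_into_space[OF this]
  have "{r \<in> space ?P. r \<in> (\<Union>i\<in>J. C i)} = (\<Union>i\<in>J. C i)" by blast
  ultimately have UC: "{r \<in> space ?P. r \<in> (\<Union>i\<in>J. C i)} \<in> sets ?P" by simp
  have "AE s in N. R s \<in> (\<Union>i\<in>J. C i)" using full A(2) by eventually_elim blast
  then have "AE r in distr N ?P R. r \<in> (\<Union>i\<in>J. C i)"
    by (subst AE_distr_iff[OF Rm UC])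
  then have full': "AE s in N'. R' s \<in> (\<Union>i\<in>J. C i)"
    unfolding law by (subst (asm) AE_distr_iff[OF R'm UC])
  have m: "R -` C j \<inter> space N \<in> sets N" "R' -` C j \<inter> space N' \<in> sets N'"
    using measurable_sets[OF Rm C(1)[OF j]] measurable_sets[OF R'm C(1)[OF j]] by auto
  have "measure N (A j) = measure N (R -` C j \<inter> space N)"
  proof (rule N.finite_measure_eq_AE)
    show "AE s in N. s \<in> A j \<longleftrightarrow> s \<in> R -` C j \<inter> space N"
      using full A(2) G AE_space[of N]
    proof eventually_elim
      case (elim s)
      show ?case
      proof
        assume "s \<in> A j" with elim j show "s \<in> R -` C j \<inter> space N" by blast
      next
        assume "s \<in> R -` C j \<inter> space N"
        then obtain u where u: "u \<in> A j \<inter> G" "R s = R u" using Cimg[OF j] by blast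
        obtain i where i: "i \<in> J" "s \<in> A i" using elim by blast
        have "i = j" using sep[OF i(1) j _ u(1) u(2)] i elim by blast
        with i show "s \<in> A j" by simp
      qed
    qed
  qed (use A(1)[OF j] m in auto)
  also have "\<dots> = measure (distr N ?P R) (C j)" by (simp add: measure_distr[OF Rm C(1)[OF j]])
  also have "\<dots> = measure N' (R' -` C j \<inter> space N')" unfolding law by (simp add: measure_distr[OF R'm C(1)[OF j]])
  also have "\<dots> = measure N' (A' j)"
  proof (rule N'.finite_measure_eq_AE)
    show "AE s in N'. s \<in> R' -` C j \<inter> space N' \<longleftrightarrow> s \<in> A' j"
      using full' A'(2) G' AE_space[of N']
    proof eventually_elim
      case (elim s)
      show ?case
      proof
        assume "s \<in> A' j"
        obtain i where i: "i \<in> J" "R' s \<in> C i" using elim by blast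
        obtain u where u: "u \<in> A i \<inter> G" "R' s = R u" using Cimg[OF i] by blast
        have "i = j" using sep'[OF i(1) j u(1) _ u(2)[symmetric]] \<open>s \<in> A' j\<close> elim by blast
        with i elim show "s \<in> R' -` C j \<inter> space N'" by blast
      next
        assume "s \<in> R' -` C j \<inter> space N'"
        then obtain u where u: "u \<in> A j \<inter> G" "R' s = R u" using Cimg[OF j] by blast
        obtain i where i: "i \<in> J" "s \<in> A' i" using elim by blast
        have "j = i" using sep'[OF j i(1) u(1) _ u(2)[symmetric]] i elim by blast
        with i show "s \<in> A' j" by simp
      qed
    qed
  qed (use A'(1)[OF j] m in auto)
  finally show ?thesis .
qed

section \<open>Uniqueness and independence of the components\<close>

lemma ae_class_cong:
  assumes "AE t in lam. g t = h t"
  shows "ae_class lam g = ae_class lam h"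
proof -
  have "(AE t in lam. g t = k t) \<longleftrightarrow> (AE t in lam. h t = k t)" for k
    using assms by (intro eventually_subst) (auto elim: eventually_mono)
  then show ?thesis by (simp add: ae_class_def)
qed

text \<open>By closure under scaling the class of \<open>g\<close> lies in both cones, which share only the zero class.\<close>

lemma cone_index_unique:
  assumes cones: "disjoint_cones lam n P" and ij: "i \<in> {1..n}" "j \<in> {1..n}"
    and g: "g \<in> nonneg_measurable lam" "ae_class lam g \<in> P i"
    and h: "h \<in> nonneg_measurable lam" "ae_class lam h \<in> P j"
    and c: "0 \<le> c" "AE t in lam. g t = c * h t"
    and nz: "\<not> (AE t in lam. g t = 0)"
  shows "i = j"
proof (rule ccontr)
  assume "i \<noteq> j"
  have "ae_class lam (\<lambda>t. c * h t) \<in> P j"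
    using cones ij(2) h c(1) unfolding disjoint_cones_def positive_cone_def by blast
  then have "ae_class lam g \<in> P i \<inter> P j" using g(2) ae_class_cong[OF c(2)] by simp
  also have "P i \<inter> P j = {ae_class lam (\<lambda>_. 0)}"
    using cones ij \<open>i \<noteq> j\<close> unfolding disjoint_cones_def by blast
  finally have "ae_class lam g = ae_class lam (\<lambda>_. 0)" by simp
  moreover have "g \<in> ae_class lam g" using g(1) by (simp add: ae_class_def)
  ultimately have "AE t in lam. (0::real) = g t" by (simp add: ae_class_def)
  then have "AE t in lam. g t = 0" by (rule eventually_mono) simp
  with nz show False by simp
qed

text \<open>Equal ratios mean that the \<open>\<alpha>\<close>-th powers are proportional along \<open>D\<close>, with the quotient of the envelopes
  as factor; proportionality passes to the limits.\<close>

lemma proportional_of_ratio_eq: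
  fixes f :: "'t \<Rightarrow> 's \<Rightarrow> real" and f' :: "'t \<Rightarrow> 's2 \<Rightarrow> real"
  assumes \<alpha>: "0 < \<alpha>" and nn: "\<And>t. 0 \<le> f t s" "\<And>t. 0 \<le> f' t u"
    and q: "0 < envelope \<alpha> f K s" "0 < envelope \<alpha> f' K u"
    and eq: "ratio \<alpha> f K D s = ratio \<alpha> f' K D u"
    and rec: "AE t in lam. (\<lambda>k. f (D (\<tau> k t)) s powr \<alpha>) \<longlonglongrightarrow> f t s powr \<alpha>"
    and rec': "AE t in lam. (\<lambda>k. f' (D (\<tau> k t)) u powr \<alpha>) \<longlonglongrightarrow> f' t u powr \<alpha>"
  shows "\<exists>c\<ge>0. AE t in lam. f t s = c * f' t u"
proof -
  define c where "c = envelope \<alpha> f K s / envelope \<alpha> f' K u"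
  have c: "0 < c" using q by (simp add: c_def)
  have D: "f (D i) s powr \<alpha> = c * f' (D i) u powr \<alpha>" for i
    using fun_cong[OF eq, of i] q by (simp add: ratio_def c_def field_simps)
  have "AE t in lam. f t s = c powr (1 / \<alpha>) * f' t u"
    using rec rec'
  proof eventually_elim
    case (elim t)
    have "(\<lambda>k. f (D (\<tau> k t)) s powr \<alpha>) \<longlonglongrightarrow> c * f' t u powr \<alpha>"
      unfolding D by (intro tendsto_mult tendsto_const elim)
    with elim(1) have "f t s powr \<alpha> = c * f' t u powr \<alpha>" by (rule LIMSEQ_unique)
    also have "\<dots> = (c powr (1 / \<alpha>) * f' t u) powr \<alpha>"
      using c \<alpha> nn(2)[of t] by (simp add: powr_mult powr_powr)
    finally have "(f t s powr \<alpha>) powr (1 / \<alpha>) = ((c powr (1 / \<alpha>) * f' t u) powr \<alpha>) powr (1 / \<alpha>)" by simp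
    then show ?case using \<alpha> nn(1)[of t] nn(2)[of t] c by (simp add: powr_powr)
  qed
  then show ?thesis using c by (intro exI[of _ "c powr (1 / \<alpha>)"]) simp
qed

lemma cospectralD:
  assumes "cospectral_decomposition lam n P \<mu> f S"
  shows "j \<in> {1..n} \<Longrightarrow> S j \<in> sets \<mu>" "j \<in> {1..n} \<Longrightarrow> s \<in> S j \<Longrightarrow> ae_class lam (\<lambda>t. f t s) \<in> P j"
    "j \<in> {1..n} \<Longrightarrow> s \<in> S j \<Longrightarrow> s \<in> space \<mu>"
    "AE s in \<mu>. s \<in> (\<Union>j\<in>{1..n}. S j)"
proof -
  have *: "\<forall>j\<in>{1..n}. S j \<in> sets \<mu> \<and> S j \<subseteq> {s \<in> space \<mu>. ae_class lam (\<lambda>t. f t s) \<in> P j}"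
    "emeasure \<mu> (space \<mu> - (\<Union>j\<in>{1..n}. S j)) = 0"
    using assms by (auto simp: cospectral_decomposition_def)
  show "j \<in> {1..n} \<Longrightarrow> S j \<in> sets \<mu>" "j \<in> {1..n} \<Longrightarrow> s \<in> S j \<Longrightarrow> ae_class lam (\<lambda>t. f t s) \<in> P j"
    "j \<in> {1..n} \<Longrightarrow> s \<in> S j \<Longrightarrow> s \<in> space \<mu>"
    using *(1) by blast+
  have "space \<mu> - (\<Union>j\<in>{1..n}. S j) \<in> null_sets \<mu>"
    using * by (intro null_setsI) auto
  from AE_not_in[OF this] AE_space show "AE s in \<mu>. s \<in> (\<Union>j\<in>{1..n}. S j)"
    by eventually_elim blast
qed

lemma nonneg_measurable_section:
  assumes "jointly_measurable \<mu> f" "sets lam = sets borel" "\<And>t. f t \<in> L_plus \<alpha> \<mu>" "s \<in> space \<mu>"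
  shows "(\<lambda>t. f t s) \<in> nonneg_measurable lam"
  using jointly_measurable_section(1)[OF assms(1,2,4)] L_plusD(2)[OF assms(3,4)]
  by (simp add: nonneg_measurable_def)

text \<open>The exponent of a component is the mass of its set under \<open>weighted\<close>.  Points of \<open>S i\<close> and \<open>S' k\<close> with
  the same ratios have proportional co-spectral functions, and the one from \<open>f\<close> is nonzero, so that
  \<open>i = k\<close>.\<close>

lemma component_exponent_eq:
  fixes f :: "'t::topological_space \<Rightarrow> 's \<Rightarrow> real" and f' :: "'t \<Rightarrow> 's2 \<Rightarrow> real"
  assumes \<alpha>: "0 < \<alpha>" and lam: "sets lam = sets borel" "sigma_finite_measure lam"
    and cones: "disjoint_cones lam n P"
    and \<mu>: "standard_lebesgue \<mu>" and \<mu>': "standard_lebesgue \<mu>'"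
    and f: "\<And>t. f t \<in> L_plus \<alpha> \<mu>" and f': "\<And>t. f' t \<in> L_plus \<alpha> \<mu>'"
    and jm: "jointly_measurable \<mu> f" and jm': "jointly_measurable \<mu>' f'"
    and eq: "\<And>K. positive_weights K \<Longrightarrow> exponent \<alpha> \<mu> f K = exponent \<alpha> \<mu>' f' K"
    and nonvanishing: "AE s in \<mu>. \<not> (AE t in lam. f t s = 0)"
    and S: "cospectral_decomposition lam n P \<mu> f S" and S': "cospectral_decomposition lam n P \<mu>' f' S'"
    and j: "j \<in> {1..n}" and K: "positive_weights K"
  shows "(\<integral>s. envelope \<alpha> f K s * indicator (S j) s \<partial>\<mu>) = (\<integral>s. envelope \<alpha> f' K s * indicator (S' j) s \<partial>\<mu>')"
proof -
  have sb: "standard_borel \<mu>" "sigma_finite_measure \<mu>" "standard_borel \<mu>'" "sigma_finite_measure \<mu>'"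
    using \<mu> \<mu>' by (simp_all add: standard_lebesgue_def)
  obtain D :: "nat \<Rightarrow> 't" and \<tau> :: "nat \<Rightarrow> 't \<Rightarrow> nat"
    where \<tau>: "\<And>k. \<tau> k \<in> measurable borel (count_space UNIV)"
      and small: "\<And>k t. rho \<mu> \<alpha> (f t) (f (D (\<tau> k t))) < (1 / 2) ^ k"
    by (rule measurable_selection[where f = f, OF sb(1,2) f jm]) (rule that)
  have rho: "rho \<mu> \<alpha> (f t) (f u) = rho \<mu>' \<alpha> (f' t) (f' u)" for t u
    unfolding rho_eq_envelope[where f = f, OF f] rho_eq_envelope[where f = f', OF f']
    by (simp add: eq positive_weights_def)
  \<comment> \<open>The selection made for \<open>f\<close> serves for \<open>f'\<close> too.\<close>
  have small': "rho \<mu>' \<alpha> (f' t) (f' (D (\<tau> k t))) < (1 / 2) ^ k" for k t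
    using small[of t k] by (simp add: rho)
  define rec where "rec s \<longleftrightarrow> (AE t in lam. (\<lambda>k. f (D (\<tau> k t)) s powr \<alpha>) \<longlonglongrightarrow> f t s powr \<alpha>)" for s
  define rec' where "rec' s \<longleftrightarrow> (AE t in lam. (\<lambda>k. f' (D (\<tau> k t)) s powr \<alpha>) \<longlonglongrightarrow> f' t s powr \<alpha>)" for s
  have rec: "AE s in \<mu>. rec s"
    unfolding rec_def by (rule AE_recovered_from_selection[where f = f, OF lam sb(2) f jm \<tau> small])
  have rec': "AE s in \<mu>'. rec' s"
    unfolding rec'_def by (rule AE_recovered_from_selection[where f = f', OF lam sb(4) f' jm' \<tau> small'])
  let ?G = "{s \<in> space \<mu>. 0 < envelope \<alpha> f K s \<and> rec s \<and> \<not> (AE t in lam. f t s = 0)}"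
  let ?G' = "{s \<in> space \<mu>'. 0 < envelope \<alpha> f' K s \<and> rec' s}"
  let ?N = "weighted \<alpha> \<mu> f K" and ?N' = "weighted \<alpha> \<mu>' f' K"
  have "measure ?N (S j) = measure ?N' (S' j)"
  proof (rule measure_eq_of_separated_images[where J = "{1..n}" and G = ?G and G' = ?G'
        and R = "ratio \<alpha> f K D" and R' = "ratio \<alpha> f' K D"])
    show "standard_borel ?N" using sb(1) by (simp add: standard_borel_def)
    show "finite_measure ?N" "finite_measure ?N'"
      by (rule weighted_measure(2)[where f = f, OF K f sets.top], rule weighted_measure(2)[where f = f', OF K f' sets.top])
    show "(\<lambda>s. ratio \<alpha> f K D s i) \<in> borel_measurable ?N" for i
      using ratio_measurable[where f = f, OF K f] by (simp cong: measurable_cong_sets)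
    show "(\<lambda>s. ratio \<alpha> f' K D s i) \<in> borel_measurable ?N'" for i
      using ratio_measurable[where f = f', OF K f'] by (simp cong: measurable_cong_sets)
    show "distr ?N (\<Pi>\<^sub>M i\<in>UNIV. borel) (ratio \<alpha> f K D) = distr ?N' (\<Pi>\<^sub>M i\<in>UNIV. borel) (ratio \<alpha> f' K D)"
      by (rule distr_ratio_eq[where f = f and f' = f', OF \<alpha> K f f' eq])
    show "i \<in> {1..n} \<Longrightarrow> S i \<in> sets ?N" "i \<in> {1..n} \<Longrightarrow> S' i \<in> sets ?N'" for i
      using cospectralD(1)[OF S] cospectralD(1)[OF S'] by simp_all
    show "AE s in ?N. s \<in> (\<Union>j\<in>{1..n}. S j)" "AE s in ?N'. s \<in> (\<Union>j\<in>{1..n}. S' j)"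
      using cospectralD(4)[OF S] cospectralD(4)[OF S']
      by (auto simp: AE_weighted[where f = f, OF K f] AE_weighted[where f = f', OF K f'] elim: eventually_mono)
    show "AE s in ?N. s \<in> ?G"
      unfolding AE_weighted[where f = f, OF K f]
      using rec nonvanishing AE_space by eventually_elim simp
    show "AE s in ?N'. s \<in> ?G'"
      unfolding AE_weighted[where f = f', OF K f']
      using rec' AE_space by eventually_elim simp
    fix i k assume ik: "i \<in> {1..n}" "k \<in> {1..n}"
    show "i = k" if s: "s \<in> S i \<inter> ?G" and u: "u \<in> S k \<inter> ?G" and R: "ratio \<alpha> f K D s = ratio \<alpha> f K D u" for s u
    proof -
      have "\<exists>c\<ge>0. AE t in lam. f t s = c * f t u"
        using s u L_plusD(2)[OF f] unfolding rec_def
        by (intro proportional_of_ratio_eq[OF \<alpha> _ _ _ _ R]) auto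
      then obtain c where c: "0 \<le> c" "AE t in lam. f t s = c * f t u" by blast
      show ?thesis
        by (rule cone_index_unique[OF cones ik _ cospectralD(2)[OF S ik(1)] _ cospectralD(2)[OF S ik(2)] c])
           (use s u in \<open>auto intro: nonneg_measurable_section[OF jm lam(1) f]\<close>)
    qed
    show "i = k" if s: "s \<in> S i \<inter> ?G" and u: "u \<in> S' k \<inter> ?G'" and R: "ratio \<alpha> f K D s = ratio \<alpha> f' K D u" for s u
    proof -
      have "\<exists>c\<ge>0. AE t in lam. f t s = c * f' t u"
        using s u L_plusD(2)[OF f] L_plusD(2)[OF f'] unfolding rec_def rec'_def
        by (intro proportional_of_ratio_eq[OF \<alpha> _ _ _ _ R]) auto
      then obtain c where c: "0 \<le> c" "AE t in lam. f t s = c * f' t u" by blast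
      show ?thesis
        by (rule cone_index_unique[OF cones ik _ cospectralD(2)[OF S ik(1)] _ cospectralD(2)[OF S' ik(2)] c])
           (use s u in \<open>auto intro: nonneg_measurable_section[OF jm lam(1) f] nonneg_measurable_section[OF jm' lam(1) f']\<close>)
    qed
  qed (use j in simp_all)
  then show ?thesis
    unfolding weighted_measure(3)[where f = f, OF K f cospectralD(1)[OF S j]]
      weighted_measure(3)[where f = f', OF K f' cospectralD(1)[OF S' j]] .
qed

lemma envelope_indicator:
  assumes "finite K"
  shows "envelope \<alpha> (\<lambda>t s. f t s * indicator A s) K s = envelope \<alpha> f K s * indicator A s"
  using envelope_nonneg[OF assms, of \<alpha> f s]
  by (cases "s \<in> A") (auto simp: assms envelope_le_iff intro!: envelope_eqI)

lemma AE_components_disjoint: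
  assumes cones: "disjoint_cones lam n P" and S: "cospectral_decomposition lam n P \<mu> f S"
    and lam: "sets lam = sets borel" and f: "\<And>t. f t \<in> L_plus \<alpha> \<mu>" and jm: "jointly_measurable \<mu> f"
    and nonvanishing: "AE s in \<mu>. \<not> (AE t in lam. f t s = 0)"
  shows "AE s in \<mu>. \<forall>i\<in>{1..n}. \<forall>j\<in>{1..n}. s \<in> S i \<longrightarrow> s \<in> S j \<longrightarrow> i = j"
  using nonvanishing
proof eventually_elim
  case (elim s)
  show ?case
  proof (intro ballI impI)
    fix i j assume ij: "i \<in> {1..n}" "j \<in> {1..n}" and s: "s \<in> S i" "s \<in> S j"
    have "(\<lambda>t. f t s) \<in> nonneg_measurable lam"
      by (rule nonneg_measurable_section[OF jm lam f cospectralD(3)[OF S ij(1) s(1)]])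
    from cone_index_unique[OF cones ij this cospectralD(2)[OF S ij(1) s(1)] this cospectralD(2)[OF S ij(2) s(2)], of 1]
    show "i = j" using elim by simp
  qed
qed

text \<open>Weights for the components as one process indexed by \<open>(j, t)\<close>.\<close>

abbreviation pair_weights :: "nat set \<Rightarrow> (nat \<Rightarrow> ('t \<times> real) set) \<Rightarrow> ((nat \<times> 't) \<times> real) set" where
  "pair_weights J K \<equiv> (\<Union>j\<in>J. (\<lambda>(t, a). ((j, t), a)) ` K j)"

lemma pair_weights_positive:
  assumes "finite J" "\<And>j. j \<in> J \<Longrightarrow> positive_weights (K j)"
  shows "positive_weights (pair_weights J K)"
  unfolding positive_weights_def
proof (intro conjI ballI)
  show "finite (pair_weights J K)"
    using assms positive_weights_finite by blast
  fix p assume "p \<in> pair_weights J K"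
  then obtain j t a where "j \<in> J" "(t, a) \<in> K j" "p = ((j, t), a)" by auto
  then show "case p of (i, a) \<Rightarrow> 0 < a" using positive_weightsD[OF assms(2)] by simp
qed

lemma box_pair_weights:
  "box_event Pr (\<lambda>(j, t). Y j t) (pair_weights J K)
    = {\<omega> \<in> space Pr. \<forall>j\<in>J. \<omega> \<in> box_event Pr (Y j) (K j)}"
  by (auto simp: box_event_def split_beta)

text \<open>At most one term of the sum is nonzero, so the sum is the maximum.\<close>

lemma envelope_pair_weights:
  assumes J: "finite J" "\<And>j. j \<in> J \<Longrightarrow> finite (K j)"
    and disj: "\<And>i j. i \<in> J \<Longrightarrow> j \<in> J \<Longrightarrow> s \<in> S i \<Longrightarrow> s \<in> S j \<Longrightarrow> i = j"
  shows "envelope \<alpha> (\<lambda>(j, t) s. f t s * indicator (S j) s) (pair_weights J K) s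
    = (\<Sum>j\<in>J. envelope \<alpha> f (K j) s * indicator (S j) s)"
proof (cases "\<exists>j\<in>J. s \<in> S j")
  case True
  then obtain j where j: "j \<in> J" "s \<in> S j" by blast
  have "(\<Sum>i\<in>J. envelope \<alpha> f (K i) s * indicator (S i) s) = (\<Sum>i\<in>{j}. envelope \<alpha> f (K i) s * indicator (S i) s)"
    using j J(1) disj by (intro sum.mono_neutral_right) (auto simp: indicator_def)
  also have "\<dots> = envelope \<alpha> f (K j) s" using j by simp
  also have "\<dots> = envelope \<alpha> (\<lambda>(j, t) s. f t s * indicator (S j) s) (pair_weights J K) s"
  proof (rule envelope_eqI[symmetric])
    show "0 \<le> envelope \<alpha> f (K j) s" by (rule envelope_nonneg[OF J(2)[OF j(1)]])
    show "finite (pair_weights J K)" using J by simp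
    fix c :: real assume c: "0 \<le> c"
    show "envelope \<alpha> f (K j) s \<le> c \<longleftrightarrow>
      (\<forall>(i, a)\<in>pair_weights J K. (a * (case i of (j, t) \<Rightarrow> \<lambda>s. f t s * indicator (S j) s) s) powr \<alpha> \<le> c)"
    proof
      assume le: "envelope \<alpha> f (K j) s \<le> c"
      show "\<forall>(i, a)\<in>pair_weights J K. (a * (case i of (j, t) \<Rightarrow> \<lambda>s. f t s * indicator (S j) s) s) powr \<alpha> \<le> c"
      proof clarsimp
        fix i t a assume i: "i \<in> J" "(t, a) \<in> K i"
        show "(a * (f t s * indicator (S i) s)) powr \<alpha> \<le> c"
        proof (cases "s \<in> S i")
          case True
          then have "i = j" using disj i j by blast
          then show ?thesis
            using envelope_ge[OF J(2)[OF i(1)] i(2), of f s \<alpha>] le True by simp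
        qed (use c in simp)
      qed
    next
      assume *: "\<forall>(i, a)\<in>pair_weights J K. (a * (case i of (j, t) \<Rightarrow> \<lambda>s. f t s * indicator (S j) s) s) powr \<alpha> \<le> c"
      have "(a * f t s) powr \<alpha> \<le> c" if "(t, a) \<in> K j" for t a
      proof -
        have "((j, t), a) \<in> pair_weights J K" using j that by force
        from bspec[OF * this] j show ?thesis by simp
      qed
      then show "envelope \<alpha> f (K j) s \<le> c" using c by (subst envelope_le_iff[OF J(2)[OF j(1)]]) auto
    qed
  qed
  finally show ?thesis by simp
next
  case False
  have "envelope \<alpha> (\<lambda>(j, t) s. f t s * indicator (S j) s) (pair_weights J K) s = 0"
    using False J by (intro envelope_eqI) auto
  also have "0 = (\<Sum>j\<in>J. envelope \<alpha> f (K j) s * indicator (S j) s)" using False by simp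
  finally show ?thesis .
qed

theorem theorem5p2:
  fixes \<alpha> :: real
    and lam :: "'t::{metric_space, second_countable_topology} measure"
    and n :: nat and P :: "nat \<Rightarrow> ('t \<Rightarrow> real) set set"
    and PX :: "'x measure" and X :: "'t \<Rightarrow> 'x \<Rightarrow> real"
    and \<mu> :: "'s measure" and f :: "'t \<Rightarrow> 's \<Rightarrow> real" and S :: "nat \<Rightarrow> 's set"
    and Pr :: "'w measure" and M :: "'s set \<Rightarrow> 'w \<Rightarrow> ennreal"
    and Y :: "nat \<Rightarrow> 't \<Rightarrow> 'w \<Rightarrow> real"
  assumes "0 < \<alpha>"
    and "sets lam = sets borel" and "sigma_finite_measure lam"
    and "1 \<le> n" and "disjoint_cones lam n P"
    and "prob_space PX" and "frechet_process PX \<alpha> X"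
    and "standard_lebesgue \<mu>"
    and "spectral_representation PX \<alpha> X \<mu> f"
    and "jointly_measurable \<mu> f" and "full_support \<alpha> \<mu> f"
    and nonvanishing: "AE s in \<mu>. \<not> (AE t in lam. f t s = 0)"
    and "cospectral_decomposition lam n P \<mu> f S"
    and "prob_space Pr" and "frechet_sup_measure Pr \<alpha> \<mu> M"
    and "induced_components Pr \<alpha> \<mu> M f n S Y"
  shows "process_law PX X = process_law Pr (\<lambda>t \<omega>. MAX j\<in>{1..n}. Y j t \<omega>) \<and>
    (\<forall>(\<mu>' :: 's2 measure) f' S' (Pr' :: 'w2 measure) M' Y'.
       standard_lebesgue \<mu>' \<and>
       spectral_representation PX \<alpha> X \<mu>' f' \<and>
       jointly_measurable \<mu>' f' \<and> full_support \<alpha> \<mu>' f' \<and>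
       cospectral_decomposition lam n P \<mu>' f' S' \<and>
       prob_space Pr' \<and> frechet_sup_measure Pr' \<alpha> \<mu>' M' \<and>
       induced_components Pr' \<alpha> \<mu>' M' f' n S' Y' \<longrightarrow>
       (\<forall>j\<in>{1..n}. process_law Pr (Y j) = process_law Pr' (Y' j))) \<and>
    indep_processes Pr {1..n} Y \<and>
    (\<forall>j\<in>{1..n}. frechet_process Pr \<alpha> (Y j))"
proof -
  note \<alpha> = assms(1) and lam = assms(2,3) and n = assms(4) and cones = assms(5)
    and PX = assms(6) and X = assms(7) and \<mu> = assms(8) and rep = assms(9) and jm = assms(10)
    and S = assms(13) and Pr = assms(14) and M = assms(15) and comp = assms(16)
  interpret Pr: prob_space Pr by (rule Pr)
  interpret PX: prob_space PX by (rule PX)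
  have f: "f t \<in> L_plus \<alpha> \<mu>" for t using rep by (simp add: spectral_representation_def)
  have ext: "has_extremal_integral Pr \<alpha> \<mu> M (\<lambda>s. f t s * indicator (S j) s) (Y j t)" if "j \<in> {1..n}" for j t
    using comp that by (simp add: induced_components_def)
  note Y_meas = has_extremal_integralD(2)[OF ext]
  have Y_nonneg: "AE \<omega> in Pr. 0 \<le> Y j t \<omega>" if "j \<in> {1..n}" for j t
    by (rule extremal_integral_nonneg[OF Pr M ext[OF that]])
  have law_X: "spectral_law PX \<alpha> X \<mu> f" by (rule spectral_representation_imp_law[OF rep \<alpha> PX])
  have law_Y: "spectral_law Pr \<alpha> (Y j) \<mu> (\<lambda>t s. f t s * indicator (S j) s)" if "j \<in> {1..n}" for j
    unfolding spectral_law_def using ext[OF that] by (intro allI impI extremal_integral_box[OF Pr M \<alpha>])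
  have disj: "AE s in \<mu>. \<forall>i\<in>{1..n}. \<forall>j\<in>{1..n}. s \<in> S i \<longrightarrow> s \<in> S j \<longrightarrow> i = j"
    by (rule AE_components_disjoint[where f = f, OF cones S lam(1) f jm nonvanishing])
  have env_int: "integrable \<mu> (\<lambda>s. envelope \<alpha> f K s * indicator (S j) s)" if "positive_weights K" "j \<in> {1..n}" for K j
    using integrable_envelope[where g = f, OF that(1) f] cospectralD(1)[OF S that(2)]
    by (intro integrable_real_mult_indicator)
  \<comment> \<open>As the sets \<open>S j\<close> are disjoint, the exponent of several components splits into a sum.\<close>
  have joint: "Pr.prob {\<omega> \<in> space Pr. \<forall>j\<in>J. \<omega> \<in> box_event Pr (Y j) (K j)}
      = exp (- (\<Sum>j\<in>J. \<integral>s. envelope \<alpha> f (K j) s * indicator (S j) s \<partial>\<mu>))"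
    if J: "J \<subseteq> {1..n}" and K: "\<And>j. j \<in> J \<Longrightarrow> positive_weights (K j)" for J K
  proof -
    have fin: "finite J" using J by (rule finite_subset) simp
    have "Pr.prob (box_event Pr (\<lambda>(j, t). Y j t) (pair_weights J K))
        = exp (- exponent \<alpha> \<mu> (\<lambda>(j, t) s. f t s * indicator (S j) s) (pair_weights J K))"
    proof (rule extremal_integral_box[OF Pr M \<alpha> pair_weights_positive[OF fin K]])
      fix p a assume "(p, a) \<in> pair_weights J K"
      then obtain j t where "p = (j, t)" "j \<in> {1..n}" using J by auto
      then show "has_extremal_integral Pr \<alpha> \<mu> M ((case p of (j, t) \<Rightarrow> \<lambda>s. f t s * indicator (S j) s)) (case p of (j, t) \<Rightarrow> Y j t)"
        using ext by simp
    qed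
    also have "exponent \<alpha> \<mu> (\<lambda>(j, t) s. f t s * indicator (S j) s) (pair_weights J K)
        = (\<integral>s. (\<Sum>j\<in>J. envelope \<alpha> f (K j) s * indicator (S j) s) \<partial>\<mu>)"
    proof (rule integral_cong_AE)
      show "AE s in \<mu>. envelope \<alpha> (\<lambda>(j, t) s. f t s * indicator (S j) s) (pair_weights J K) s
          = (\<Sum>j\<in>J. envelope \<alpha> f (K j) s * indicator (S j) s)"
        using disj
      proof eventually_elim
        case (elim s)
        show ?case
          by (rule envelope_pair_weights[OF fin positive_weights_finite[OF K]]) (use elim J in blast)+
      qed
      show "(\<lambda>s. \<Sum>j\<in>J. envelope \<alpha> f (K j) s * indicator (S j) s) \<in> borel_measurable \<mu>"
        using env_int K J by (intro borel_measurable_sum borel_measurable_integrable) auto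
      show "envelope \<alpha> (\<lambda>(j, t) s. f t s * indicator (S j) s) (pair_weights J K) \<in> borel_measurable \<mu>"
      proof (rule measurable_envelope[OF positive_weights_finite[OF pair_weights_positive[OF fin K]]])
        fix p a assume "(p, a) \<in> pair_weights J K"
        then obtain j t where "p = (j, t)" "j \<in> {1..n}" using J by auto
        then show "(case p of (j, t) \<Rightarrow> \<lambda>s. f t s * indicator (S j) s) \<in> borel_measurable \<mu>"
          using L_plusD(1)[OF has_extremal_integralD(1)[OF ext]] by simp
      qed
    qed
    also have "\<dots> = (\<Sum>j\<in>J. \<integral>s. envelope \<alpha> f (K j) s * indicator (S j) s \<partial>\<mu>)"
      using env_int K J by (intro Bochner_Integration.integral_sum) auto
    finally show ?thesis unfolding box_pair_weights .
  qed
  have marginal: "Pr.prob (box_event Pr (Y j) K) = exp (- (\<integral>s. envelope \<alpha> f K s * indicator (S j) s \<partial>\<mu>))"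
    if "j \<in> {1..n}" "positive_weights K" for j K
    using law_Y[OF that(1)] that(2) by (simp add: spectral_law_def envelope_indicator positive_weights_finite)

  have "process_law PX X = process_law Pr (\<lambda>t \<omega>. MAX j\<in>{1..n}. Y j t \<omega>)"
    unfolding process_law_def
  proof (rule distr_eqI_box_events)
    show "finite_measure PX" "finite_measure Pr" by unfold_locales
    show "X t \<in> borel_measurable PX" "AE \<omega> in PX. 0 \<le> X t \<omega>" for t
      by (rule frechet_process_nonneg[OF X])+
    show "(\<lambda>\<omega>. MAX j\<in>{1..n}. Y j t \<omega>) \<in> borel_measurable Pr" for t
      by (intro borel_measurable_Max Y_meas) auto
    show "AE \<omega> in Pr. 0 \<le> (MAX j\<in>{1..n}. Y j t \<omega>)" for t
    proof -
      have one: "1 \<in> {1..n}" using n by simp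
      show ?thesis using Y_nonneg[OF one, of t]
      proof eventually_elim
        case (elim \<omega>)
        have "Y 1 t \<omega> \<le> (MAX j\<in>{1..n}. Y j t \<omega>)" using one by (intro Max_ge) auto
        with elim show ?case by linarith
      qed
    qed
    fix K :: "('t \<times> real) set" assume K: "positive_weights K"
    have "box_event Pr (\<lambda>t \<omega>. MAX j\<in>{1..n}. Y j t \<omega>) K = {\<omega> \<in> space Pr. \<forall>j\<in>{1..n}. \<omega> \<in> box_event Pr (Y j) K}"
    proof -
      have "a * (MAX j\<in>{1..n}. Y j t \<omega>) \<le> 1 \<longleftrightarrow> (\<forall>j\<in>{1..n}. a * Y j t \<omega> \<le> 1)" if "(t, a) \<in> K" for t a \<omega>
      proof -
        have a: "0 < a" by (rule positive_weightsD[OF K that])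
        have "a * (MAX j\<in>{1..n}. Y j t \<omega>) \<le> 1 \<longleftrightarrow> (MAX j\<in>{1..n}. Y j t \<omega>) \<le> 1 / a"
          using a by (simp add: field_simps)
        also have "\<dots> \<longleftrightarrow> (\<forall>j\<in>{1..n}. Y j t \<omega> \<le> 1 / a)" using n by (subst Max_le_iff) auto
        also have "\<dots> \<longleftrightarrow> (\<forall>j\<in>{1..n}. a * Y j t \<omega> \<le> 1)" using a by (simp add: field_simps)
        finally show ?thesis .
      qed
      then show ?thesis unfolding box_event_def by blast
    qed
    then have "Pr.prob (box_event Pr (\<lambda>t \<omega>. MAX j\<in>{1..n}. Y j t \<omega>) K)
        = exp (- (\<Sum>j\<in>{1..n}. \<integral>s. envelope \<alpha> f K s * indicator (S j) s \<partial>\<mu>))"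
      using joint[of "{1..n}" "\<lambda>_. K"] K by simp
    also have "(\<Sum>j\<in>{1..n}. \<integral>s. envelope \<alpha> f K s * indicator (S j) s \<partial>\<mu>)
        = (\<integral>s. (\<Sum>j\<in>{1..n}. envelope \<alpha> f K s * indicator (S j) s) \<partial>\<mu>)"
      using env_int[OF K] by (intro Bochner_Integration.integral_sum[symmetric]) auto
    also have "\<dots> = exponent \<alpha> \<mu> f K"
    proof (rule integral_cong_AE)
      show "AE s in \<mu>. (\<Sum>j\<in>{1..n}. envelope \<alpha> f K s * indicator (S j) s) = envelope \<alpha> f K s"
        using disj cospectralD(4)[OF S]
      proof eventually_elim
        case (elim s)
        then obtain j where j: "j \<in> {1..n}" "s \<in> S j" by blast
        then have "(\<Sum>i\<in>{1..n}. envelope \<alpha> f K s * indicator (S i) s) = (\<Sum>i\<in>{j}. envelope \<alpha> f K s * indicator (S i) s)"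
          using elim(1) by (intro sum.mono_neutral_right) (auto simp: indicator_def)
        then show ?case using j by simp
      qed
      show "(\<lambda>s. \<Sum>j\<in>{1..n}. envelope \<alpha> f K s * indicator (S j) s) \<in> borel_measurable \<mu>"
        using env_int[OF K] by (intro borel_measurable_sum borel_measurable_integrable)
      show "envelope \<alpha> f K \<in> borel_measurable \<mu>"
        by (rule borel_measurable_integrable[OF integrable_envelope[where g = f, OF K f]])
    qed
    finally show "PX.prob (box_event PX X K) = Pr.prob (box_event Pr (\<lambda>t \<omega>. MAX j\<in>{1..n}. Y j t \<omega>) K)"
      using law_X K by (simp add: spectral_law_def)
  qed
  moreover have "process_law Pr (Y j) = process_law Pr' (Y' j)"
    if \<mu>': "standard_lebesgue \<mu>'" and rep': "spectral_representation PX \<alpha> X \<mu>' f'"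
      and jm': "jointly_measurable \<mu>' f'" and S': "cospectral_decomposition lam n P \<mu>' f' S'"
      and Pr': "prob_space Pr'" and M': "frechet_sup_measure Pr' \<alpha> \<mu>' M'"
      and comp': "induced_components Pr' \<alpha> \<mu>' M' f' n S' Y'" and j: "j \<in> {1..n}"
    for \<mu>' :: "'s2 measure" and f' S' and Pr' :: "'w2 measure" and M' Y' j
  proof -
    have f': "f' t \<in> L_plus \<alpha> \<mu>'" for t using rep' by (simp add: spectral_representation_def)
    have ext': "has_extremal_integral Pr' \<alpha> \<mu>' M' (\<lambda>s. f' t s * indicator (S' j) s) (Y' j t)" for t
      using comp' j by (simp add: induced_components_def)
    have law_X': "spectral_law PX \<alpha> X \<mu>' f'" by (rule spectral_representation_imp_law[OF rep' \<alpha> PX])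
    have eq: "exponent \<alpha> \<mu> f K = exponent \<alpha> \<mu>' f' K" if "positive_weights K" for K
      using law_X law_X' that by (simp add: spectral_law_def)
    show ?thesis
    proof (rule spectral_law_process_law_eq[OF Pr Pr' Y_meas[OF j] has_extremal_integralD(2)[OF ext']
          Y_nonneg[OF j] extremal_integral_nonneg[OF Pr' M' ext'] law_Y[OF j]])
      show "spectral_law Pr' \<alpha> (Y' j) \<mu>' (\<lambda>t s. f' t s * indicator (S' j) s)"
        unfolding spectral_law_def using ext' by (intro allI impI extremal_integral_box[OF Pr' M' \<alpha>])
      fix K :: "('t \<times> real) set" assume K: "positive_weights K"
      show "exponent \<alpha> \<mu> (\<lambda>t s. f t s * indicator (S j) s) K
          = exponent \<alpha> \<mu>' (\<lambda>t s. f' t s * indicator (S' j) s) K"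
        unfolding envelope_indicator[OF positive_weights_finite[OF K]]
        by (rule component_exponent_eq[where f = f and f' = f', OF \<alpha> lam cones \<mu> \<mu>' f f' jm jm' eq nonvanishing S S' j K])
    qed
  qed
  moreover have "indep_processes Pr {1..n} Y"
  proof (rule indep_processesI[OF Pr Y_meas Y_nonneg])
    fix J and K :: "nat \<Rightarrow> ('t \<times> real) set"
    assume J: "J \<subseteq> {1..n}" "finite J" "J \<noteq> {}" and K: "\<And>j. j \<in> J \<Longrightarrow> positive_weights (K j)"
    have "(\<Inter>j\<in>J. box_event Pr (Y j) (K j)) = {\<omega> \<in> space Pr. \<forall>j\<in>J. \<omega> \<in> box_event Pr (Y j) (K j)}"
      using J(3) by (auto simp: box_event_def)
    then have "Pr.prob (\<Inter>j\<in>J. box_event Pr (Y j) (K j))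
        = exp (- (\<Sum>j\<in>J. \<integral>s. envelope \<alpha> f (K j) s * indicator (S j) s \<partial>\<mu>))"
      using joint[OF J(1) K] by simp
    also have "\<dots> = (\<Prod>j\<in>J. exp (- (\<integral>s. envelope \<alpha> f (K j) s * indicator (S j) s \<partial>\<mu>)))"
      using J(2) by (simp add: exp_sum sum_negf[symmetric])
    also have "\<dots> = (\<Prod>j\<in>J. Pr.prob (box_event Pr (Y j) (K j)))"
      using J(1) K by (intro prod.cong refl marginal[symmetric]) auto
    finally show "Pr.prob (\<Inter>j\<in>J. box_event Pr (Y j) (K j)) = (\<Prod>j\<in>J. Pr.prob (box_event Pr (Y j) (K j)))" .
  qed
  moreover have "frechet_process Pr \<alpha> (Y j)" if "j \<in> {1..n}" for j
    by (rule spectral_law_frechet_process[OF \<alpha> Pr Y_meas[OF that] Y_nonneg[OF that] law_Y[OF that]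
          has_extremal_integralD(1)[OF ext[OF that]]])
  ultimately show ?thesis by blast
qed

end
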